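(* Let $\psi\in\mathcal{E}(\mathcal{O},R)$ be an optimal embedding with $\tau_{\psi,p}\in A_0$, and let $\phi_\psi\in H^1(\Gamma_0(\mathfrak p),\Lambda)$ be the associated class. The series $$\Phi_\psi^+=\phi_\psi+U_{\mathfrak p}\phi_\psi+U_{\mathfrak p}^2\phi_\psi+U_{\mathfrak p}^3\phi_\psi+U_{\mathfrak p}^4\phi_\psi+\cdots,$$ $$\Phi_\psi^-=-\phi_\psi+U_{\mathfrak p}\phi_\psi-U_{\mathfrak p}^2\phi_\psi+U_{\mathfrak p}^3\phi_\psi-U_{\mathfrak p}^4\phi_\psi+\cdots$$ give rise to well defined cohomology classes in $H^1(\Gamma_0(\mathfrak p),\Lambda)$. In addition, they satisfy $$U_{\mathfrak p}\Phi_\psi^++\phi_\psi=\Phi_\psi^+\qquad\text{and}\qquad U_{\mathfrak p}\Phi_\psi^-+\phi_\psi=-\Phi_\psi^-.$$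
   Context: Setting. $F$ is a totally real number field of narrow class number $1$; $B$ is a quaternion algebra over $F$ that is split at exactly one archimedean place $v_\infty$ of $F$; $\mathfrak p$ is a finite prime of $F$, above the rational prime $p$, at which $B$ is split. $\mathbb{Q}_{\mathfrak p}$ is the completion of $F$ at $\mathfrak p$, $\mathbb{Z}_{\mathfrak p}$ its ring of integers, $\mathbb{F}_{\mathfrak p}=\mathbb{Z}_{\mathfrak p}/\mathfrak p\mathbb{Z}_{\mathfrak p}$, $\mathbb{C}_p$ the completion of an algebraic closure of $\mathbb{Q}_p$, and $\bar{\mathbb{Z}}_{\mathfrak p}$ the ring of integers of $\mathbb{C}_p$. Fix embeddings $\iota_{\mathfrak p}\colon B\hookrightarrow M_2(\mathbb{Q}_{\mathfrak p})$ and $\iota_\infty\colon B\hookrightarrow M_2(\mathbb{R})$ induced by splittings at $\mathfrak p$ and $v_\infty$. $R\subset B$ is a maximal order with $\iota_{\mathfrak p}(R\otimes\mathbb{Z}_{\mathfrak p})=M_2(\mathbb{Z}_{\mathfrak p})$, $R(\mathfrak p)\subset R$ is the Eichler order of level $\mathfrak p$ with $\iota_{\mathfrak p}(R(\mathfrak p)\otimes\mathbb{Z}_{\mathfrak p})=\{\begin{pmatrix}a&b\\c&d\end{pmatrix}\in M_2(\mathbb{Z}_{\mathfrak p}) : c\in\mathfrak p\}$, and $\Gamma_0$, $\Gamma_0(\mathfrak p)$ are the groups of reduced norm $1$ units of $R$ and $R(\mathfrak p)$. $\varpi$ is a totally positive generator of $\mathfrak p$. $\Gamma_0$ acts by fractional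 linear transformations on the complex upper half plane $\mathcal{H}$ and on $\mathbb{P}^1(\mathbb{R})$ via $\iota_\infty$, and $B^\times$ acts on $\mathcal{H}_{\mathfrak p}=\mathbb{P}^1(\mathbb{C}_p)\setminus\mathbb{P}^1(\mathbb{Q}_{\mathfrak p})$ via $\iota_{\mathfrak p}$. The set $$A_0=\{z\in\mathbb{C}_p : |z|\le 1 \text{ and } |z-t|\ge 1 \text{ for all } t\in\mathbb{Z}_{\mathfrak p}\}$$ is preserved by $\Gamma_0$ and by elements of $R$ whose norm is a $\mathfrak p$-adic unit. $\operatorname{Div}$ and $\operatorname{Div}^0$ denote groups of divisors and of degree $0$ divisors. Cohomology $H^1(G,V)$ is inhomogeneous $1$-cocycles ($\varphi(gh)=\varphi(g)+g\varphi(h)$) modulo coboundaries $g\mapsto gv-v$. The class $\varphi_\psi$. $K/F$ is a quadratic extension in which $\mathfrak p$ is inert, $v_\infty$ splits and all other infinite places of $F$ ramify; $\mathcal{O}$ is an $\mathcal{O}_F$-order of $K$; $\mathcal{E}(\mathcal{O},R)$ is the set of $F$-algebra embeddings $\psi\colon K\hookrightarrow B$ with $\psi^{-1}(R)=\mathcal{O}$. Let $u$ be a generator of the free part of the rank one group $\{w\in\mathcal{O}^\times : \mathrm{Norm}_{K/F}(w)=1\}$ and $\gamma_\psi=\psi(u)\in\Gamma_0$. Fix an embedding of $K$ into its completion $K_{\mathfrak p}\subset\mathbb{C}_p$; $\tau_{\psi,p}\in\mathcal{H}_{\mathfrak p}$ is the fixed point of $\iota_{\mathfrak p}(\gamma_\psi)$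 with $\iota_{\mathfrak p}(\psi(a))\binom{\tau_{\psi,p}}{1}=a\binom{\tau_{\psi,p}}{1}$ for all $a\in K$. Write $\iota_\infty(\gamma_\psi)=\begin{pmatrix}a&b\\c&d\end{pmatrix}$, assumed to have $c\ne0$; $\tau_{\psi,\infty}$ and $\tau'_{\psi,\infty}$ are its fixed points $\frac{a-d\pm\sqrt{(d-a)^2+4bc}}{2c}$ in $\mathbb{P}^1(\mathbb{R})$ with sign $+$ and $-$ respectively. For $w=\gamma_w\tau_{\psi,\infty}$ with $\gamma_w\in\Gamma_0$, put $w_p=\gamma_w\tau_{\psi,p}$ and $w'=\gamma_w\tau'_{\psi,\infty}$ (independent of the choice of $\gamma_w$). Fix a base point $x$ in $\mathcal{H}$ (or in $\mathcal{H}\cup\mathbb{P}^1(\mathbb{Q})$ if $B\cong M_2(\mathbb{Q})$) lying on none of the geodesics $C(w,w')$, where $C(a,b)$ is the oriented hyperbolic geodesic from $a$ to $b$. Let $\delta_\gamma(w)\in\{-1,0,1\}$ be the signed intersection number of $C(x,\gamma x)$ and $C(w,w')$. Then $\gamma\mapsto\varphi_\psi(\gamma)=\sum_{w\in\Gamma_0\tau_{\psi,\infty}}\delta_\gamma(w)\cdot w_p$ is a cocycle (the sums being finite) defining a class $\varphi_\psi\in H^1(\Gamma_0,\operatorname{Div}A_0)$ independent of $x$. The class $\varphi_\psi^0$. For a prime $\mathfrak l\ne\mathfrak p$ of $F$ not dividing the discriminant of $B$, with totally positive generator $\lambda$, the Hecke operators $T_{\mathfrak l}$ and $S_{\mathfrak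 l}$ act on $H^1(\Gamma_0,V)$, $V=\operatorname{Div}A_0,\operatorname{Div}^0A_0,\mathbb{Z}$, as the usual double coset operators attached to an element of $R$ of reduced norm $\lambda$ and to the central element $\lambda$, respectively. Choose a polynomial $T$ in such operators with $T\deg(\varphi_\psi)=0$ in $H^1(\Gamma_0,\mathbb{Z})$, and let $\varphi_\psi^0\in H^1(\Gamma_0,\operatorname{Div}^0A_0)$ be a lift of $T\varphi_\psi$ (which exists by the long exact sequence of $0\to\operatorname{Div}^0A_0\to\operatorname{Div}A_0\xrightarrow{\deg}\mathbb{Z}\to0$). $T$ and the lift are fixed. The class $\phi_\psi$. Let $U_\infty=\{z\in\mathcal{H}_{\mathfrak p} : |z|\ge|\varpi|^{-1}\}$. Let $\omega_{\mathfrak p}\in R(\mathfrak p)$ be an element normalizing $\Gamma_0(\mathfrak p)$ with $\iota_{\mathfrak p}(\omega_{\mathfrak p})=u'\begin{pmatrix}0&-1\\\varpi&0\end{pmatrix}$ for some $u'\in\mathrm{SL}_2(\mathbb{Z}_{\mathfrak p})$ with lower left entry in $\mathfrak p$, and for a cocycle $\varphi$ on $\Gamma_0(\mathfrak p)$ put $(W_{\mathfrak p}\varphi)(g)=\omega_{\mathfrak p}\varphi(\omega_{\mathfrak p}^{-1}g\omega_{\mathfrak p})$. Applying $W_{\mathfrak p}$ to the restriction of $\varphi_\psi^0$ to $\Gamma_0(\mathfrak p)$ gives a class $\tilde\phi_\psi\in H^1(\Gamma_0(\mathfrak p),\operatorname{Div}^0U_\infty)$. Let $\Lambda=\bar{\mathbb{Z}}_{\mathfrak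 p}[\![\varpi x]\!]=\{\sum_{n\ge0}a_n\varpi^nx^n : a_n\in\bar{\mathbb{Z}}_{\mathfrak p}\}$, and let $\Sigma_0(\mathfrak p)\subset R(\mathfrak p)$ be the semigroup of elements $\sigma$ of nonzero norm with $\iota_{\mathfrak p}(\sigma)=\begin{pmatrix}a&b\\c&d\end{pmatrix}$, $c\in\mathfrak p$, $a\in\mathbb{Z}_{\mathfrak p}^\times$. It acts on $\Lambda$ by $$(\sigma f)(x)=(ad-bc)(a-cx)^{-2}f(\sigma^{-1}x),\qquad \sigma^{-1}x=\frac{dx-b}{a-cx}.$$ The map $\eta\colon\operatorname{Div}^0U_\infty\to\Lambda$ determined by $\eta(Q-P)=\frac1{x-Q}-\frac1{x-P}$ is $\Sigma_0(\mathfrak p)$-equivariant, and $\phi_\psi=\eta(\tilde\phi_\psi)\in H^1(\Gamma_0(\mathfrak p),\Lambda)$. The operator $U_{\mathfrak p}$. Let $h_\varpi\in\Sigma_0(\mathfrak p)$ have reduced norm $\varpi$ and $\iota_{\mathfrak p}(h_\varpi)=\begin{pmatrix}1&0\\0&\varpi\end{pmatrix}u_\varpi$ with $u_\varpi\in\mathrm{SL}_2(\mathbb{Z}_{\mathfrak p})$. Fix representatives $h_t$ with $\Gamma_0(\mathfrak p)h_\varpi\Gamma_0(\mathfrak p)=\bigsqcup_{t\in\mathbb{F}_{\mathfrak p}}h_t\Gamma_0(\mathfrak p)$. For $t\in\mathbb{F}_{\mathfrak p}$ and $\gamma\in\Gamma_0(\mathfrak p)$ there are a unique $b\in\mathbb{F}_{\mathfrak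 p}$ and a unique $s_t(\gamma)\in\Gamma_0(\mathfrak p)$ with $h_ts_t(\gamma)=\gamma h_b$. For a cocycle $\varphi\in Z^1(\Gamma_0(\mathfrak p),\Lambda)$, $(U_{\mathfrak p}\varphi)(\gamma)=\sum_{t\in\mathbb{F}_{\mathfrak p}}h_t\varphi(s_t(\gamma))$; this induces $U_{\mathfrak p}$ on $H^1(\Gamma_0(\mathfrak p),\Lambda)$. Meaning of the series: choose a cocycle representing $\phi_\psi$ and, for each $\gamma\in\Gamma_0(\mathfrak p)$, sum the values at $\gamma$ of the indicated cocycles in the $\varpi$-adic topology of $\Lambda$; "well defined" means that these sums converge, that they define a cocycle, and that its class does not depend on the cocycle chosen to represent $\phi_\psi$. *)

theory Defs
  imports
    "HOL-Analysis.Analysis"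
    "HOL-Computational_Algebra.Formal_Power_Series"
    "HOL-Library.Poly_Mapping"
    "HOL-Library.Disjoint_Sets"
begin

section \<open>Number fields\<close>

definition ring_hom_on_type :: "('a::ring_1 \<Rightarrow> 'r::ring_1) \<Rightarrow> bool" where
  "ring_hom_on_type f \<longleftrightarrow>
     f 1 = 1 \<and> (\<forall>x y. f (x + y) = f x + f y) \<and> (\<forall>x y. f (x * y) = f x * f y)"

definition coef_span :: "'s set \<Rightarrow> ('s \<Rightarrow> 'v \<Rightarrow> 'v) \<Rightarrow> 'v set \<Rightarrow> 'v::comm_monoid_add set" where
  "coef_span A smul X =
     {(\<Sum>x\<in>S. smul (c x) x) | S c. finite S \<and> S \<subseteq> X \<and> (\<forall>x\<in>S. c x \<in> A)}"

definition integers_of :: "'f::field set" where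
  "integers_of = {x. algebraic_int x}"

definition number_field :: "'f::field_char_0 itself \<Rightarrow> bool" where
  "number_field _ \<longleftrightarrow>
     (\<exists>S. finite S \<and> coef_span UNIV (\<lambda>q x. of_rat q * x) S = (UNIV :: 'f set))"

definition totally_real :: "'f::field_char_0 itself \<Rightarrow> bool" where
  "totally_real _ \<longleftrightarrow>
     (\<forall>\<sigma> :: 'f \<Rightarrow> complex. ring_hom_on_type \<sigma> \<longrightarrow> range \<sigma> \<subseteq> \<real>)"

text \<open>The archimedean places of a totally real field are its embeddings into the reals.\<close>

definition arch_place :: "('f::field \<Rightarrow> real) \<Rightarrow> bool" where
  "arch_place \<sigma> \<longleftrightarrow> ring_hom_on_type \<sigma>"

definition totally_positive :: "'f::field \<Rightarrow> bool" where
  "totally_positive a \<longleftrightarrow> (\<forall>\<sigma>. arch_place \<sigma> \<longrightarrow> \<sigma> a > 0)"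

definition prime_ideal_of :: "'a::comm_ring_1 set \<Rightarrow> 'a set \<Rightarrow> bool" where
  "prime_ideal_of A I \<longleftrightarrow>
     I \<subseteq> A \<and> I \<noteq> A \<and> 0 \<in> I \<and> (\<forall>x\<in>I. \<forall>y\<in>I. x - y \<in> I) \<and> (\<forall>a\<in>A. \<forall>x\<in>I. a * x \<in> I) \<and>
     (\<forall>x\<in>A. \<forall>y\<in>A. x * y \<in> I \<longrightarrow> x \<in> I \<or> y \<in> I)"

definition finite_prime :: "'f::field set \<Rightarrow> bool" where
  "finite_prime P \<longleftrightarrow> prime_ideal_of integers_of P \<and> P \<noteq> {0}"

definition principal :: "'f::field \<Rightarrow> 'f set" where
  "principal a = (*) a ` integers_of"

definition fractional_ideal :: "'f::field set \<Rightarrow> bool" where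
  "fractional_ideal I \<longleftrightarrow>
     I \<noteq> {0} \<and> 0 \<in> I \<and> (\<forall>x\<in>I. \<forall>y\<in>I. x - y \<in> I) \<and> (\<forall>a\<in>integers_of. \<forall>x\<in>I. a * x \<in> I) \<and>
     (\<exists>d\<in>integers_of. d \<noteq> 0 \<and> (*) d ` I \<subseteq> integers_of)"

definition narrow_class_number :: "'f::field itself \<Rightarrow> nat" where
  "narrow_class_number _ =
     card (Collect fractional_ideal //
       {(I, J :: 'f set). fractional_ideal I \<and> fractional_ideal J \<and>
          (\<exists>a. totally_positive a \<and> a \<noteq> 0 \<and> J = (*) a ` I)})"


section \<open>Algebras over a field, orders and quaternion algebras\<close>

text \<open>An algebra over a field is given by its structure map, a ring homomorphism into the centre.\<close>

definition algebra_map :: "('f::field \<Rightarrow> 'a::ring_1) \<Rightarrow> bool" where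
  "algebra_map alg \<longleftrightarrow> ring_hom_on_type alg \<and> (\<forall>a x. alg a * x = x * alg a)"

definition lin_comb :: "('f::field \<Rightarrow> 'a::ring_1) \<Rightarrow> 'a^'n \<Rightarrow> 'f^'n \<Rightarrow> 'a" where
  "lin_comb alg e c = (\<Sum>i\<in>UNIV. alg (c $ i) * e $ i)"

definition is_basis :: "('f::field \<Rightarrow> 'a::ring_1) \<Rightarrow> 'a^'n \<Rightarrow> bool" where
  "is_basis alg e \<longleftrightarrow> bij (lin_comb alg e)"

definition is_order :: "('f::field \<Rightarrow> 'a::ring_1) \<Rightarrow> 'a set \<Rightarrow> bool" where
  "is_order alg R \<longleftrightarrow>
     1 \<in> R \<and> (\<forall>x\<in>R. \<forall>y\<in>R. x - y \<in> R \<and> x * y \<in> R) \<and> alg ` integers_of \<subseteq> R \<and>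
     (\<exists>S. finite S \<and> R = coef_span integers_of (\<lambda>a x. alg a * x) S) \<and>
     coef_span UNIV (\<lambda>a x. alg a * x) R = UNIV"

definition maximal_order :: "('f::field \<Rightarrow> 'a::ring_1) \<Rightarrow> 'a set \<Rightarrow> bool" where
  "maximal_order alg R \<longleftrightarrow> is_order alg R \<and> (\<forall>R'. is_order alg R' \<and> R \<subseteq> R' \<longrightarrow> R' = R)"

text \<open>The index ideal of a lattice \<open>N\<close> in a lattice \<open>M\<close> of a four-dimensional algebra: it is
  generated by the determinants of the linear endomorphisms that map \<open>M\<close> into \<open>N\<close>.\<close>

definition lattice_index :: "('f::field \<Rightarrow> 'a::ring_1) \<Rightarrow> 'a set \<Rightarrow> 'a set \<Rightarrow> 'f set" where
  "lattice_index alg M N =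
     coef_span integers_of (*)
       {det A | A :: 'f^4^4. \<exists>e. is_basis alg e \<and>
          (\<forall>c. lin_comb alg e c \<in> M \<longrightarrow> lin_comb alg e (A *v c) \<in> N)}"

definition eichler_order_of_level ::
    "('f::field \<Rightarrow> 'a::ring_1) \<Rightarrow> 'a set \<Rightarrow> 'a set \<Rightarrow> 'f set \<Rightarrow> bool" where
  "eichler_order_of_level alg R R' I \<longleftrightarrow>
     R' \<subseteq> R \<and> lattice_index alg R R' = I \<and>
     (\<exists>R1 R2. maximal_order alg R1 \<and> maximal_order alg R2 \<and> R' = R1 \<inter> R2)"

definition quaternion_algebra :: "('f::field \<Rightarrow> 'b::ring_1) \<Rightarrow> bool" where
  "quaternion_algebra alg \<longleftrightarrow> algebra_map alg \<and>
     (\<exists>a b i j. a \<noteq> 0 \<and> b \<noteq> 0 \<and> i * i = alg a \<and> j * j = alg b \<and> j * i = - (i * j) \<and>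
        is_basis alg (vector [1, i, j, i * j] :: 'b^4))"

definition standard_involution :: "('f::field \<Rightarrow> 'b::ring_1) \<Rightarrow> ('b \<Rightarrow> 'b) \<Rightarrow> bool" where
  "standard_involution alg s \<longleftrightarrow>
     (\<forall>a. s (alg a) = alg a) \<and> (\<forall>x y. s (x + y) = s x + s y) \<and>
     (\<forall>x y. s (x * y) = s y * s x) \<and> (\<forall>x. s (s x) = x) \<and>
     (\<forall>x. x + s x \<in> range alg \<and> x * s x \<in> range alg)"

definition reduced_norm :: "('f::field \<Rightarrow> 'b::ring_1) \<Rightarrow> 'b \<Rightarrow> 'f" where
  "reduced_norm alg x = (THE n. \<exists>s. standard_involution alg s \<and> x * s x = alg n)"

text \<open>A splitting over the subfield \<open>L\<close> of a field, along \<open>\<sigma>\<close> from the base field into \<open>L\<close>: an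
  algebra homomorphism into the 2-by-2 matrices over \<open>L\<close> whose scalar extension, written here in
  coordinates, is bijective. Note that \<open>mat a\<close> is a scalar matrix.\<close>

definition splitting ::
    "('f::field \<Rightarrow> 'b::ring_1) \<Rightarrow> ('f \<Rightarrow> 'l::field) \<Rightarrow> 'l set \<Rightarrow> ('b \<Rightarrow> 'l^2^2) \<Rightarrow> bool" where
  "splitting alg \<sigma> L \<iota> \<longleftrightarrow>
     (\<forall>x y. \<iota> (x + y) = \<iota> x + \<iota> y) \<and> (\<forall>x y. \<iota> (x * y) = \<iota> x ** \<iota> y) \<and>
     (\<forall>a. \<iota> (alg a) = mat (\<sigma> a)) \<and>
     (\<forall>e :: 'b^4. is_basis alg e \<longrightarrow>
        bij_betw (\<lambda>c :: 'l^4. \<Sum>i\<in>UNIV. mat (c $ i) ** \<iota> (e $ i))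
          {c. \<forall>i. c $ i \<in> L} {M. \<forall>i j. M $ i $ j \<in> L})"

definition split_at_arch :: "('f::field \<Rightarrow> 'b::ring_1) \<Rightarrow> ('f \<Rightarrow> real) \<Rightarrow> bool" where
  "split_at_arch alg \<sigma> \<longleftrightarrow> (\<exists>\<iota>. splitting alg \<sigma> UNIV \<iota>)"

text \<open>Splitting at the finite prime generated by \<open>l\<close>. Elements of the completion are represented
  by Cauchy sequences in the field, and equality in the completion is equality up to null
  sequences. The neighbourhoods of zero are the \<open>l\<close>-power multiples of the localised integers.\<close>

definition adic_nbhd :: "'f::field \<Rightarrow> nat \<Rightarrow> 'f set" where
  "adic_nbhd l N = {x. \<exists>s\<in>integers_of - principal l. \<exists>y\<in>integers_of. s * x = l ^ N * y}"

definition adic_null :: "'f::field \<Rightarrow> (nat \<Rightarrow> 'f) \<Rightarrow> bool" where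
  "adic_null l x \<longleftrightarrow> (\<forall>N. \<exists>n0. \<forall>n\<ge>n0. x n \<in> adic_nbhd l N)"

definition adic_cauchy :: "'f::field \<Rightarrow> (nat \<Rightarrow> 'f) \<Rightarrow> bool" where
  "adic_cauchy l x \<longleftrightarrow> (\<forall>N. \<exists>n0. \<forall>m\<ge>n0. \<forall>n\<ge>n0. x m - x n \<in> adic_nbhd l N)"

definition mat_eqv :: "'f::field \<Rightarrow> (nat \<Rightarrow> 'f^2^2) \<Rightarrow> (nat \<Rightarrow> 'f^2^2) \<Rightarrow> bool" where
  "mat_eqv l X Y \<longleftrightarrow> (\<forall>i j. adic_null l (\<lambda>n. X n $ i $ j - Y n $ i $ j))"

definition split_at_finite :: "('f::field \<Rightarrow> 'b::ring_1) \<Rightarrow> 'f \<Rightarrow> bool" where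
  "split_at_finite alg l \<longleftrightarrow>
     (\<exists>\<iota> :: 'b \<Rightarrow> nat \<Rightarrow> 'f^2^2.
        (\<forall>x i j. adic_cauchy l (\<lambda>n. \<iota> x n $ i $ j)) \<and>
        (\<forall>x y. mat_eqv l (\<iota> (x + y)) (\<lambda>n. \<iota> x n + \<iota> y n)) \<and>
        (\<forall>x y. mat_eqv l (\<iota> (x * y)) (\<lambda>n. \<iota> x n ** \<iota> y n)) \<and>
        (\<forall>a. mat_eqv l (\<iota> (alg a)) (\<lambda>n. mat a)) \<and>
        (\<forall>e :: 'b^4. is_basis alg e \<longrightarrow>
           (\<forall>M. (\<forall>i j. adic_cauchy l (\<lambda>n. M n $ i $ j)) \<longrightarrow>
              (\<exists>c :: nat \<Rightarrow> 'f^4. (\<forall>i. adic_cauchy l (\<lambda>n. c n $ i)) \<and>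
                 mat_eqv l M (\<lambda>n. \<Sum>i\<in>UNIV. mat (c n $ i) ** \<iota> (e $ i) n))) \<and>
           (\<forall>c :: nat \<Rightarrow> 'f^4. (\<forall>i. adic_cauchy l (\<lambda>n. c n $ i)) \<and>
                 mat_eqv l (\<lambda>n. \<Sum>i\<in>UNIV. mat (c n $ i) ** \<iota> (e $ i) n) (\<lambda>n. 0) \<longrightarrow>
              (\<forall>i. adic_null l (\<lambda>n. c n $ i)))))"


section \<open>The completed algebraic closure of the \<open>p\<close>-adic numbers\<close>

definition abs_closure :: "('c::field \<Rightarrow> real) \<Rightarrow> 'c set \<Rightarrow> 'c set" where
  "abs_closure nu X = {z. \<forall>\<epsilon>>0. \<exists>q\<in>X. nu (z - q) < \<epsilon>}"

definition nonarch_abs :: "('c::field \<Rightarrow> real) \<Rightarrow> bool" where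
  "nonarch_abs nu \<longleftrightarrow>
     (\<forall>x. nu x \<ge> 0) \<and> (\<forall>x. nu x = 0 \<longleftrightarrow> x = 0) \<and> (\<forall>x y. nu (x * y) = nu x * nu y) \<and>
     (\<forall>x y. nu (x + y) \<le> max (nu x) (nu y))"

definition abs_complete :: "('c::field \<Rightarrow> real) \<Rightarrow> bool" where
  "abs_complete nu \<longleftrightarrow>
     (\<forall>X :: nat \<Rightarrow> 'c. (\<forall>\<epsilon>>0. \<exists>n0. \<forall>m\<ge>n0. \<forall>n\<ge>n0. nu (X m - X n) < \<epsilon>) \<longrightarrow>
        (\<exists>L. (\<lambda>n. nu (X n - L)) \<longlonglongrightarrow> 0))"

definition algebraic_over :: "'c::field set \<Rightarrow> 'c set" where
  "algebraic_over L = {z. \<exists>q. q \<noteq> 0 \<and> (\<forall>i. coeff q i \<in> L) \<and> poly q z = 0}"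

text \<open>The field \<open>'c\<close> is complete and contains, as a dense subfield, an algebraic closure of the
  closure of the rationals. The absolute value is not normalised.\<close>

definition completed_alg_closure :: "('c::field_char_0 \<Rightarrow> real) \<Rightarrow> nat \<Rightarrow> bool" where
  "completed_alg_closure nu p \<longleftrightarrow>
     prime p \<and> nonarch_abs nu \<and> nu (of_nat p) < 1 \<and> abs_complete nu \<and>
     (let Qbar = algebraic_over (abs_closure nu \<rat>) in
        (\<forall>q. (\<forall>i. coeff q i \<in> Qbar) \<and> degree q > 0 \<longrightarrow> (\<exists>z\<in>Qbar. poly q z = 0)) \<and>
        abs_closure nu Qbar = UNIV)"

definition abs_suminf :: "('c::field \<Rightarrow> real) \<Rightarrow> (nat \<Rightarrow> 'c) \<Rightarrow> 'c" where
  "abs_suminf nu f = (THE s. (\<lambda>N. nu (s - (\<Sum>n<N. f n))) \<longlonglongrightarrow> 0)"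


section \<open>The quaternionic setting\<close>

record ('f, 'b, 'c) setting =
  alg :: "'f \<Rightarrow> 'b"
  vinf :: "'f \<Rightarrow> real"
  pr :: "'f set"
  varpi :: 'f
  rat_prime :: nat
  absp :: "'c \<Rightarrow> real"
  jp :: "'f \<Rightarrow> 'c"
  iota_p :: "'b \<Rightarrow> 'c^2^2"
  iota_inf :: "'b \<Rightarrow> real^2^2"
  max_ord :: "'b set"
  eich_ord :: "'b set"

definition Qp :: "('f, 'b, 'c::field) setting \<Rightarrow> 'c set" where
  "Qp S = abs_closure (absp S) (range (jp S))"

definition Zp :: "('f, 'b, 'c::field) setting \<Rightarrow> 'c set" where
  "Zp S = {z \<in> Qp S. absp S z \<le> 1}"

definition pZp :: "('f, 'b, 'c::field) setting \<Rightarrow> 'c set" where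
  "pZp S = coef_span (Zp S) (*) (jp S ` pr S)"

definition Fp :: "('f, 'b, 'c::field) setting \<Rightarrow> 'c set set" where
  "Fp S = Zp S // {(x, y). x \<in> Zp S \<and> y \<in> Zp S \<and> x - y \<in> pZp S}"

definition quaternionic_setting ::
    "('f::field_char_0, 'b::ring_1, 'c::field_char_0) setting \<Rightarrow> bool" where
  "quaternionic_setting S \<longleftrightarrow>
     number_field TYPE('f) \<and> totally_real TYPE('f) \<and> narrow_class_number TYPE('f) = 1 \<and>
     quaternion_algebra (alg S) \<and>
     arch_place (vinf S) \<and>
     (\<forall>\<sigma>. arch_place \<sigma> \<longrightarrow> (split_at_arch (alg S) \<sigma> \<longleftrightarrow> \<sigma> = vinf S)) \<and>
     finite_prime (pr S) \<and> of_nat (rat_prime S) \<in> pr S \<and>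
     totally_positive (varpi S) \<and> pr S = principal (varpi S) \<and>
     completed_alg_closure (absp S) (rat_prime S) \<and>
     ring_hom_on_type (jp S) \<and>
     (\<forall>x\<in>integers_of. absp S (jp S x) \<le> 1) \<and>
     {x \<in> integers_of. absp S (jp S x) < 1} = pr S \<and>
     splitting (alg S) (jp S) (Qp S) (iota_p S) \<and>
     splitting (alg S) (vinf S) UNIV (iota_inf S) \<and>
     maximal_order (alg S) (max_ord S) \<and>
     coef_span (Zp S) (\<lambda>c M. mat c ** M) (iota_p S ` max_ord S) =
       {M. \<forall>i j. M $ i $ j \<in> Zp S} \<and>
     eichler_order_of_level (alg S) (max_ord S) (eich_ord S) (pr S) \<and>
     coef_span (Zp S) (\<lambda>c M. mat c ** M) (iota_p S ` eich_ord S) =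
       {M. (\<forall>i j. M $ i $ j \<in> Zp S) \<and> M $ 2 $ 1 \<in> pZp S}"

abbreviation nrd :: "('f::field, 'b::ring_1, 'c) setting \<Rightarrow> 'b \<Rightarrow> 'f" where
  "nrd S \<equiv> reduced_norm (alg S)"

definition norm_one_units :: "('f::field, 'b::ring_1, 'c) setting \<Rightarrow> 'b set \<Rightarrow> 'b set" where
  "norm_one_units S R = {g \<in> R. (\<exists>g'\<in>R. g * g' = 1 \<and> g' * g = 1) \<and> nrd S g = 1}"

definition Gamma0 :: "('f::field, 'b::ring_1, 'c) setting \<Rightarrow> 'b set" where
  "Gamma0 S = norm_one_units S (max_ord S)"

definition Gamma0p :: "('f::field, 'b::ring_1, 'c) setting \<Rightarrow> 'b set" where
  "Gamma0p S = norm_one_units S (eich_ord S)"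

definition ring_inv :: "'b::ring_1 \<Rightarrow> 'b" where
  "ring_inv x = (THE y. x * y = 1 \<and> y * x = 1)"


section \<open>The \<open>p\<close>-adic upper half plane and divisors\<close>

text \<open>Since the point at infinity is rational, the \<open>p\<close>-adic upper half plane is a subset of \<open>'c\<close>,
  and for a nonsingular matrix over \<open>Qp S\<close> the denominator below does not vanish on it.\<close>

definition Hp :: "('f, 'b, 'c::field) setting \<Rightarrow> 'c set" where
  "Hp S = - Qp S"

definition mob_p :: "('f, 'b, 'c::field) setting \<Rightarrow> 'b \<Rightarrow> 'c \<Rightarrow> 'c" where
  "mob_p S g z =
     (let M = iota_p S g in (M $ 1 $ 1 * z + M $ 1 $ 2) / (M $ 2 $ 1 * z + M $ 2 $ 2))"

definition A0 :: "('f, 'b, 'c::field) setting \<Rightarrow> 'c set" where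
  "A0 S = {z. absp S z \<le> 1 \<and> (\<forall>t\<in>Zp S. absp S (z - t) \<ge> 1)}"

definition Uinf :: "('f, 'b, 'c::field) setting \<Rightarrow> 'c set" where
  "Uinf S = {z \<in> Hp S. absp S z \<ge> inverse (absp S (jp S (varpi S)))}"

definition Div :: "'c set \<Rightarrow> ('c \<Rightarrow>\<^sub>0 int) set" where
  "Div X = {D. Poly_Mapping.keys D \<subseteq> X}"

definition deg :: "('c \<Rightarrow>\<^sub>0 int) \<Rightarrow> int" where
  "deg D = (\<Sum>z\<in>Poly_Mapping.keys D. Poly_Mapping.lookup D z)"

definition Div0 :: "'c set \<Rightarrow> ('c \<Rightarrow>\<^sub>0 int) set" where
  "Div0 X = {D \<in> Div X. deg D = 0}"

definition div_act :: "('f, 'b, 'c::field) setting \<Rightarrow> 'b \<Rightarrow> ('c \<Rightarrow>\<^sub>0 int) \<Rightarrow> ('c \<Rightarrow>\<^sub>0 int)" where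
  "div_act S g = frag_extend (\<lambda>z. frag_of (mob_p S g z))"


section \<open>First cohomology\<close>

text \<open>A coefficient module consists of the group, the action and the underlying abelian group.
  The action is also used for elements outside the group in double coset operators. Cocycles are
  total functions of which only the values on the group matter: two cocycles that agree on the
  group are cohomologous, hence equal as classes.\<close>

record ('g, 'v) gmod =
  grp :: "'g set"
  act :: "'g \<Rightarrow> 'v \<Rightarrow> 'v"
  carr :: "'v set"

definition Z1 :: "('g::times, 'v::ab_group_add) gmod \<Rightarrow> ('g \<Rightarrow> 'v) set" where
  "Z1 M = {\<phi>. (\<forall>g\<in>grp M. \<phi> g \<in> carr M) \<and>
               (\<forall>g\<in>grp M. \<forall>h\<in>grp M. \<phi> (g * h) = \<phi> g + act M g (\<phi> h))}"

definition cohomologous :: "('g::times, 'v::ab_group_add) gmod \<Rightarrow> (('g \<Rightarrow> 'v) \<times> ('g \<Rightarrow> 'v)) set" where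
  "cohomologous M = {(\<phi>, \<phi>'). \<phi> \<in> Z1 M \<and> \<phi>' \<in> Z1 M \<and>
     (\<exists>v\<in>carr M. \<forall>g\<in>grp M. \<phi>' g - \<phi> g = act M g v - v)}"

definition H1 :: "('g::times, 'v::ab_group_add) gmod \<Rightarrow> ('g \<Rightarrow> 'v) set set" where
  "H1 M = Z1 M // cohomologous M"

definition H1_class :: "('g::times, 'v::ab_group_add) gmod \<Rightarrow> ('g \<Rightarrow> 'v) \<Rightarrow> ('g \<Rightarrow> 'v) set" where
  "H1_class M \<phi> = cohomologous M `` {\<phi>}"

text \<open>The map into the cohomology of \<open>M\<close> induced by a map \<open>F\<close> on cocycles.\<close>

definition H1_map ::
    "('g::times, 'v::ab_group_add) gmod \<Rightarrow> (('h \<Rightarrow> 'w) \<Rightarrow> ('g \<Rightarrow> 'v)) \<Rightarrow> ('h \<Rightarrow> 'w) set \<Rightarrow>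
      ('g \<Rightarrow> 'v) set" where
  "H1_map M F c = (\<Union>\<phi>\<in>c. H1_class M (F \<phi>))"

definition H1_add ::
    "('g::times, 'v::ab_group_add) gmod \<Rightarrow> ('g \<Rightarrow> 'v) set \<Rightarrow> ('g \<Rightarrow> 'v) set \<Rightarrow> ('g \<Rightarrow> 'v) set" where
  "H1_add M c d = (\<Union>\<phi>\<in>c. \<Union>\<phi>'\<in>d. H1_class M (\<lambda>g. \<phi> g + \<phi>' g))"

definition H1_minus ::
    "('g::times, 'v::ab_group_add) gmod \<Rightarrow> ('g \<Rightarrow> 'v) set \<Rightarrow> ('g \<Rightarrow> 'v) set" where
  "H1_minus M c = H1_map M (\<lambda>\<phi> g. - \<phi> g) c"

definition H1_zero :: "('g::times, 'v::ab_group_add) gmod \<Rightarrow> ('g \<Rightarrow> 'v) set" where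
  "H1_zero M = H1_class M (\<lambda>_. 0)"

definition coset_reps :: "'g::times set \<Rightarrow> 'g \<Rightarrow> 'i set \<Rightarrow> ('i \<Rightarrow> 'g) \<Rightarrow> bool" where
  "coset_reps G a I h \<longleftrightarrow>
     {g * a * g' | g g'. g \<in> G \<and> g' \<in> G} = (\<Union>t\<in>I. (*) (h t) ` G) \<and>
     disjoint_family_on (\<lambda>t. (*) (h t) ` G) I"

definition double_coset_op ::
    "('g::times, 'v::ab_group_add) gmod \<Rightarrow> 'i set \<Rightarrow> ('i \<Rightarrow> 'g) \<Rightarrow> ('g \<Rightarrow> 'v) \<Rightarrow> ('g \<Rightarrow> 'v)" where
  "double_coset_op M I h \<phi> \<gamma> =
     (\<Sum>t\<in>I. act M (h t) (\<phi> (THE s. s \<in> grp M \<and> (\<exists>b\<in>I. h t * s = \<gamma> * h b))))"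

text \<open>The operator on classes given by an element \<open>a\<close>. The class obtained does not depend on the
  system \<open>D\<close> of coset representatives.\<close>

definition H1_double_coset ::
    "('g::times, 'v::ab_group_add) gmod \<Rightarrow> 'g \<Rightarrow> ('g \<Rightarrow> 'v) set \<Rightarrow> ('g \<Rightarrow> 'v) set" where
  "H1_double_coset M a c =
     (\<Union>D\<in>{D. finite D \<and> coset_reps (grp M) a D (\<lambda>t. t)}.
        H1_map M (double_coset_op M D (\<lambda>t. t)) c)"

definition DivA0_mod :: "('f::field, 'b::ring_1, 'c::field) setting \<Rightarrow> ('b, 'c \<Rightarrow>\<^sub>0 int) gmod" where
  "DivA0_mod S = \<lparr>grp = Gamma0 S, act = div_act S, carr = Div (A0 S)\<rparr>"

definition Div0A0_mod :: "('f::field, 'b::ring_1, 'c::field) setting \<Rightarrow> ('b, 'c \<Rightarrow>\<^sub>0 int) gmod" where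
  "Div0A0_mod S = \<lparr>grp = Gamma0 S, act = div_act S, carr = Div0 (A0 S)\<rparr>"

definition Z_mod :: "('f::field, 'b::ring_1, 'c::field) setting \<Rightarrow> ('b, int) gmod" where
  "Z_mod S = \<lparr>grp = Gamma0 S, act = (\<lambda>_ n. n), carr = UNIV\<rparr>"

definition Div0Uinf_mod :: "('f::field, 'b::ring_1, 'c::field) setting \<Rightarrow> ('b, 'c \<Rightarrow>\<^sub>0 int) gmod" where
  "Div0Uinf_mod S = \<lparr>grp = Gamma0p S, act = div_act S, carr = Div0 (Uinf S)\<rparr>"


section \<open>Hecke operators away from \<open>p\<close>\<close>

text \<open>A polynomial with integer coefficients in the operators attached to primes, each prime being
  given by a totally positive generator. The operators commute, so the order of factors is
  immaterial.\<close>

datatype 'f hecke =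
    T_op 'f
  | S_op 'f
  | H_one
  | H_neg "'f hecke"
  | H_add "'f hecke" "'f hecke"
  | H_mult "'f hecke" "'f hecke"

text \<open>The discriminant of a quaternion algebra is the product of the finite primes at which it is
  not split, so the last condition says that the prime does not divide the discriminant.\<close>

definition hecke_prime :: "('f::field, 'b::ring_1, 'c) setting \<Rightarrow> 'f \<Rightarrow> bool" where
  "hecke_prime S l \<longleftrightarrow>
     totally_positive l \<and> finite_prime (principal l) \<and> principal l \<noteq> pr S \<and>
     split_at_finite (alg S) l"

primrec hecke_act ::
    "('f::field, 'b::ring_1, 'c) setting \<Rightarrow> ('b, 'v::ab_group_add) gmod \<Rightarrow> 'f hecke \<Rightarrow>
      ('b \<Rightarrow> 'v) set \<Rightarrow> ('b \<Rightarrow> 'v) set" where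
  "hecke_act S M (T_op l) c = (\<Union>a\<in>{a \<in> max_ord S. nrd S a = l}. H1_double_coset M a c)"
| "hecke_act S M (S_op l) c = H1_double_coset M (alg S l) c"
| "hecke_act S M H_one c = c"
| "hecke_act S M (H_neg P) c = H1_minus M (hecke_act S M P c)"
| "hecke_act S M (H_add P Q) c = H1_add M (hecke_act S M P c) (hecke_act S M Q c)"
| "hecke_act S M (H_mult P Q) c = hecke_act S M P (hecke_act S M Q c)"


section \<open>Geodesics in the upper half plane\<close>

datatype 'a proj_line = Pt 'a | Infty

definition mobius :: "'a::field^2^2 \<Rightarrow> 'a proj_line \<Rightarrow> 'a proj_line" where
  "mobius M x =
     (case x of
        Pt z \<Rightarrow> if M $ 2 $ 1 * z + M $ 2 $ 2 = 0 then Infty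
                else Pt ((M $ 1 $ 1 * z + M $ 1 $ 2) / (M $ 2 $ 1 * z + M $ 2 $ 2))
      | Infty \<Rightarrow> if M $ 2 $ 1 = 0 then Infty else Pt (M $ 1 $ 1 / M $ 2 $ 1))"

text \<open>The upper half plane and the real projective line are both regarded as subsets of the complex
  projective line, on which real matrices act.\<close>

definition rmob :: "real^2^2 \<Rightarrow> complex proj_line \<Rightarrow> complex proj_line" where
  "rmob g = mobius (\<chi> i j. complex_of_real (g $ i $ j))"

definition vert :: "ereal \<Rightarrow> complex proj_line" where
  "vert y = (if y = \<infinity> then Infty else Pt (\<i> * complex_of_real (real_of_ereal y)))"

text \<open>Oriented geodesics are the images under real matrices of determinant one of the segments of
  the imaginary axis, oriented upwards. Endpoints are included.\<close>

definition geodesic :: "complex proj_line \<Rightarrow> complex proj_line \<Rightarrow> complex proj_line set" where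
  "geodesic a b =
     {rmob g (vert y) | g s y t. det g = 1 \<and> 0 \<le> s \<and> s \<le> y \<and> y \<le> t \<and>
        rmob g (vert s) = a \<and> rmob g (vert t) = b}"

text \<open>Unit tangent vector at \<open>z\<close> of the geodesic from \<open>a\<close> to \<open>b\<close>, where \<open>a \<noteq> b\<close>; the derivative of
  the action of \<open>g\<close> at \<open>w\<close> is the inverse square of the denominator.\<close>

definition direction :: "complex proj_line \<Rightarrow> complex proj_line \<Rightarrow> complex \<Rightarrow> complex" where
  "direction a b z =
     (THE v. \<exists>g s t. \<exists>y::real. det g = 1 \<and> 0 \<le> s \<and> s < t \<and> s \<le> ereal y \<and> ereal y \<le> t \<and> 0 < y \<and>
        rmob g (vert s) = a \<and> rmob g (vert t) = b \<and> rmob g (vert (ereal y)) = Pt z \<and>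
        v = sgn (\<i> / (complex_of_real (g $ 2 $ 1) * (\<i> * complex_of_real y)
                       + complex_of_real (g $ 2 $ 2))\<^sup>2))"

text \<open>A crossing counts \<open>+1\<close> if the tangent vectors of the first and the second geodesic, in this
  order, form a positively oriented basis.\<close>

definition signed_intersection ::
    "complex proj_line \<Rightarrow> complex proj_line \<Rightarrow> complex proj_line \<Rightarrow> complex proj_line \<Rightarrow> int" where
  "signed_intersection a b a' b' =
     (\<Sum>z\<in>{z. Im z > 0 \<and> Pt z \<in> geodesic a b \<inter> geodesic a' b'}.
        let r = Im (cnj (direction a b z) * direction a' b' z)
        in if r > 0 then 1 else if r < 0 then -1 else 0)"

abbreviation mob_inf ::
    "('f, 'b, 'c) setting \<Rightarrow> 'b \<Rightarrow> complex proj_line \<Rightarrow> complex proj_line" where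
  "mob_inf S g \<equiv> rmob (iota_inf S g)"

text \<open>The cusps: the rational projective line, available only if the algebra is isomorphic to the
  rational matrices \<open>f\<close>, and transported to the coordinates of \<open>iota_inf\<close> by the real matrix \<open>g\<close>
  that conjugates \<open>f\<close> into \<open>iota_inf\<close>.\<close>

definition cusps :: "('f, 'b::ring_1, 'c) setting \<Rightarrow> complex proj_line set" where
  "cusps S =
     {rmob g q | g q. (q = Infty \<or> (\<exists>r::rat. q = Pt (of_rat r))) \<and> det g \<noteq> 0 \<and>
        (\<exists>f :: 'b \<Rightarrow> rat^2^2. bij f \<and> f 1 = mat 1 \<and> (\<forall>x y. f (x + y) = f x + f y) \<and>
           (\<forall>x y. f (x * y) = f x ** f y) \<and>
           (\<forall>x. iota_inf S x ** g = g ** (\<chi> i j. real_of_rat (f x $ i $ j))))}"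


section \<open>Optimal embeddings and the class \<open>\<phi>\<^sub>\<psi>\<close>\<close>

definition quadratic_norm :: "('f::field \<Rightarrow> 'k::field) \<Rightarrow> 'k \<Rightarrow> 'f" where
  "quadratic_norm algK w =
     (THE n. \<exists>(e :: 'k^2) A. is_basis algK e \<and>
        (\<forall>c. w * lin_comb algK e c = lin_comb algK e (A *v c)) \<and> n = det A)"

definition quadratic_extension :: "('f::field, 'b, 'c) setting \<Rightarrow> ('f \<Rightarrow> 'k::field) \<Rightarrow> bool" where
  "quadratic_extension S algK \<longleftrightarrow>
     algebra_map algK \<and> (\<exists>e :: 'k^2. is_basis algK e) \<and>
     prime_ideal_of integers_of (coef_span integers_of (*) (algK ` pr S)) \<and>
     (\<exists>\<rho> \<rho>'. \<rho> \<noteq> \<rho>' \<and> arch_place \<rho> \<and> arch_place \<rho>' \<and> \<rho> \<circ> algK = vinf S \<and> \<rho>' \<circ> algK = vinf S) \<and>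
     (\<forall>\<sigma>. arch_place \<sigma> \<and> \<sigma> \<noteq> vinf S \<longrightarrow> \<not> (\<exists>\<rho>. arch_place \<rho> \<and> \<rho> \<circ> algK = \<sigma>))"

definition optimal_embeddings ::
    "('f::field, 'b::ring_1, 'c) setting \<Rightarrow> ('f \<Rightarrow> 'k::field) \<Rightarrow> 'k set \<Rightarrow> ('k \<Rightarrow> 'b) set" where
  "optimal_embeddings S algK Ord =
     {\<psi>. ring_hom_on_type \<psi> \<and> inj \<psi> \<and> \<psi> \<circ> algK = alg S \<and> \<psi> -` max_ord S = Ord}"

definition relative_norm_one_units :: "('f::field \<Rightarrow> 'k::field) \<Rightarrow> 'k set \<Rightarrow> 'k set" where
  "relative_norm_one_units algK Ord =
     {w \<in> Ord. (\<exists>w'\<in>Ord. w * w' = 1) \<and> quadratic_norm algK w = 1}"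

definition generates_free_part :: "'k::field set \<Rightarrow> 'k \<Rightarrow> bool" where
  "generates_free_part W u \<longleftrightarrow>
     u \<in> W \<and> (\<forall>n>0. u ^ n \<noteq> 1) \<and>
     (\<forall>w\<in>W. \<exists>(m::int). \<exists>\<zeta>\<in>W. (\<exists>n>0. \<zeta> ^ n = 1) \<and> w = \<zeta> * u powi m)"

definition tau_p :: "('f, 'b, 'c::field) setting \<Rightarrow> ('k \<Rightarrow> 'c) \<Rightarrow> ('k \<Rightarrow> 'b) \<Rightarrow> 'c" where
  "tau_p S kp \<psi> =
     (THE z. z \<in> Hp S \<and>
        (\<forall>a. iota_p S (\<psi> a) *v vector [z, 1] = kp a *s (vector [z, 1] :: 'c^2)))"

definition fixed_pt :: "real \<Rightarrow> real^2^2 \<Rightarrow> complex proj_line" where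
  "fixed_pt \<epsilon> M =
     (let a = M $ 1 $ 1; b = M $ 1 $ 2; c = M $ 2 $ 1; d = M $ 2 $ 2
      in Pt (complex_of_real ((a - d + \<epsilon> * sqrt ((d - a)\<^sup>2 + 4 * b * c)) / (2 * c))))"

definition tau_inf :: "('f, 'b, 'c) setting \<Rightarrow> 'b \<Rightarrow> complex proj_line" where
  "tau_inf S g = fixed_pt 1 (iota_inf S g)"

definition tau_inf' :: "('f, 'b, 'c) setting \<Rightarrow> 'b \<Rightarrow> complex proj_line" where
  "tau_inf' S g = fixed_pt (- 1) (iota_inf S g)"

definition tau_orbit :: "('f::field, 'b::ring_1, 'c) setting \<Rightarrow> 'b \<Rightarrow> complex proj_line set" where
  "tau_orbit S g = (\<lambda>\<gamma>. mob_inf S \<gamma> (tau_inf S g)) ` Gamma0 S"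

definition orbit_elt ::
    "('f::field, 'b::ring_1, 'c) setting \<Rightarrow> 'b \<Rightarrow> complex proj_line \<Rightarrow> 'b" where
  "orbit_elt S g w = (SOME \<gamma>. \<gamma> \<in> Gamma0 S \<and> mob_inf S \<gamma> (tau_inf S g) = w)"

definition conj_pt ::
    "('f::field, 'b::ring_1, 'c) setting \<Rightarrow> 'b \<Rightarrow> complex proj_line \<Rightarrow> complex proj_line" where
  "conj_pt S g w = mob_inf S (orbit_elt S g w) (tau_inf' S g)"

definition base_point ::
    "('f::field, 'b::ring_1, 'c) setting \<Rightarrow> 'b \<Rightarrow> complex proj_line \<Rightarrow> bool" where
  "base_point S g x \<longleftrightarrow>
     x \<in> {Pt z | z. Im z > 0} \<union> cusps S \<and>
     (\<forall>w\<in>tau_orbit S g. x \<notin> geodesic w (conj_pt S g w))"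

definition delta ::
    "('f::field, 'b::ring_1, 'c) setting \<Rightarrow> 'b \<Rightarrow> complex proj_line \<Rightarrow> 'b \<Rightarrow> complex proj_line \<Rightarrow> int"
    where
  "delta S g x \<gamma> w = signed_intersection x (mob_inf S \<gamma> x) w (conj_pt S g w)"

definition phi_cocycle ::
    "('f::field, 'b::ring_1, 'c::field) setting \<Rightarrow> ('k \<Rightarrow> 'c) \<Rightarrow> ('k \<Rightarrow> 'b) \<Rightarrow> 'k \<Rightarrow>
      complex proj_line \<Rightarrow> 'b \<Rightarrow> ('c \<Rightarrow>\<^sub>0 int)" where
  "phi_cocycle S kp \<psi> u x \<gamma> =
     (\<Sum>w\<in>{w \<in> tau_orbit S (\<psi> u). delta S (\<psi> u) x \<gamma> w \<noteq> 0}.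
        frag_cmul (delta S (\<psi> u) x \<gamma> w)
          (frag_of (mob_p S (orbit_elt S (\<psi> u) w) (tau_p S kp \<psi>))))"

definition phi_class ::
    "('f::field, 'b::ring_1, 'c::field) setting \<Rightarrow> ('k \<Rightarrow> 'c) \<Rightarrow> ('k \<Rightarrow> 'b) \<Rightarrow> 'k \<Rightarrow>
      complex proj_line \<Rightarrow> ('b \<Rightarrow> ('c \<Rightarrow>\<^sub>0 int)) set" where
  "phi_class S kp \<psi> u x = H1_class (DivA0_mod S) (phi_cocycle S kp \<psi> u x)"

text \<open>The pairs of a Hecke polynomial killing the degree of the class, and a lift to divisors of
  degree zero of the image of the class under that polynomial.\<close>

definition degree_zero_lift ::
    "('f::field, 'b::ring_1, 'c::field) setting \<Rightarrow> ('b \<Rightarrow> ('c \<Rightarrow>\<^sub>0 int)) set \<Rightarrow> 'f hecke \<Rightarrow>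
      ('b \<Rightarrow> ('c \<Rightarrow>\<^sub>0 int)) set \<Rightarrow> bool" where
  "degree_zero_lift S c P c0 \<longleftrightarrow>
     (\<forall>l\<in>set_hecke P. hecke_prime S l) \<and>
     hecke_act S (Z_mod S) P (H1_map (Z_mod S) (\<lambda>\<phi> g. deg (\<phi> g)) c) = H1_zero (Z_mod S) \<and>
     c0 \<in> H1 (Div0A0_mod S) \<and>
     H1_map (DivA0_mod S) (\<lambda>\<phi>. \<phi>) c0 = hecke_act S (DivA0_mod S) P c"


section \<open>The module \<open>\<Lambda>\<close>, the class \<open>\<phi>\<^sub>\<psi>\<close> with values in it, and \<open>U\<^sub>p\<close>\<close>

definition Lam :: "('f, 'b, 'c::field) setting \<Rightarrow> 'c fps set" where
  "Lam S = {f. \<forall>n. \<exists>a. absp S a \<le> 1 \<and> fps_nth f n = a * jp S (varpi S) ^ n}"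

text \<open>The series \<open>det \<cdot> (a - c x)\<^sup>-\<^sup>2 \<cdot> f ((d x - b) / (a - c x))\<close>: the rational functions are
  expanded at \<open>x = 0\<close>, and the sum over the terms of \<open>f\<close> is taken coefficientwise in \<open>'c\<close>. The
  composition of formal power series in the library does not apply, because the constant term
  \<open>- b / a\<close> of the inner series need not vanish.\<close>

definition lam_act :: "('f, 'b, 'c::field) setting \<Rightarrow> 'b \<Rightarrow> 'c fps \<Rightarrow> 'c fps" where
  "lam_act S g f =
     (let M = iota_p S g; a = M $ 1 $ 1; b = M $ 1 $ 2; c = M $ 2 $ 1; d = M $ 2 $ 2;
          r = inverse (fps_const a - fps_const c * fps_X);
          y = (fps_const d * fps_X - fps_const b) * r
      in Abs_fps (\<lambda>m. abs_suminf (absp S)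
           (\<lambda>n. fps_nth f n * fps_nth (fps_const (a * d - b * c) * r ^ 2 * y ^ n) m)))"

definition Lam_mod :: "('f::field, 'b::ring_1, 'c::field) setting \<Rightarrow> ('b, 'c fps) gmod" where
  "Lam_mod S = \<lparr>grp = Gamma0p S, act = lam_act S, carr = Lam S\<rparr>"

definition Sigma0p :: "('f::field, 'b::ring_1, 'c::field) setting \<Rightarrow> 'b set" where
  "Sigma0p S = {g \<in> eich_ord S. nrd S g \<noteq> 0 \<and> iota_p S g $ 2 $ 1 \<in> pZp S \<and>
     iota_p S g $ 1 $ 1 \<in> Zp S \<and> absp S (iota_p S g $ 1 $ 1) = 1}"

text \<open>On divisors of degree zero this is determined by sending \<open>Q - P\<close> to
  \<open>1 / (x - Q) - 1 / (x - P)\<close>.\<close>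

definition eta :: "('c::field \<Rightarrow>\<^sub>0 int) \<Rightarrow> 'c fps" where
  "eta D = (\<Sum>Q\<in>Poly_Mapping.keys D.
     of_int (Poly_Mapping.lookup D Q) * inverse (fps_X - fps_const Q))"

definition SL2_Zp :: "('f, 'b, 'c::field) setting \<Rightarrow> ('c^2^2) set" where
  "SL2_Zp S = {M. (\<forall>i j. M $ i $ j \<in> Zp S) \<and> det M = 1}"

definition atkin_lehner_elt :: "('f::field, 'b::ring_1, 'c::field) setting \<Rightarrow> 'b \<Rightarrow> bool" where
  "atkin_lehner_elt S \<omega> \<longleftrightarrow>
     \<omega> \<in> eich_ord S \<and> (\<lambda>g. \<omega> * g * ring_inv \<omega>) ` Gamma0p S = Gamma0p S \<and>
     (\<exists>M\<in>SL2_Zp S. M $ 2 $ 1 \<in> pZp S \<and>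
        iota_p S \<omega> = M ** vector [vector [0, - 1], vector [jp S (varpi S), 0]])"

definition Wp ::
    "('f, 'b::ring_1, 'c::field) setting \<Rightarrow> 'b \<Rightarrow> ('b \<Rightarrow> ('c \<Rightarrow>\<^sub>0 int)) \<Rightarrow> 'b \<Rightarrow> ('c \<Rightarrow>\<^sub>0 int)" where
  "Wp S \<omega> \<phi> g = div_act S \<omega> (\<phi> (ring_inv \<omega> * g * \<omega>))"

definition phi_Lam_class ::
    "('f::field, 'b::ring_1, 'c::field) setting \<Rightarrow> 'b \<Rightarrow> ('b \<Rightarrow> ('c \<Rightarrow>\<^sub>0 int)) set \<Rightarrow>
      ('b \<Rightarrow> 'c fps) set" where
  "phi_Lam_class S \<omega> c0 =
     H1_map (Lam_mod S) (\<lambda>\<phi> g. eta (\<phi> g)) (H1_map (Div0Uinf_mod S) (Wp S \<omega>) c0)"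

definition Up_reps ::
    "('f::field, 'b::ring_1, 'c::field) setting \<Rightarrow> 'b \<Rightarrow> ('c set \<Rightarrow> 'b) \<Rightarrow> bool" where
  "Up_reps S hw h \<longleftrightarrow>
     hw \<in> Sigma0p S \<and> nrd S hw = varpi S \<and>
     (\<exists>M\<in>SL2_Zp S.
        iota_p S hw = vector [vector [1, 0], vector [0, jp S (varpi S)]] ** M) \<and>
     coset_reps (Gamma0p S) hw (Fp S) h"

definition Up ::
    "('f::field, 'b::ring_1, 'c::field) setting \<Rightarrow> ('c set \<Rightarrow> 'b) \<Rightarrow> ('b \<Rightarrow> 'c fps) \<Rightarrow> 'b \<Rightarrow> 'c fps"
    where
  "Up S h = double_coset_op (Lam_mod S) (Fp S) h"

definition Lam_sums :: "('f, 'b, 'c::field) setting \<Rightarrow> (nat \<Rightarrow> 'c fps) \<Rightarrow> 'c fps \<Rightarrow> bool" where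
  "Lam_sums S f s \<longleftrightarrow>
     s \<in> Lam S \<and>
     (\<forall>N. \<exists>n0. \<forall>n\<ge>n0. s - (\<Sum>k<n. f k) \<in> (*) (fps_const (jp S (varpi S) ^ N)) ` Lam S)"

definition Lam_summable :: "('f, 'b, 'c::field) setting \<Rightarrow> (nat \<Rightarrow> 'c fps) \<Rightarrow> bool" where
  "Lam_summable S f \<longleftrightarrow> (\<exists>s. Lam_sums S f s)"

definition Lam_suminf :: "('f, 'b, 'c::field) setting \<Rightarrow> (nat \<Rightarrow> 'c fps) \<Rightarrow> 'c fps" where
  "Lam_suminf S f = (THE s. Lam_sums S f s)"

text \<open>The series with terms \<open>F n \<phi>\<close>, for a representing cocycle \<open>\<phi>\<close> of \<open>c\<close>, defines the class \<open>C\<close>: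
  for every choice of \<open>\<phi>\<close> it converges at each group element and its sum is a cocycle in \<open>C\<close>.\<close>

definition series_defines_class ::
    "('f::field, 'b::ring_1, 'c::field) setting \<Rightarrow>
      (nat \<Rightarrow> ('b \<Rightarrow> 'c fps) \<Rightarrow> 'b \<Rightarrow> 'c fps) \<Rightarrow> ('b \<Rightarrow> 'c fps) set \<Rightarrow> ('b \<Rightarrow> 'c fps) set \<Rightarrow> bool"
    where
  "series_defines_class S F c C \<longleftrightarrow>
     C \<in> H1 (Lam_mod S) \<and>
     (\<forall>\<phi>\<in>c. (\<forall>\<gamma>\<in>Gamma0p S. Lam_summable S (\<lambda>n. F n \<phi> \<gamma>)) \<and>
             (\<lambda>\<gamma>. Lam_suminf S (\<lambda>n. F n \<phi> \<gamma>)) \<in> C)"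

end

theory Submission
  imports Defs
begin

text \<open>The key observation is that the series converge for every class with values in \<open>\<Lambda>\<close>. The
  action of \<open>\<sigma>\<close> on \<open>\<Lambda>\<close> carries the factor \<open>det \<sigma>\<close>, and the determinant of every coset
  representative \<open>h\<^sub>t\<close> is \<open>\<varpi>\<close> up to a unit, so \<open>U\<^sub>p\<close> maps cocycles to \<open>\<varpi>\<close> times cocycles. As \<open>\<Lambda>\<close> is
  \<open>\<varpi>\<close>-adically complete and separated, the geometric series of \<open>\<plusminus> U\<^sub>p\<close> converge and invert
  \<open>1 \<minusplus> U\<^sub>p\<close>. On a coboundary \<open>g \<mapsto> g v - v\<close> the operator \<open>U\<^sub>p\<close> acts through
  \<open>v \<mapsto> \<Sum>\<^sub>t h\<^sub>t v\<close>, which is divisible by \<open>\<varpi>\<close> as well, so the classes of the sums are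
  independent of the representing cocycle. That the action on \<open>\<Lambda>\<close> is multiplicative is a
  statement about substitution into power series, which is reduced to polynomials by
  approximation in the Gauss norm.\<close>

section \<open>Complete nonarchimedean fields\<close>

text \<open>The series (d x - b) / (a - c x) has constant term -b/a, in general not zero, so
  substituting it makes sense only for series with decaying coefficients. Two norms therefore work
  together: with q = |varpi|, \<open>bd q C\<close> bounds a series by \<open>C\<close> on the open
  disc of radius 1/q, and \<open>bd 1 C\<close> bounds its Gauss norm. Truncating an element of
  \<Lambda> after N terms leaves an error of Gauss norm at most q^N, while in the first norm the
  error need not become small. Hence errors are measured in the second norm and integrality is
  tracked in the first. The weight det (a - c x)^-2 is the derivative of the substituted series. So
  the action is pullback of the differential f dx, and \<open>eta\<close> takes a divisor of degree
  zero to the logarithmic derivative of a function with that divisor; this is the source of the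
  action law and of the equivariance of \<open>eta\<close>. On the cohomological side, maps on
  classes are unions over all representatives, and inverses, norms, transfers and sums are definite
  descriptions. Each has to be shown well defined before it can be computed with.\<close>

locale complete_nonarch =
  fixes nu :: "'c::field \<Rightarrow> real" and w :: 'c
  assumes nonarch: "nonarch_abs nu" and complete: "abs_complete nu"
    and w_pos: "0 < nu w" and w_less: "nu w < 1"
begin

lemma nu_nonneg [simp]: "0 \<le> nu x"
  and nu_eq_0 [simp]: "nu x = 0 \<longleftrightarrow> x = 0"
  and nu_mult: "nu (x * y) = nu x * nu y"
  and nu_add_max: "nu (x + y) \<le> max (nu x) (nu y)"
  using nonarch by (auto simp: nonarch_abs_def)

lemma nu_0 [simp]: "nu 0 = 0"
  by simp

lemma nu_1 [simp]: "nu 1 = 1"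
proof -
  have "nu 1 * nu 1 = nu 1 * 1" using nu_mult[of 1 1] by simp
  then show ?thesis by (simp only: mult_cancel_left nu_eq_0) simp
qed

lemma nu_power: "nu (x ^ n) = nu x ^ n"
  by (induction n) (auto simp: nu_mult)

lemma nu_minus [simp]: "nu (- x) = nu x"
proof -
  have "nu (- 1) ^ 2 = 1" by (simp flip: nu_power)
  then have "nu (- 1) = 1"
    using nu_nonneg[of "- 1"] by (smt (verit) power2_eq_1_iff)
  then show ?thesis using nu_mult[of "- 1" x] by simp
qed

lemma nu_inverse: "nu (inverse x) = inverse (nu x)"
proof (cases "x = 0")
  case False
  then have "nu x * nu (inverse x) = 1" by (simp flip: nu_mult)
  then show ?thesis by (metis inverse_unique)
qed simp

lemma nu_divide: "nu (x / y) = nu x / nu y"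
  by (simp add: divide_inverse nu_mult nu_inverse)

lemma nu_add_le: "nu x \<le> C \<Longrightarrow> nu y \<le> C \<Longrightarrow> nu (x + y) \<le> C"
  using nu_add_max[of x y] by linarith

lemma nu_diff_le: "nu x \<le> C \<Longrightarrow> nu y \<le> C \<Longrightarrow> nu (x - y) \<le> C"
  using nu_add_le[of x C "- y"] by simp

lemma nu_add_less: "nu x < C \<Longrightarrow> nu y < C \<Longrightarrow> nu (x + y) < C"
  using nu_add_max[of x y] by linarith

lemma nu_sum_le: "0 \<le> C \<Longrightarrow> (\<And>i. i \<in> I \<Longrightarrow> nu (f i) \<le> C) \<Longrightarrow> nu (sum f I) \<le> C"
  by (induction I rule: infinite_finite_induct) (auto intro: nu_add_le)

text \<open>Isosceles triangle principle: the missing inequality is the ultrametric one for x = (x +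
  y) - y, in which \<open>y\<close> is too small to attain the maximum.\<close>

lemma nu_add_eq: "nu y < nu x \<Longrightarrow> nu (x + y) = nu x"
  using nu_add_max[of x y] nu_add_max[of "x + y" "- y"] by auto

lemma nu_of_int_le: "nu (of_int n) \<le> 1"
proof -
  have "nu (of_nat m) \<le> 1" for m
    by (induction m) (auto intro: nu_add_le)
  then show ?thesis by (cases n) (auto simp del: of_nat_Suc)
qed

abbreviation q :: real where "q \<equiv> nu w"

lemma w_nonzero [simp]: "w \<noteq> 0"
  using w_pos by auto

lemma q_power_le: "m \<le> n \<Longrightarrow> q ^ n \<le> q ^ m"
  using w_pos w_less by (intro power_decreasing) auto

lemma q_power_le_1: "q ^ n \<le> 1"
  using q_power_le[of 0 n] by simp

lemma q_power_small: "0 < e \<Longrightarrow> \<exists>N. C * q ^ N < e"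
proof -
  assume "0 < e"
  have "(\<lambda>N. C * q ^ N) \<longlonglongrightarrow> C * 0"
    using w_pos w_less by (intro tendsto_mult LIMSEQ_power_zero) auto
  then have "\<forall>\<^sub>F N in sequentially. C * q ^ N < e"
    using \<open>0 < e\<close> by (intro order_tendstoD(2)[where y = 0]) auto
  then show ?thesis by (auto simp: eventually_sequentially)
qed

lemma eq_0_if_nu_le: "(\<And>N. nu x \<le> C * q ^ N) \<Longrightarrow> x = 0"
  using q_power_small[of "nu x" C] nu_nonneg[of x] nu_eq_0[of x] by (metis leD order_le_less)

lemma nu_le_if_approx: "0 \<le> C \<Longrightarrow> (\<And>N. nu x \<le> max C (D * q ^ N)) \<Longrightarrow> nu x \<le> C"
proof (rule ccontr)
  assume "0 \<le> C" and le: "\<And>N. nu x \<le> max C (D * q ^ N)" and "\<not> nu x \<le> C"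
  then obtain N where "D * q ^ N < nu x" using q_power_small[of "nu x" D] by auto
  then show False using le[of N] \<open>\<not> nu x \<le> C\<close> by auto
qed

lemma partial_sums_close:
  assumes "\<And>n. nu (f n) \<le> C * q ^ n" "m \<le> n"
  shows "nu ((\<Sum>i<n. f i) - (\<Sum>i<m. f i)) \<le> C * q ^ m"
proof -
  have C: "0 \<le> C" using order_trans[OF nu_nonneg assms(1)[of 0]] by simp
  have eq: "(\<Sum>i<n. f i) - (\<Sum>i<m. f i) = (\<Sum>i\<in>{m..<n}. f i)"
    using sum_diff_nat_ivl[of 0 m n f] assms(2) by (simp add: atLeast0LessThan)
  show ?thesis unfolding eq using w_pos C
    by (intro nu_sum_le) (auto intro!: order_trans[OF assms(1)] mult_left_mono q_power_le)
qed

text \<open>Completeness alone gives a limit; the ultrametric inequality lets the remainder keep the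
  rate of the terms. Later limits are handled through such explicit rates.\<close>

lemma sum_approx_ex:
  assumes "\<And>n. nu (f n) \<le> C * q ^ n"
  shows "\<exists>s. \<forall>N. nu (s - (\<Sum>n<N. f n)) \<le> C * q ^ N"
proof -
  let ?X = "\<lambda>N. \<Sum>n<N. f n"
  have close: "nu (?X n - ?X m) \<le> C * q ^ k" if "k \<le> m" "k \<le> n" for k m n
    using nu_diff_le[OF partial_sums_close[of f, OF assms that(2)] partial_sums_close[of f, OF assms that(1)]]
    by simp
  have "\<forall>\<epsilon>>0. \<exists>n0. \<forall>m\<ge>n0. \<forall>n\<ge>n0. nu (?X m - ?X n) < \<epsilon>"
    using close q_power_small by (meson order_le_less_trans)
  then obtain s where s: "(\<lambda>n. nu (?X n - s)) \<longlonglongrightarrow> 0"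
    using complete unfolding abs_complete_def by meson
  have "nu (s - ?X N) \<le> C * q ^ N" for N
  proof (cases "nu (s - ?X N) = 0")
    case True
    then show ?thesis using order_trans[OF nu_nonneg close[of N N N]] by simp
  next
    case False
    then have "nu (s - ?X N) > 0" using nu_nonneg[of "s - ?X N"] by linarith
    then have "\<forall>\<^sub>F n in sequentially. nu (?X n - s) < nu (s - ?X N)"
      by (rule order_tendstoD(2)[OF s])
    then obtain M where M: "\<And>n. n \<ge> M \<Longrightarrow> nu (?X n - s) < nu (s - ?X N)"
      by (auto simp: eventually_sequentially)
    \<comment> \<open>A partial sum that is closer to \<open>s\<close> than \<open>?X N\<close> can
      replace \<open>s\<close> without changing the distance to \<open>?X N\<close>, which leaves a
      distance between two partial sums.\<close>
    let ?n = "max M N"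
    have "nu ((s - ?X N) + (?X ?n - s)) = nu (s - ?X N)"
      by (rule nu_add_eq) (simp add: M)
    moreover have "(s - ?X N) + (?X ?n - s) = ?X ?n - ?X N" by simp
    ultimately have "nu (s - ?X N) = nu (?X ?n - ?X N)" by simp
    then show ?thesis using close[of N N ?n] by simp
  qed
  then show ?thesis by blast
qed

lemma abs_suminf_eq:
  assumes "\<And>N. nu (s - (\<Sum>n<N. f n)) \<le> C * q ^ N"
  shows "abs_suminf nu f = s"
  unfolding abs_suminf_def
proof (rule the_equality)
  have lim: "(\<lambda>N. C * q ^ N) \<longlonglongrightarrow> 0"
    using tendsto_mult[OF tendsto_const LIMSEQ_power_zero, of q C] w_pos w_less by simp
  show s: "(\<lambda>N. nu (s - (\<Sum>n<N. f n))) \<longlonglongrightarrow> 0"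
    by (rule Lim_null_comparison[OF _ lim]) (use assms in auto)
  fix s' assume s': "(\<lambda>N. nu (s' - (\<Sum>n<N. f n))) \<longlonglongrightarrow> 0"
  have "(\<lambda>N. nu (s' - (\<Sum>n<N. f n)) + nu (s - (\<Sum>n<N. f n))) \<longlonglongrightarrow> 0"
    using tendsto_add[OF s' s] by simp
  then have "(\<lambda>N::nat. nu (s' - s)) \<longlonglongrightarrow> 0"
  proof (rule Lim_null_comparison[rotated], intro always_eventually allI)
    fix N
    have "nu (s' - s) \<le> max (nu (s' - (\<Sum>n<N. f n))) (nu (- (s - (\<Sum>n<N. f n))))"
      using nu_add_max[of "s' - (\<Sum>n<N. f n)" "- (s - (\<Sum>n<N. f n))"] by simp
    then show "norm (nu (s' - s)) \<le> nu (s' - (\<Sum>n<N. f n)) + nu (s - (\<Sum>n<N. f n))"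
      using nu_nonneg[of "s' - (\<Sum>n<N. f n)"] nu_nonneg[of "s - (\<Sum>n<N. f n)"]
        nu_minus[of "s - (\<Sum>n<N. f n)"] nu_nonneg[of "s' - s"]
      unfolding real_norm_def by linarith
  qed
  then show "s' = s" by (simp add: tendsto_const_iff)
qed


section \<open>Power series with geometrically bounded coefficients\<close>

text \<open>For \<open>\<rho> = 1\<close> this bounds the Gauss norm; the module \<open>\<Lambda>\<close> is given by \<open>\<rho> = nu w\<close> and
  \<open>C = 1\<close>, with \<open>w\<close> the uniformiser.\<close>

definition bd :: "real \<Rightarrow> real \<Rightarrow> 'c fps \<Rightarrow> bool" where
  "bd \<rho> C f \<longleftrightarrow> (\<forall>n. nu (fps_nth f n) \<le> C * \<rho> ^ n)"

lemma bdD: "bd \<rho> C f \<Longrightarrow> nu (fps_nth f n) \<le> C * \<rho> ^ n"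
  by (simp add: bd_def)

lemma bd_nonneg: "bd \<rho> C f \<Longrightarrow> 0 \<le> C"
  using order_trans[OF nu_nonneg bdD[of \<rho> C f 0]] by simp

lemma bd_mono: "bd \<rho> C f \<Longrightarrow> C \<le> D \<Longrightarrow> 0 \<le> \<rho> \<Longrightarrow> bd \<rho> D f"
  unfolding bd_def by (meson mult_right_mono order_trans zero_le_power)

lemma bd_q_imp_bd_1: "bd q C f \<Longrightarrow> bd 1 C f"
  using mult_left_mono[OF q_power_le_1 bd_nonneg[of q C f]]
  unfolding bd_def by (metis mult.right_neutral order_trans power_one)

lemma bd_add: "bd \<rho> C f \<Longrightarrow> bd \<rho> C g \<Longrightarrow> bd \<rho> C (f + g)"
  by (simp add: bd_def nu_add_le)

lemma bd_minus: "bd \<rho> C f \<Longrightarrow> bd \<rho> C (- f)"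
  by (simp add: bd_def)

lemma bd_diff: "bd \<rho> C f \<Longrightarrow> bd \<rho> C g \<Longrightarrow> bd \<rho> C (f - g)"
  by (simp add: bd_def nu_diff_le)

lemma bd_0: "0 \<le> C \<Longrightarrow> 0 \<le> \<rho> \<Longrightarrow> bd \<rho> C 0"
  by (simp add: bd_def)

lemma bd_sum: "0 \<le> C \<Longrightarrow> 0 \<le> \<rho> \<Longrightarrow> (\<And>i. i \<in> I \<Longrightarrow> bd \<rho> C (f i)) \<Longrightarrow> bd \<rho> C (sum f I)"
  by (induction I rule: infinite_finite_induct) (auto intro: bd_add bd_0)

lemma bd_const: "nu a \<le> C \<Longrightarrow> 0 \<le> \<rho> \<Longrightarrow> bd \<rho> C (fps_const a)"
  using order_trans[OF nu_nonneg, of a C] by (auto simp: bd_def)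

lemma bd_X: "1 \<le> C * \<rho> \<Longrightarrow> 0 \<le> C \<Longrightarrow> 0 \<le> \<rho> \<Longrightarrow> bd \<rho> C fps_X"
  by (auto simp: bd_def fps_X_def)

lemma bd_mult:
  assumes "bd \<rho> C f" "bd \<rho> D g" "0 \<le> \<rho>"
  shows "bd \<rho> (C * D) (f * g)"
  unfolding bd_def
proof
  fix n
  have C: "0 \<le> C" "0 \<le> D" using assms bd_nonneg by auto
  show "nu (fps_nth (f * g) n) \<le> C * D * \<rho> ^ n"
    unfolding fps_mult_nth
  proof (rule nu_sum_le)
    fix i assume i: "i \<in> {0..n}"
    have "nu (fps_nth f i * fps_nth g (n - i)) \<le> (C * \<rho> ^ i) * (D * \<rho> ^ (n - i))"
      unfolding nu_mult using assms C by (intro mult_mono bdD) auto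
    also have "\<dots> = C * D * \<rho> ^ n"
      using i by (simp add: mult.left_commute mult.assoc flip: power_add)
    finally show "nu (fps_nth f i * fps_nth g (n - i)) \<le> C * D * \<rho> ^ n" .
  qed (use C assms in auto)
qed

lemma bd_mult_unit: "bd \<rho> 1 f \<Longrightarrow> bd \<rho> C g \<Longrightarrow> 0 \<le> \<rho> \<Longrightarrow> bd \<rho> C (f * g)"
  using bd_mult[of \<rho> 1 f C g] by simp

lemma bd_const_mult: "nu a \<le> D \<Longrightarrow> bd \<rho> C g \<Longrightarrow> 0 \<le> \<rho> \<Longrightarrow> bd \<rho> (D * C) (fps_const a * g)"
  by (intro bd_mult bd_const)

lemma bd_power: "bd \<rho> C f \<Longrightarrow> 0 \<le> \<rho> \<Longrightarrow> bd \<rho> (C ^ n) (f ^ n)"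
  by (induction n) (auto intro: bd_mult bd_const simp flip: fps_const_1_eq_1)

lemma eq_if_bd: "(\<And>N. bd 1 (C * q ^ N) (f - g)) \<Longrightarrow> f = g"
proof (rule fps_ext)
  fix n assume "\<And>N. bd 1 (C * q ^ N) (f - g)"
  then have "nu (fps_nth f n - fps_nth g n) \<le> C * q ^ N" for N
    using bdD[of 1 "C * q ^ N" "f - g" n] by simp
  then show "fps_nth f n = fps_nth g n" using eq_0_if_nu_le by fastforce
qed

text \<open>Each coefficient of \<open>f\<close> is a limit of coefficients of the
  \<open>F N\<close>, so the bound passes over one coefficient at a time. This is why approximation
  in the Gauss norm suffices to transfer a bound for \<open>\<rho>\<close>.\<close>

lemma bd_if_approx:
  assumes "0 \<le> C" "0 \<le> \<rho>" "\<And>N. bd \<rho> C (F N)" "\<And>N. bd 1 (D * q ^ N) (f - F N)"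
  shows "bd \<rho> C f"
  unfolding bd_def
proof
  fix n
  show "nu (fps_nth f n) \<le> C * \<rho> ^ n"
  proof (rule nu_le_if_approx)
    fix N
    have "nu ((fps_nth f n - fps_nth (F N) n) + fps_nth (F N) n) \<le> max (C * \<rho> ^ n) (D * q ^ N)"
      using bdD[OF assms(3)[of N], of n] bdD[OF assms(4)[of N], of n]
      by (intro nu_add_le) (auto simp: max_def)
    then show "nu (fps_nth f n) \<le> max (C * \<rho> ^ n) (D * q ^ N)" by simp
  qed (use assms in auto)
qed


section \<open>Substitution into power series\<close>

text \<open>The inner sum of \<open>lam_act\<close> without its weight factor. Summing every
  coefficient in the complete field is what permits a constant term in \<open>y\<close>.\<close>

definition sub :: "'c fps \<Rightarrow> 'c fps \<Rightarrow> 'c fps" where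
  "sub y f = Abs_fps (\<lambda>m. abs_suminf nu (\<lambda>n. fps_nth f n * fps_nth (y ^ n) m))"

definition psub :: "nat \<Rightarrow> 'c fps \<Rightarrow> 'c fps \<Rightarrow> 'c fps" where
  "psub N y f = (\<Sum>n<N. fps_const (fps_nth f n) * y ^ n)"

lemma bd_1_power: "bd 1 1 y \<Longrightarrow> bd 1 1 (y ^ n)"
  using bd_power[of 1 1 y n] by simp

lemma bd_1_term: "nu a \<le> C \<Longrightarrow> bd 1 1 y \<Longrightarrow> bd 1 C (fps_const a * y ^ n)"
  using bd_const_mult[OF _ bd_1_power, of a C y n] by simp

text \<open>The decay q^n of the n-th coefficient of \<open>f\<close> cancels the growth (1/q)^n of
  \<open>y ^ n\<close>; geometrically, \<open>y\<close> maps the disc of radius 1/q into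
  itself.\<close>

lemma bd_q_term:
  assumes "bd q C f" "bd q (1 / q) y"
  shows "bd q C (fps_const (fps_nth f n) * y ^ n)"
proof -
  have "bd q (C * q ^ n * (1 / q) ^ n) (fps_const (fps_nth f n) * y ^ n)"
    by (intro bd_mult bd_const bd_power bdD assms) auto
  then show ?thesis by (simp add: power_divide)
qed

lemma bd_q_psub: "bd q C f \<Longrightarrow> bd q (1 / q) y \<Longrightarrow> bd q C (psub N y f)"
  unfolding psub_def by (intro bd_sum bd_q_term) (auto intro: bd_nonneg)

lemma bd_1_psub: "bd 1 C f \<Longrightarrow> bd 1 1 y \<Longrightarrow> bd 1 C (psub N y f)"
  unfolding psub_def using bdD[of 1 C f]
  by (intro bd_sum bd_1_term) (auto intro: bd_nonneg)

text \<open>From index \<open>N\<close> on, the coefficients of \<open>f\<close> are at most C q^N,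
  and powers of \<open>y\<close> have Gauss norm at most 1.\<close>

lemma sub_approx:
  assumes f: "bd q C f" and y: "bd 1 1 y"
  shows "bd 1 (C * q ^ N) (sub y f - psub N y f)"
  unfolding bd_def
proof
  fix m
  let ?t = "\<lambda>n. fps_nth f n * fps_nth (y ^ n) m"
  have "nu (?t n) \<le> C * q ^ n" for n
    using mult_mono[OF bdD[OF f, of n] bdD[OF bd_1_power[OF y], of n m]] bd_nonneg[OF f]
    by (simp add: nu_mult)
  from sum_approx_ex[of ?t, OF this]
  obtain s where s: "\<And>N. nu (s - (\<Sum>n<N. ?t n)) \<le> C * q ^ N" by blast
  have "fps_nth (sub y f) m = s" using abs_suminf_eq[of s ?t, OF s] by (simp add: sub_def)
  then show "nu (fps_nth (sub y f - psub N y f) m) \<le> C * q ^ N * 1 ^ m"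
    using s[of N] by (simp add: psub_def fps_sum_nth)
qed

text \<open>The standard way to identify a substitution: compare the candidate with polynomials in
  \<open>y\<close>, at a geometric rate with any constant \<open>D\<close>.\<close>

lemma sub_unique:
  assumes f: "bd q C f" and y: "bd 1 1 y" and G: "\<And>N. bd 1 (D * q ^ N) (G - psub N y f)"
  shows "sub y f = G"
proof (rule eq_if_bd)
  fix N
  have D: "0 \<le> D" using bd_nonneg[OF G[of 0]] by simp
  have C: "0 \<le> C" using bd_nonneg[OF f] .
  have "bd 1 ((C + D) * q ^ N) ((sub y f - psub N y f) - (G - psub N y f))"
    using C D by (intro bd_diff bd_mono[OF sub_approx[OF f y]] bd_mono[OF G] mult_right_mono) auto
  then show "bd 1 ((C + D) * q ^ N) (sub y f - G)" by simp
qed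

lemma psub_diff: "psub N y (f - g) = psub N y f - psub N y g"
  by (simp add: psub_def algebra_simps sum_subtractf flip: fps_const_sub)

lemma sub_diff:
  assumes f: "bd q C f" and g: "bd q C g" and y: "bd 1 1 y"
  shows "sub y (f - g) = sub y f - sub y g"
proof (rule sub_unique[OF bd_diff[OF f g] y])
  fix N
  have "bd 1 (C * q ^ N) ((sub y f - psub N y f) - (sub y g - psub N y g))"
    by (intro bd_diff sub_approx assms)
  then show "bd 1 (C * q ^ N) (sub y f - sub y g - psub N y (f - g))"
    by (simp add: psub_diff algebra_simps)
qed

text \<open>The product of the truncations runs over the square i, j < N, the truncated product over
  the triangle i + j < N. Every term in between has i + j \<ge> N and so carries a factor of size at
  most C D q^N.\<close>

lemma pmult_sub_eq:
  assumes f: "bd q C f" and g: "bd q D g" and y: "bd 1 1 y"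
  shows "bd 1 (C * D * q ^ N) (psub N y f * psub N y g - psub N y (f * g))"
proof -
  let ?t = "\<lambda>(i, j). fps_const (fps_nth f i * fps_nth g j) * y ^ (i + j)"
  let ?T = "{(i, j). i + j < N}"
  have C: "0 \<le> C" "0 \<le> D" using f g bd_nonneg by auto
  have "psub N y f * psub N y g = (\<Sum>p\<in>{..<N} \<times> {..<N}. ?t p)"
    unfolding psub_def sum_product sum.cartesian_product
    by (intro sum.cong) (auto simp: power_add algebra_simps simp flip: fps_const_mult)
  moreover have "psub N y (f * g) = (\<Sum>p\<in>?T. ?t p)"
  proof -
    have const_sum: "fps_const (sum a I) = (\<Sum>i\<in>I. fps_const (a i))" for a :: "nat \<Rightarrow> 'c" and I
      by (induction I rule: infinite_finite_induct) (auto simp flip: fps_const_add)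
    have "psub N y (f * g) = (\<Sum>n<N. \<Sum>i\<le>n. ?t (i, n - i))"
      unfolding psub_def fps_mult_nth
      by (intro sum.cong) (auto simp: sum_distrib_right atLeast0AtMost const_sum)
    then show ?thesis using sum.triangle_reindex[of "\<lambda>i j. ?t (i, j)" N] by simp
  qed
  moreover have "?T \<subseteq> {..<N} \<times> {..<N}" by auto
  ultimately have "psub N y f * psub N y g - psub N y (f * g)
      = (\<Sum>p\<in>{..<N} \<times> {..<N} - ?T. ?t p)"
    by (simp add: sum_diff)
  moreover have "bd 1 (C * D * q ^ N) \<dots>"
  proof (rule bd_sum)
    fix p assume "p \<in> {..<N} \<times> {..<N} - ?T"
    then obtain i j where p: "p = (i, j)" "N \<le> i + j" by force
    have "nu (fps_nth f i * fps_nth g j) \<le> (C * q ^ i) * (D * q ^ j)"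
      unfolding nu_mult using C by (intro mult_mono bdD f g) auto
    also have "\<dots> = C * D * q ^ (i + j)" by (simp add: power_add)
    also have "\<dots> \<le> C * D * q ^ N" using C p(2) by (intro mult_left_mono q_power_le) auto
    finally show "bd 1 (C * D * q ^ N) (?t p)"
      using bd_const_mult[OF _ bd_1_power[OF y]] p(1) by fastforce
  qed (use C in auto)
  ultimately show ?thesis by simp
qed

lemma sub_mult:
  assumes f: "bd q C f" and g: "bd q D g" and y: "bd 1 1 y"
  shows "sub y (f * g) = sub y f * sub y g"
proof (rule sub_unique[OF bd_mult[OF f g] y])
  have C: "0 \<le> C" "0 \<le> D" using f g bd_nonneg by auto
  have psub: "bd 1 E (psub N y h)" if h: "bd q E h" for E N h
    by (intro bd_1_psub bd_q_imp_bd_1 that y)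
  fix N
  have 1: "bd 1 (C * q ^ N * D) ((sub y f - psub N y f) * psub N y g)"
    by (intro bd_mult sub_approx psub assms) auto
  have f0: "bd 1 C (sub y f)"
    using sub_approx[OF f y, of 0] by (simp add: psub_def)
  have 2: "bd 1 (C * (D * q ^ N)) (sub y f * (sub y g - psub N y g))"
    by (intro bd_mult sub_approx f0 assms) auto
  \<comment> \<open>Telescoping: one factor is truncated at a time, and then the product of
    truncations is replaced by the truncated product.\<close>
  have "bd 1 (C * D * q ^ N) (sub y f * (sub y g - psub N y g) + (sub y f - psub N y f) * psub N y g
      + (psub N y f * psub N y g - psub N y (f * g)))"
    using 1 2 by (intro bd_add pmult_sub_eq assms) (simp_all add: ac_simps)
  then show "bd 1 (C * D * q ^ N) (sub y f * sub y g - psub N y (f * g))"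
    by (simp add: algebra_simps)
qed simp

lemma sub_bd_1:
  assumes f: "bd q C f" and E: "bd 1 E f" and y: "bd 1 1 y"
  shows "bd 1 E (sub y f)"
proof (rule bd_if_approx[where F = "\<lambda>N. psub N y f"])
  show "bd 1 E (psub N y f)" for N by (intro bd_1_psub E y)
qed (use sub_approx[OF f y] bd_nonneg[OF E] in auto)

text \<open>The truncations satisfy the bound at radius 1/q and converge in the Gauss norm, which is
  enough. In particular substitution preserves \<Lambda>.\<close>

lemma sub_bd_q:
  assumes f: "bd q C f" and y: "bd 1 1 y" "bd q (1 / q) y"
  shows "bd q C (sub y f)"
proof (rule bd_if_approx[where F = "\<lambda>N. psub N y f"])
  show "bd q C (psub N y f)" for N by (intro bd_q_psub f y)
qed (use sub_approx[OF f y(1)] bd_nonneg[OF f] in auto)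

lemma sub_const: "bd 1 1 y \<Longrightarrow> sub y (fps_const a) = fps_const a"
proof (rule sub_unique)
  fix N assume "bd 1 1 y"
  have "psub N y (fps_const a) = (if N = 0 then 0 else fps_const a)"
    unfolding psub_def
    by (cases N) (auto simp: lessThan_Suc_eq_insert_0 sum.reindex)
  then show "bd 1 (nu a * q ^ N) (fps_const a - psub N y (fps_const a))"
    by (auto intro!: bd_const bd_0)
qed (auto intro: bd_const)

lemma sub_X: "bd 1 1 y \<Longrightarrow> sub y fps_X = y"
proof (rule sub_unique)
  fix N assume y: "bd 1 1 y"
  have "psub N y fps_X = (if N < 2 then 0 else y)"
  proof -
    have "psub N y fps_X = (\<Sum>n<N. if n = 1 then y else 0)"
      unfolding psub_def by (intro sum.cong) (auto simp: fps_X_def)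
    then show ?thesis by (simp add: sum.delta)
  qed
  \<comment> \<open>For \<open>N\<close> equal to 0 or 1 the truncation misses the linear term. The
    constant 1/q, the norm of \<open>fps_X\<close> at radius 1/q, absorbs this error of Gauss norm
    at most 1.\<close>
  moreover have "(1::real) \<le> 1 / q * q ^ N" if "N < 2"
    using that w_pos w_less by (cases N) (auto simp: divide_simps less_Suc_eq numeral_2_eq_2)
  ultimately show "bd 1 (1 / q * q ^ N) (y - psub N y fps_X)"
    using y w_pos by (auto intro!: bd_0 intro: bd_mono)
  show "bd q (1 / q) fps_X" using w_pos by (intro bd_X) auto
qed

text \<open>The definition of \<open>lam_act\<close> has the weight inside the sum over the terms of
  \<open>f\<close>; with \<open>K\<close> as the weight, this moves it outside.\<close>

lemma mult_sub_eq:
  assumes f: "bd q C f" and y: "bd 1 1 y" and K: "bd 1 1 K"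
  shows "K * sub y f = Abs_fps (\<lambda>m. abs_suminf nu (\<lambda>n. fps_nth f n * fps_nth (K * y ^ n) m))"
proof (rule fps_ext)
  fix m
  have "abs_suminf nu (\<lambda>n. fps_nth f n * fps_nth (K * y ^ n) m) = fps_nth (K * sub y f) m"
  proof (rule abs_suminf_eq)
    fix N
    have "bd 1 (C * q ^ N) (K * (sub y f - psub N y f))"
      by (intro bd_mult_unit sub_approx assms) auto
    moreover have "K * psub N y f = (\<Sum>n<N. fps_const (fps_nth f n) * (K * y ^ n))"
      unfolding psub_def sum_distrib_left by (intro sum.cong) (auto simp: mult.left_commute)
    ultimately show "nu (fps_nth (K * sub y f) m
        - (\<Sum>n<N. fps_nth f n * fps_nth (K * y ^ n) m)) \<le> C * q ^ N"
      using bdD[of 1 "C * q ^ N" "K * sub y f - K * psub N y f" m]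
      by (simp add: right_diff_distrib fps_sum_nth)
  qed
  then show "fps_nth (K * sub y f) m = fps_nth (Abs_fps (\<lambda>m. abs_suminf nu
      (\<lambda>n. fps_nth f n * fps_nth (K * y ^ n) m))) m" by simp
qed

lemma sub_power: "bd q C f \<Longrightarrow> bd 1 1 y \<Longrightarrow> sub y (f ^ n) = sub y f ^ n"
proof (induction n)
  case 0
  then show ?case using sub_const[of y 1] by simp
next
  case (Suc n)
  then show ?case using sub_mult[OF Suc.prems(1) bd_power[OF Suc.prems(1), of n]] by simp
qed

lemma sub_psub:
  assumes y: "bd 1 1 y" and z: "bd q D z"
  shows "sub y (psub N z f) = psub N (sub y z) f"
proof (induction N)
  case 0
  then show ?case using sub_const[OF y, of 0] by (simp add: psub_def)
next
  case (Suc N)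
  let ?t = "fps_const (fps_nth f N) * z ^ N"
  have t: "bd q (nu (fps_nth f N) * D ^ N) ?t"
    by (intro bd_mult bd_const bd_power z) auto
  have D: "0 \<le> D" using bd_nonneg[OF z] .
  \<comment> \<open>Only the existence of a common bound matters, as the hypothesis of
    \<open>sub_diff\<close>; a sum of norms of all terms serves.\<close>
  have p: "\<exists>E. bd q E (psub N z f)"
    unfolding psub_def
  proof (rule exI, rule bd_sum)
    fix i assume i: "i \<in> {..<N}"
    show "bd q (\<Sum>n<N. nu (fps_nth f n) * D ^ n) (fps_const (fps_nth f i) * z ^ i)"
      by (rule bd_mono[OF bd_mult[OF bd_const[OF order_refl] bd_power[OF z]]])
        (use i D in \<open>auto intro!: member_le_sum[of i _ "\<lambda>n. nu (fps_nth f n) * D ^ n"]\<close>)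
  qed (use D in \<open>auto intro!: sum_nonneg\<close>)
  then obtain E where E: "bd q E (psub N z f)" by blast
  let ?m = "max E (nu (fps_nth f N) * D ^ N)"
  have mE: "bd q ?m (psub N z f)" by (rule bd_mono[OF E]) auto
  have mt: "bd q ?m ?t" by (rule bd_mono[OF t]) auto
  \<comment> \<open>Additivity of \<open>sub\<close> is available in the form
    \<open>sub_diff\<close>, so the new term is subtracted with its sign reversed.\<close>
  have "psub (Suc N) z f = psub N z f - (- ?t)" by (simp add: psub_def)
  then have "sub y (psub (Suc N) z f) = sub y (psub N z f) - sub y (0 - ?t)"
    using sub_diff[OF mE bd_minus[OF mt] y] by simp
  also have "sub y (0 - ?t) = 0 - sub y ?t"
    using sub_diff[OF bd_0 mt y] sub_const[OF y, of 0] bd_nonneg[OF mt] by simp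
  also have "sub y ?t = fps_const (fps_nth f N) * sub y z ^ N"
    using sub_mult[OF bd_const[OF order_refl] bd_power[OF z, of N] y] sub_const[OF y]
      sub_power[OF z y] by simp
  finally show ?case using Suc.IH by (simp add: psub_def)
qed

text \<open>Replace \<open>sub z f\<close> by a polynomial in \<open>z\<close>: the error is small
  in the Gauss norm, which \<open>sub y\<close> does not increase, and for polynomials associativity
  is multiplicativity. The bound of \<open>z\<close> at radius 1/q ensures that
  \<open>sub z f\<close> has decaying coefficients, so that \<open>sub y\<close> applies to
  it.\<close>

lemma sub_sub:
  assumes f: "bd q C f" and y: "bd 1 1 y" and z: "bd 1 1 z" "bd q (1 / q) z"
  shows "sub y (sub z f) = sub (sub y z) f"
proof (rule sub_unique[symmetric])
  show "bd q C f" "bd 1 1 (sub y z)" using f sub_bd_1[OF z(2,1) y] by auto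
  fix N
  have "bd q C (psub N z f)" by (intro bd_q_psub f z)
  note d = bd_diff[OF sub_bd_q[OF f z] this] and e = sub_diff[OF sub_bd_q[OF f z] this y]
  have "bd 1 (C * q ^ N) (sub y (sub z f - psub N z f))"
    by (intro sub_bd_1[OF d] sub_approx f z y)
  then show "bd 1 (C * q ^ N) (sub y (sub z f) - psub N (sub y z) f)"
    using e sub_psub[OF y z(2)] by simp
qed

end

section \<open>The action of matrices on power series\<close>

lemma matrix_mult_2:
  fixes M N :: "'a::semiring_1^2^2"
  shows "(M ** N) $ i $ j = M $ i $ 1 * N $ 1 $ j + M $ i $ 2 * N $ 2 $ j"
  by (simp add: matrix_matrix_mult_def sum_2)

context complete_nonarch
begin

text \<open>Multiplicativity of the norm for a dominant constant term: each coefficient of the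
  reciprocal is, up to that term, a sum of coefficients of \<open>f\<close> times earlier
  coefficients of the reciprocal, and the induction loses nothing in the ultrametric
  estimate.\<close>

lemma bd_inverse:
  assumes f: "bd \<rho> (nu (fps_nth f 0)) f" and f0: "fps_nth f 0 \<noteq> 0" and \<rho>: "0 \<le> \<rho>"
  shows "bd \<rho> (1 / nu (fps_nth f 0)) (inverse f)"
  unfolding bd_def
proof
  let ?E = "nu (fps_nth f 0)"
  have E: "?E > 0" using f0 nu_nonneg[of "fps_nth f 0"] nu_eq_0[of "fps_nth f 0"] by linarith
  fix n show "nu (fps_nth (inverse f) n) \<le> 1 / ?E * \<rho> ^ n"
  proof (induction n rule: less_induct)
    case (less n)
    show ?case
    proof (cases n)
      case 0
      then show ?thesis using f0 by (simp add: nu_inverse divide_inverse)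
    next
      case (Suc m)
      let ?s = "\<Sum>i=1..n. fps_nth f i * fps_nth (inverse f) (n - i)"
      have "fps_nth (f * inverse f) n = 0"
        using inverse_mult_eq_1'[OF f0] Suc by simp
      then have "fps_nth f 0 * fps_nth (inverse f) n = - ?s"
        unfolding fps_mult_nth sum.atLeast_Suc_atMost[OF le0]
        by (simp add: eq_neg_iff_add_eq_0)
      then have "?E * nu (fps_nth (inverse f) n) = nu ?s"
        by (metis nu_minus nu_mult)
      also have "\<dots> \<le> \<rho> ^ n"
      proof (rule nu_sum_le)
        fix i assume i: "i \<in> {1..n}"
        have "nu (fps_nth f i * fps_nth (inverse f) (n - i)) \<le> (?E * \<rho> ^ i) * (1 / ?E * \<rho> ^ (n - i))"
          unfolding nu_mult using i \<rho> by (intro mult_mono bdD f less) auto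
        also have "\<dots> = \<rho> ^ n"
          using i f0 by (simp flip: power_add)
        finally show "nu (fps_nth f i * fps_nth (inverse f) (n - i)) \<le> \<rho> ^ n" .
      qed (use \<rho> in auto)
      finally show ?thesis using E by (simp add: field_simps)
    qed
  qed
qed

text \<open>Only sizes are recorded, with |c| \<le> q in place of membership in
  \<open>pZp S\<close>, since the estimates use nothing else.\<close>

definition integral_mat :: "'c^2^2 \<Rightarrow> bool" where
  "integral_mat M \<longleftrightarrow> (\<forall>i j. nu (M $ i $ j) \<le> 1) \<and> nu (M $ 2 $ 1) \<le> q"

definition sigma_mat :: "'c^2^2 \<Rightarrow> bool" where
  "sigma_mat M \<longleftrightarrow> integral_mat M \<and> nu (M $ 1 $ 1) = 1"

lemma nu_mult_le_1: "nu x \<le> 1 \<Longrightarrow> nu y \<le> 1 \<Longrightarrow> nu (x * y) \<le> 1"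
  unfolding nu_mult by (rule mult_le_one) auto

lemma nu_mult_le: "nu x \<le> C \<Longrightarrow> nu y \<le> 1 \<Longrightarrow> nu (x * y) \<le> C"
  unfolding nu_mult using mult_mono[of "nu x" C "nu y" 1] order_trans[OF nu_nonneg, of x C] by simp

lemma nu_mult_le': "nu x \<le> 1 \<Longrightarrow> nu y \<le> C \<Longrightarrow> nu (x * y) \<le> C"
  using nu_mult_le[of y C x] by (simp add: mult.commute)

lemma integral_mat_mult:
  assumes "integral_mat M" "integral_mat N"
  shows "integral_mat (M ** N)"
  using assms unfolding integral_mat_def matrix_mult_2
  by (auto intro!: nu_add_le nu_mult_le_1 intro: nu_mult_le nu_mult_le')

text \<open>Modulo elements of absolute value less than 1 the matrices are upper triangular, so
  their upper left entries multiply.\<close>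

lemma nu_11_mult:
  assumes "integral_mat M" "integral_mat N"
  shows "nu ((M ** N) $ 1 $ 1) = 1 \<longleftrightarrow> nu (M $ 1 $ 1) = 1 \<and> nu (N $ 1 $ 1) = 1"
proof -
  let ?x = "M $ 1 $ 1 * N $ 1 $ 1" and ?y = "M $ 1 $ 2 * N $ 2 $ 1"
  have y: "nu ?y < 1"
    using nu_mult_le'[of "M $ 1 $ 2" "N $ 2 $ 1" q] assms w_less by (auto simp: integral_mat_def)
  have x: "nu ?x \<le> 1" using assms by (intro nu_mult_le_1) (auto simp: integral_mat_def)
  have "nu (?x + ?y) = 1 \<longleftrightarrow> nu ?x = 1"
  proof (cases "nu ?x = 1")
    case True
    then show ?thesis using nu_add_eq[of ?y ?x] y by simp
  next
    case False
    then have "nu (?x + ?y) < 1" using x y by (intro nu_add_less) auto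
    then show ?thesis using False by simp
  qed
  moreover have "nu ?x = 1 \<longleftrightarrow> nu (M $ 1 $ 1) = 1 \<and> nu (N $ 1 $ 1) = 1"
  proof
    assume 1: "nu ?x = 1"
    have "nu ?x \<le> nu (M $ 1 $ 1)" "nu ?x \<le> nu (N $ 1 $ 1)"
      using assms by (auto intro: nu_mult_le nu_mult_le' simp: integral_mat_def)
    moreover have "nu (M $ 1 $ 1) \<le> 1" "nu (N $ 1 $ 1) \<le> 1"
      using assms by (auto simp: integral_mat_def)
    ultimately show "nu (M $ 1 $ 1) = 1 \<and> nu (N $ 1 $ 1) = 1" using 1 by simp
  qed (simp add: nu_mult)
  ultimately show ?thesis by (simp add: matrix_mult_2)
qed

lemma sigma_mat_mult: "sigma_mat M \<Longrightarrow> sigma_mat N \<Longrightarrow> sigma_mat (M ** N)"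
  by (simp add: sigma_mat_def integral_mat_mult nu_11_mult)

definition den :: "'c^2^2 \<Rightarrow> 'c fps" where
  "den M = fps_const (M $ 1 $ 1) - fps_const (M $ 2 $ 1) * fps_X"

definition recip :: "'c^2^2 \<Rightarrow> 'c fps" where
  "recip M = inverse (den M)"

text \<open>The image of the variable under the inverse of \<open>M\<close>, written with the
  adjugate matrix.\<close>

definition arg :: "'c^2^2 \<Rightarrow> 'c fps" where
  "arg M = (fps_const (M $ 2 $ 2) * fps_X - fps_const (M $ 1 $ 2)) * recip M"

text \<open>The derivative of \<open>arg M\<close>; with this factor the law for products of
  matrices becomes the chain rule.\<close>

definition wt :: "'c^2^2 \<Rightarrow> 'c fps" where
  "wt M = fps_const (det M) * recip M ^ 2"

definition mact :: "'c^2^2 \<Rightarrow> 'c fps \<Rightarrow> 'c fps" where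
  "mact M f = wt M * sub (arg M) f"

lemma sigma_matD:
  assumes "sigma_mat M"
  shows "nu (M $ i $ j) \<le> 1" "nu (M $ 2 $ 1) \<le> q" "nu (M $ 1 $ 1) = 1" "M $ 1 $ 1 \<noteq> 0"
  using assms by (auto simp: sigma_mat_def integral_mat_def)

lemma den_recip: "sigma_mat M \<Longrightarrow> den M * recip M = 1"
  unfolding recip_def by (rule inverse_mult_eq_1') (simp add: den_def sigma_matD)

lemma bd_den: "sigma_mat M \<Longrightarrow> bd q 1 (den M)"
proof -
  assume M: "sigma_mat M"
  have "bd q (q * (1 / q)) (fps_const (M $ 2 $ 1) * fps_X)"
    using w_pos by (intro bd_const_mult bd_X sigma_matD M) auto
  then show ?thesis unfolding den_def by (intro bd_diff bd_const) (auto simp: sigma_matD M)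
qed

lemma bd_recip:
  assumes "sigma_mat M" shows "bd q 1 (recip M)"
proof -
  have "fps_nth (den M) 0 = M $ 1 $ 1" by (simp add: den_def)
  then show ?thesis
    using bd_inverse[of q "den M"] bd_den[OF assms] assms by (simp add: recip_def sigma_matD)
qed

lemma nu_det_le:
  assumes "sigma_mat M" shows "nu (det M) \<le> 1"
  unfolding det_2 using assms by (intro nu_diff_le nu_mult_le_1 sigma_matD)

lemma bd_wt: "sigma_mat M \<Longrightarrow> bd q (nu (det M)) (wt M)"
  unfolding wt_def using bd_mult[OF bd_const[OF order_refl] bd_power[OF bd_recip, of M 2], of "det M"]
  by simp

text \<open>For |x| < 1/q the conditions |a| = 1 and |c| \<le> q give |a - c x| = 1, while |d x - b|
  stays below 1/q, and is at most 1 if |x| \<le> 1. So the inverse of \<open>M\<close> respects both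
  discs.\<close>

lemma bd_arg:
  assumes "sigma_mat M" shows "bd 1 1 (arg M)" and "bd q (1 / q) (arg M)"
proof -
  have "bd 1 (1 * 1 * 1) (arg M)"
    unfolding arg_def using assms
    by (intro bd_mult bd_diff bd_q_imp_bd_1[OF bd_recip]) (auto intro!: bd_mult_unit bd_const bd_X sigma_matD)
  then show "bd 1 1 (arg M)" by simp
  have "1 \<le> 1 / q" using w_pos w_less by simp
  then have "bd q (1 / q * 1) (arg M)"
    unfolding arg_def using assms w_pos
    by (intro bd_mult bd_diff bd_recip)
      (auto intro!: bd_mult_unit bd_const bd_X sigma_matD intro: order_trans[OF sigma_matD(1)])
  then show "bd q (1 / q) (arg M)" by simp
qed

lemma mact_bd:
  assumes "sigma_mat M" "bd q C f" shows "bd q (nu (det M) * C) (mact M f)"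
  unfolding mact_def by (intro bd_mult bd_wt sub_bd_q assms bd_arg) simp

lemma mact_bd_le:
  assumes "sigma_mat M" "bd q C f" shows "bd q C (mact M f)"
  using mact_bd[OF assms] mult_right_mono[OF nu_det_le[OF assms(1)] bd_nonneg[OF assms(2)]]
  by (auto intro: bd_mono)

lemma mact_diff:
  assumes "sigma_mat M" "bd q C f" "bd q C g"
  shows "mact M (f - g) = mact M f - mact M g"
  unfolding mact_def by (simp add: sub_diff[OF assms(2,3) bd_arg(1)[OF assms(1)]] right_diff_distrib)

text \<open>Two relations carry the proof: \<open>den (M ** N)\<close> is \<open>den M\<close> times
  the substitution of \<open>arg M\<close> into \<open>den N\<close>, and
  \<open>arg (M ** N)\<close> is the substitution of \<open>arg M\<close> into \<open>arg N\<close>.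
  The order is right because \<open>arg\<close> belongs to inverse matrices.\<close>

lemma mact_mult:
  assumes M: "sigma_mat M" and N: "sigma_mat N" and f: "bd q C f"
  shows "mact M (mact N f) = mact (M ** N) f"
proof -
  let ?y = "arg M" and ?r = "recip M" and ?s = "sub (arg M) (recip N)"
  note y = bd_arg[OF M]
  have X: "bd q (1 / q) fps_X" using w_pos by (intro bd_X) auto
  have c: "bd q (1 / q) (fps_const a)" if "nu a \<le> 1" for a
    using that w_pos w_less by (intro bd_const) (auto intro: order_trans)
  have cX: "bd q (1 / q) (fps_const a * fps_X)" if "nu a \<le> 1" for a
    using that by (intro bd_mult_unit bd_const X) auto
  have lin: "sub ?y (fps_const a * fps_X) = fps_const a * ?y" if "nu a \<le> 1" for a
    using sub_mult[OF bd_const[OF that] X y(1)] sub_const[OF y(1)] sub_X[OF y(1)] by simp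
  have ry: "?y = (fps_const (M $ 2 $ 2) * fps_X - fps_const (M $ 1 $ 2)) * ?r"
    by (simp add: arg_def)
  have 1: "den M * ?r = 1" by (rule den_recip[OF M])
  have "sub ?y (den N) = fps_const (N $ 1 $ 1) - fps_const (N $ 2 $ 1) * ?y"
    unfolding den_def using sub_diff[OF c cX y(1)] sub_const[OF y(1)] lin sigma_matD(1)[OF N] by simp
  moreover have "1 = sub ?y (den N) * ?s"
    using sub_mult[OF bd_den[OF N] bd_recip[OF N] y(1)] den_recip[OF N] sub_const[OF y(1), of 1] by simp
  ultimately have s: "(fps_const (N $ 1 $ 1) - fps_const (N $ 2 $ 1) * ?y) * ?s = 1" by simp
  have "fps_const (N $ 1 $ 1) - fps_const (N $ 2 $ 1) * ?y = den (M ** N) * ?r"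
  proof -
    have "fps_const (N $ 1 $ 1) - fps_const (N $ 2 $ 1) * ?y
        = fps_const (N $ 1 $ 1) * (den M * ?r) - fps_const (N $ 2 $ 1) * ?y"
      by (simp add: 1)
    then show ?thesis
      by (simp add: ry den_def matrix_mult_2 algebra_simps flip: fps_const_mult fps_const_add)
  qed
  then have "den (M ** N) * ?r * ?s = 1" using s by simp
  have MN: "den (M ** N) * recip (M ** N) = 1" by (intro den_recip sigma_mat_mult M N)
  have inv_unique: "x = x'" if "z * x = 1" "z * x' = 1" for z x x' :: "'c fps"
    using that by (metis mult.assoc mult.commute mult.left_neutral)
  have rs: "?r * ?s = recip (M ** N)"
    by (rule inv_unique[OF _ MN]) (use \<open>den (M ** N) * ?r * ?s = 1\<close> in \<open>simp add: ac_simps\<close>)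
  then have s': "?s = recip (M ** N) * den M"
    using rs[symmetric] 1 by (simp add: ac_simps)
  have arg: "sub ?y (arg N) = arg (M ** N)"
  proof -
    have "sub ?y (arg N) = (fps_const (N $ 2 $ 2) * ?y - fps_const (N $ 1 $ 2)) * ?s"
      unfolding arg_def
      using sub_mult[OF bd_diff[OF cX c] bd_recip[OF N] y(1)] sub_diff[OF cX c y(1)]
        sub_const[OF y(1)] lin sigma_matD(1)[OF N] by (simp add: arg_def)
    also have "\<dots> = (fps_const (N $ 2 $ 2) * (fps_const (M $ 2 $ 2) * fps_X - fps_const (M $ 1 $ 2))
        * (den M * ?r) - fps_const (N $ 1 $ 2) * den M) * recip (M ** N)"
      unfolding s' unfolding ry by (simp add: algebra_simps)
    also have "\<dots> = arg (M ** N)"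
      unfolding 1 by (simp add: arg_def den_def matrix_mult_2 algebra_simps flip: fps_const_mult fps_const_add)
    finally show ?thesis .
  qed
  have wt: "wt M * sub ?y (wt N) = wt (M ** N)"
  proof -
    have "sub ?y (wt N) = fps_const (det N) * ?s ^ 2"
      unfolding wt_def
      using sub_mult[OF bd_const[OF order_refl] bd_power[OF bd_recip[OF N], of 2] y(1)]
        sub_const[OF y(1)] sub_power[OF bd_recip[OF N] y(1)] by simp
    then have "wt M * sub ?y (wt N) = fps_const (det M * det N) * (?r * ?s) ^ 2"
      by (simp add: wt_def power_mult_distrib ac_simps flip: fps_const_mult)
    then show ?thesis by (simp add: rs wt_def det_mul)
  qed
  have "mact M (mact N f) = wt M * (sub ?y (wt N) * sub ?y (sub (arg N) f))"
    unfolding mact_def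
    using sub_mult[OF bd_wt[OF N] sub_bd_q[OF f bd_arg[OF N]] y(1)] by simp
  also have "sub ?y (sub (arg N) f) = sub (arg (M ** N)) f"
    using sub_sub[OF f y(1) bd_arg[OF N]] arg by simp
  finally show ?thesis using wt by (simp add: mact_def flip: mult.assoc)
qed

text \<open>The constant term \<open>- Q\<close> dominates \<open>fps_X\<close>, whose norm at
  radius 1/q is 1/q: the pole lies outside the open disc. This is the size condition in
  \<open>Uinf S\<close>.\<close>

lemma bd_inverse_linear:
  assumes "1 / q \<le> nu Q" shows "bd q 1 (inverse (fps_X - fps_const Q))"
proof -
  have "1 \<le> 1 / q" using w_pos w_less by simp
  then have Q: "1 \<le> nu Q" using assms by linarith
  have "bd q (nu Q) (fps_X - fps_const Q)"
    using assms w_pos by (intro bd_diff bd_const bd_X) (auto simp: field_simps)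
  then have "bd q (1 / nu Q) (inverse (fps_X - fps_const Q))"
    using bd_inverse[of q "fps_X - fps_const Q"] Q by (cases "Q = 0") auto
  then show ?thesis using Q by (auto intro: bd_mono)
qed

text \<open>The correction term does not depend on the pole, hence cancels on divisors of degree zero.\<close>

lemma mact_inverse_linear:
  assumes M: "sigma_mat M" and Q: "1 / q \<le> nu Q"
    and nz: "M $ 2 $ 1 * Q + M $ 2 $ 2 \<noteq> 0"
  shows "mact M (inverse (fps_X - fps_const Q)) =
    inverse (fps_X - fps_const ((M $ 1 $ 1 * Q + M $ 1 $ 2) / (M $ 2 $ 1 * Q + M $ 2 $ 2)))
    + fps_const (M $ 2 $ 1) * recip M"
proof -
  define a b c d where abcd: "a = M $ 1 $ 1" "b = M $ 1 $ 2" "c = M $ 2 $ 1" "d = M $ 2 $ 2"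
  define Q' where "Q' = (a * Q + b) / (c * Q + d)"
  define T s r where T: "T = inverse (fps_X - fps_const Q')"
    and s: "s = sub (arg M) (inverse (fps_X - fps_const Q))" and r: "r = recip M"
  define P where "P = fps_const (c * Q + d) * fps_X - fps_const (a * Q + b)"
  note y = bd_arg[OF M]
  have "1 < 1 / q" using w_pos w_less by simp
  then have nuQ: "1 < nu Q" using Q by linarith
  \<comment> \<open>As |a| = 1 and |Q| > 1 \<ge> |b|, the numerator of \<open>Q'\<close> does not
    vanish; a nonzero \<open>Q'\<close> is what makes \<open>fps_X - fps_const Q'\<close> invertible
    as a power series.\<close>
  have "nu b < nu (a * Q)"
    using sigma_matD(1)[OF M, of 1 2] sigma_matD(3)[OF M] nuQ by (simp add: nu_mult abcd)
  then have "a * Q + b \<noteq> 0" using nu_add_eq[of b "a * Q"] by fastforce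
  then have Q'0: "Q' \<noteq> 0" using nz by (simp add: Q'_def abcd)
  have nz': "c * Q + d \<noteq> 0" using nz by (simp add: abcd)
  have X: "bd q (1 / q + nu Q) fps_X" using w_pos by (intro bd_mono[OF bd_X[of "1 / q"]]) auto
  have c: "bd q (1 / q + nu Q) (fps_const Q)" using w_pos by (intro bd_const) auto
  have "sub (arg M) (fps_X - fps_const Q) = arg M - fps_const Q"
    using sub_diff[OF X c y(1)] sub_const[OF y(1)] sub_X[OF y(1)] by simp
  moreover have "(fps_X - fps_const Q) * inverse (fps_X - fps_const Q) = 1"
    using nuQ by (intro inverse_mult_eq_1') auto
  ultimately have "(arg M - fps_const Q) * s = 1"
    using sub_mult[OF bd_diff[OF X c] bd_inverse_linear[OF Q] y(1)] sub_const[OF y(1), of 1]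
    by (simp add: s)
  moreover have rd: "den M * r = 1" unfolding r by (rule den_recip[OF M])
  moreover have "arg M - fps_const Q = r * P"
  proof -
    have "arg M - fps_const Q = arg M - fps_const Q * (den M * r)" by (simp add: rd)
    then show ?thesis
      by (simp add: arg_def den_def P_def r algebra_simps flip: abcd fps_const_mult fps_const_add)
  qed
  ultimately have sP: "r * P * s = 1" by simp
  have TX: "(fps_X - fps_const Q') * T = 1"
    unfolding T using Q'0 by (intro inverse_mult_eq_1') auto
  have "P = fps_const (c * Q + d) * (fps_X - fps_const Q')"
    using nz' by (simp add: P_def Q'_def right_diff_distrib)
  then have TP: "T * P = fps_const (c * Q + d)" using TX by (simp add: ac_simps)
  \<comment> \<open>After multiplication by \<open>P * den M\<close> the claim is det = (c Q + d)(a
    - c x) + c P. This is the partial fraction identity for the transported differential dx / (x -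
    Q), whose poles are the images of \<open>Q\<close> and of infinity.\<close>
  have "(fps_const (det M) * r ^ 2 * s) * (P * den M) = fps_const (det M) * (den M * r) * (r * P * s)"
    by (simp add: power2_eq_square ac_simps)
  also have "\<dots> = fps_const (det M)" by (simp add: sP rd)
  also have "\<dots> = fps_const (c * Q + d) * den M + fps_const c * P"
    by (simp add: det_2 den_def P_def algebra_simps flip: abcd fps_const_mult fps_const_add fps_const_sub)
  also have "\<dots> = T * P * den M + fps_const c * P * (den M * r)" by (simp add: TP rd)
  also have "\<dots> = (T + fps_const c * r) * (P * den M)" by (simp add: algebra_simps)
  finally have "(fps_const (det M) * r ^ 2 * s) * (P * den M) = (T + fps_const c * r) * (P * den M)" .
  moreover have "P * den M \<noteq> 0" using sP rd by auto
  ultimately have "fps_const (det M) * r ^ 2 * s = T + fps_const c * r"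
    using \<open>P * den M \<noteq> 0\<close> by simp
  then show ?thesis by (simp add: mact_def wt_def s r T Q'_def abcd)
qed

end

section \<open>First cohomology\<close>

locale coeff_module =
  fixes M :: "('g::times, 'v::ab_group_add) gmod"
  assumes zero: "0 \<in> carr M"
    and diff: "x \<in> carr M \<Longrightarrow> y \<in> carr M \<Longrightarrow> x - y \<in> carr M"
    and act_diff: "g \<in> grp M \<Longrightarrow> x \<in> carr M \<Longrightarrow> y \<in> carr M \<Longrightarrow>
      act M g (x - y) = act M g x - act M g y"
begin

lemma minus: "x \<in> carr M \<Longrightarrow> - x \<in> carr M"
  using diff[OF zero, of x] by simp

lemma add: "x \<in> carr M \<Longrightarrow> y \<in> carr M \<Longrightarrow> x + y \<in> carr M"
  using diff[OF _ minus, of x y] by simp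

lemma sum: "(\<And>i. i \<in> I \<Longrightarrow> f i \<in> carr M) \<Longrightarrow> sum f I \<in> carr M"
  by (induction I rule: infinite_finite_induct) (auto intro: zero add)

lemma act_0: "g \<in> grp M \<Longrightarrow> act M g 0 = 0"
  using act_diff[OF _ zero zero] by simp

lemma act_minus: "g \<in> grp M \<Longrightarrow> x \<in> carr M \<Longrightarrow> act M g (- x) = - act M g x"
  using act_diff[OF _ zero, of g x] act_0 by simp

lemma act_add: "g \<in> grp M \<Longrightarrow> x \<in> carr M \<Longrightarrow> y \<in> carr M \<Longrightarrow>
    act M g (x + y) = act M g x + act M g y"
  using act_diff[OF _ _ minus, of g x y] act_minus by simp

lemma act_sum: "g \<in> grp M \<Longrightarrow> (\<And>i. i \<in> I \<Longrightarrow> f i \<in> carr M) \<Longrightarrow>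
    act M g (sum f I) = (\<Sum>i\<in>I. act M g (f i))"
  by (induction I rule: infinite_finite_induct) (auto simp: act_0 act_add sum)

lemma equiv_cohomologous: "equiv (Z1 M) (cohomologous M)"
proof (rule equivI)
  show "cohomologous M \<subseteq> Z1 M \<times> Z1 M" by (auto simp: cohomologous_def)
  show "refl_on (Z1 M) (cohomologous M)"
    by (auto simp: refl_on_def cohomologous_def act_0 intro!: bexI[OF _ zero])
  show "sym (cohomologous M)"
  proof (rule symI)
    fix \<phi> \<phi>' assume "(\<phi>, \<phi>') \<in> cohomologous M"
    then obtain v where "\<phi> \<in> Z1 M" "\<phi>' \<in> Z1 M" and v: "v \<in> carr M"
      "\<forall>g\<in>grp M. \<phi>' g - \<phi> g = act M g v - v"
      by (auto simp: cohomologous_def)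
    moreover have "\<forall>g\<in>grp M. \<phi> g - \<phi>' g = act M g (- v) - (- v)"
    proof
      fix g assume g: "g \<in> grp M"
      have "\<phi> g - \<phi>' g = - (\<phi>' g - \<phi> g)" by simp
      then show "\<phi> g - \<phi>' g = act M g (- v) - (- v)"
        using v g by (simp add: act_minus)
    qed
    ultimately show "(\<phi>', \<phi>) \<in> cohomologous M"
      unfolding cohomologous_def using minus[OF v(1)] by blast
  qed
  show "trans (cohomologous M)"
  proof (rule transI)
    fix \<phi> \<phi>' \<phi>'' assume "(\<phi>, \<phi>') \<in> cohomologous M" "(\<phi>', \<phi>'') \<in> cohomologous M"
    then obtain v v' where Z: "\<phi> \<in> Z1 M" "\<phi>'' \<in> Z1 M" and v: "v \<in> carr M" "v' \<in> carr M"
      "\<forall>g\<in>grp M. \<phi>' g - \<phi> g = act M g v - v"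
      "\<forall>g\<in>grp M. \<phi>'' g - \<phi>' g = act M g v' - v'"
      by (auto simp: cohomologous_def)
    have "\<forall>g\<in>grp M. \<phi>'' g - \<phi> g = act M g (v + v') - (v + v')"
    proof
      fix g assume g: "g \<in> grp M"
      have "\<phi>'' g - \<phi> g = (\<phi>'' g - \<phi>' g) + (\<phi>' g - \<phi> g)" by simp
      then show "\<phi>'' g - \<phi> g = act M g (v + v') - (v + v')"
        using v g by (simp add: act_add)
    qed
    then show "(\<phi>, \<phi>'') \<in> cohomologous M"
      unfolding cohomologous_def using Z add[OF v(1,2)] by blast
  qed
qed

lemma H1_class_in_H1: "\<phi> \<in> Z1 M \<Longrightarrow> H1_class M \<phi> \<in> H1 M"
  by (simp add: H1_class_def H1_def quotientI)

lemma in_H1_class: "\<phi> \<in> Z1 M \<Longrightarrow> \<phi> \<in> H1_class M \<phi>"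
  unfolding H1_class_def by (rule equiv_class_self[OF equiv_cohomologous])

lemma H1_class_eq: "(\<phi>, \<phi>') \<in> cohomologous M \<Longrightarrow> H1_class M \<phi> = H1_class M \<phi>'"
  unfolding H1_class_def by (rule equiv_class_eq[OF equiv_cohomologous])

lemma H1_cases:
  assumes "c \<in> H1 M" obtains \<phi> where "\<phi> \<in> Z1 M" "c = H1_class M \<phi>"
  using assms unfolding H1_def H1_class_def by (elim quotientE)

lemma Z1_minus: "\<phi> \<in> Z1 M \<Longrightarrow> (\<lambda>g. - \<phi> g) \<in> Z1 M"
  by (auto simp: Z1_def minus act_minus)

lemma Z1_add: "\<phi> \<in> Z1 M \<Longrightarrow> \<phi>' \<in> Z1 M \<Longrightarrow> (\<lambda>g. \<phi> g + \<phi>' g) \<in> Z1 M"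
  by (auto simp: Z1_def add act_add algebra_simps)

text \<open>Values outside the group are arbitrary, so closure under products is what controls the
  value at \<open>g * h\<close>.\<close>

lemma Z1_cong:
  assumes "\<phi> \<in> Z1 M" "\<And>g. g \<in> grp M \<Longrightarrow> \<phi>' g = \<phi> g" "\<And>g h. g \<in> grp M \<Longrightarrow> h \<in> grp M \<Longrightarrow> g * h \<in> grp M"
  shows "\<phi>' \<in> Z1 M"
  using assms by (simp add: Z1_def)

lemma cohomologous_minus:
  assumes "(\<phi>, \<phi>') \<in> cohomologous M"
  shows "((\<lambda>g. - \<phi> g), (\<lambda>g. - \<phi>' g)) \<in> cohomologous M"
proof -
  obtain v where Z: "\<phi> \<in> Z1 M" "\<phi>' \<in> Z1 M" and v: "v \<in> carr M"
    "\<forall>g\<in>grp M. \<phi>' g - \<phi> g = act M g v - v"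
    using assms by (auto simp: cohomologous_def)
  have "\<forall>g\<in>grp M. - \<phi>' g - - \<phi> g = act M g (- v) - - v"
  proof
    fix g assume g: "g \<in> grp M"
    have "- \<phi>' g - - \<phi> g = - (\<phi>' g - \<phi> g)" by simp
    then show "- \<phi>' g - - \<phi> g = act M g (- v) - - v" using v g by (simp add: act_minus)
  qed
  then show ?thesis
    unfolding cohomologous_def using Z1_minus[OF Z(1)] Z1_minus[OF Z(2)] minus[OF v(1)] by blast
qed

lemma cohomologous_add:
  assumes "(\<phi>, \<phi>') \<in> cohomologous M" "(\<theta>, \<theta>') \<in> cohomologous M"
  shows "((\<lambda>g. \<phi> g + \<theta> g), (\<lambda>g. \<phi>' g + \<theta>' g)) \<in> cohomologous M"
proof -
  obtain v v' where Z: "\<phi> \<in> Z1 M" "\<phi>' \<in> Z1 M" "\<theta> \<in> Z1 M" "\<theta>' \<in> Z1 M" and v: "v \<in> carr M" "v' \<in> carr M"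
    "\<forall>g\<in>grp M. \<phi>' g - \<phi> g = act M g v - v" "\<forall>g\<in>grp M. \<theta>' g - \<theta> g = act M g v' - v'"
    using assms by (auto simp: cohomologous_def)
  have "\<forall>g\<in>grp M. (\<phi>' g + \<theta>' g) - (\<phi> g + \<theta> g) = act M g (v + v') - (v + v')"
  proof
    fix g assume g: "g \<in> grp M"
    have "(\<phi>' g + \<theta>' g) - (\<phi> g + \<theta> g) = (\<phi>' g - \<phi> g) + (\<theta>' g - \<theta> g)" by simp
    then show "(\<phi>' g + \<theta>' g) - (\<phi> g + \<theta> g) = act M g (v + v') - (v + v')"
      using v g by (simp add: act_add)
  qed
  then show ?thesis
    unfolding cohomologous_def using Z1_add[OF Z(1,3)] Z1_add[OF Z(2,4)] add[OF v(1,2)] by blast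
qed

text \<open>\<open>H1_map\<close> unites the classes obtained from all representatives;
  compatibility with coboundaries makes these classes equal, so the union is a single class.\<close>

lemma H1_map_class:
  assumes "coeff_module N" "\<phi> \<in> Z1 M"
    and F: "\<And>\<phi>'. (\<phi>, \<phi>') \<in> cohomologous M \<Longrightarrow> (F \<phi>, F \<phi>') \<in> cohomologous N"
  shows "H1_map N F (H1_class M \<phi>) = H1_class N (F \<phi>)"
proof -
  have eq: "H1_class N (F \<phi>') = H1_class N (F \<phi>)" if "\<phi>' \<in> H1_class M \<phi>" for \<phi>'
    using coeff_module.H1_class_eq[OF assms(1) F] that by (simp add: H1_class_def)
  then show ?thesis
    unfolding H1_map_def using in_H1_class[OF assms(2)] by (intro SUP_eq_const eq) blast+
qed

lemma H1_minus_class: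
  assumes "\<phi> \<in> Z1 M" shows "H1_minus M (H1_class M \<phi>) = H1_class M (\<lambda>g. - \<phi> g)"
  unfolding H1_minus_def
  using H1_map_class[OF coeff_module_axioms assms, of "\<lambda>\<phi> g. - \<phi> g"] cohomologous_minus by simp

lemma H1_add_class:
  assumes "\<phi> \<in> Z1 M" "\<theta> \<in> Z1 M"
  shows "H1_add M (H1_class M \<phi>) (H1_class M \<theta>) = H1_class M (\<lambda>g. \<phi> g + \<theta> g)"
proof -
  have eq: "H1_class M (\<lambda>g. \<phi>' g + \<theta>' g) = H1_class M (\<lambda>g. \<phi> g + \<theta> g)"
    if "\<phi>' \<in> H1_class M \<phi>" "\<theta>' \<in> H1_class M \<theta>" for \<phi>' \<theta>'
    using H1_class_eq[OF cohomologous_add] that by (simp add: H1_class_def)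
  then show ?thesis
    unfolding H1_add_def using in_H1_class[OF assms(1)] in_H1_class[OF assms(2)]
    by (intro SUP_eq_const eq) blast+
qed

lemma H1_class_cong:
  assumes "\<phi> \<in> Z1 M" "\<phi>' \<in> Z1 M" "\<And>g. g \<in> grp M \<Longrightarrow> \<phi> g = \<phi>' g"
  shows "H1_class M \<phi> = H1_class M \<phi>'"
  by (rule H1_class_eq) (use assms zero act_0 in \<open>auto simp: cohomologous_def intro!: bexI[of _ 0]\<close>)

end


section \<open>Double coset operators\<close>

text \<open>\<open>Sg\<close> collects the elements whose action on the carrier is additive and
  multiplicative; it contains the group and the representatives. The representatives are not group
  elements, and \<open>h_cancel\<close> stands in for their invertibility.\<close>

locale hecke_module = coeff_module M
  for M :: "('g::monoid_mult, 'v::ab_group_add) gmod" +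
  fixes Sg :: "'g set" and a :: 'g and I :: "'i set" and h :: "'i \<Rightarrow> 'g"
  assumes one_in: "1 \<in> grp M"
    and mult_in: "g \<in> grp M \<Longrightarrow> g' \<in> grp M \<Longrightarrow> g * g' \<in> grp M"
    and inv_ex: "g \<in> grp M \<Longrightarrow> \<exists>g'\<in>grp M. g * g' = 1 \<and> g' * g = 1"
    and grp_Sg: "grp M \<subseteq> Sg"
    and act_closed: "s \<in> Sg \<Longrightarrow> x \<in> carr M \<Longrightarrow> act M s x \<in> carr M"
    and act_diff_Sg: "s \<in> Sg \<Longrightarrow> x \<in> carr M \<Longrightarrow> y \<in> carr M \<Longrightarrow>
      act M s (x - y) = act M s x - act M s y"
    and act_mult: "s \<in> Sg \<Longrightarrow> s' \<in> Sg \<Longrightarrow> x \<in> carr M \<Longrightarrow> act M (s * s') x = act M s (act M s' x)"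
    and h_Sg: "t \<in> I \<Longrightarrow> h t \<in> Sg"
    and h_cancel: "t \<in> I \<Longrightarrow> h t * s = h t * s' \<Longrightarrow> s = s'"
    and reps: "coset_reps (grp M) a I h"
begin

definition inv_of :: "'g \<Rightarrow> 'g" where
  "inv_of g = (SOME g'. g' \<in> grp M \<and> g * g' = 1 \<and> g' * g = 1)"

lemma inv_of:
  assumes "g \<in> grp M" shows "inv_of g \<in> grp M" "g * inv_of g = 1" "inv_of g * g = 1"
  using someI_ex[of "\<lambda>g'. g' \<in> grp M \<and> g * g' = 1 \<and> g' * g = 1"] inv_ex[OF assms]
  by (auto simp: inv_of_def)

lemma inv_cancel: "g \<in> grp M \<Longrightarrow> inv_of g * (g * x) = x" "g \<in> grp M \<Longrightarrow> g * (inv_of g * x) = x"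
  by (simp_all add: inv_of flip: mult.assoc)

lemma same_coset:
  assumes "t \<in> I" "t' \<in> I" "s \<in> grp M" "s' \<in> grp M" "h t * s = h t' * s'"
  shows "t = t'"
proof (rule ccontr)
  assume "t \<noteq> t'"
  then have "(*) (h t) ` grp M \<inter> (*) (h t') ` grp M = {}"
    using reps assms(1,2) by (auto simp: coset_reps_def disjoint_family_on_def)
  then show False using assms by (auto simp: image_iff disjoint_iff)
qed

text \<open>The double coset is stable under left multiplication by the group, so g^-1 h_t equals
  some h_b s; the element wanted is the inverse of \<open>s\<close>.\<close>

lemma transfer_ex:
  assumes "t \<in> I" "g \<in> grp M"
  shows "\<exists>s\<in>grp M. \<exists>b\<in>I. h t * s = g * h b"
proof -
  have eq: "{g * a * g' | g g'. g \<in> grp M \<and> g' \<in> grp M} = (\<Union>t\<in>I. (*) (h t) ` grp M)"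
    using reps by (simp add: coset_reps_def)
  have "h t * 1 \<in> (\<Union>t\<in>I. (*) (h t) ` grp M)" using assms(1) one_in by blast
  then obtain k k' where k: "h t = k * a * k'" "k \<in> grp M" "k' \<in> grp M"
    unfolding eq[symmetric] by auto
  then have "inv_of g * h t = (inv_of g * k) * a * k'" by (simp add: mult.assoc)
  then have "inv_of g * h t \<in> (\<Union>t\<in>I. (*) (h t) ` grp M)"
    unfolding eq[symmetric] using k mult_in inv_of assms by blast
  then obtain b s where bs: "b \<in> I" "s \<in> grp M" "inv_of g * h t = h b * s" by auto
  have "h t * inv_of s = g * ((inv_of g * h t) * inv_of s)"
    by (simp add: mult.assoc inv_cancel assms)
  also have "\<dots> = g * h b" using bs by (simp add: mult.assoc inv_of)
  finally show ?thesis using bs inv_of by blast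
qed

text \<open>Disjointness of the cosets determines the index, and cancellation of \<open>h t\<close>
  then determines the group element.\<close>

lemma transfer_unique:
  assumes "t \<in> I" "g \<in> grp M" "s \<in> grp M" "b \<in> I" "h t * s = g * h b"
    and "s' \<in> grp M" "b' \<in> I" "h t * s' = g * h b'"
  shows "s' = s" "b' = b"
proof -
  have "x = g * h c * inv_of r" if "x * r = g * h c" "r \<in> grp M" for x r c
    using arg_cong[OF that(1), of "\<lambda>z. z * inv_of r"] that(2) by (simp add: mult.assoc inv_of)
  from this[OF assms(5,3)] this[OF assms(8,6)]
  have "g * (h b * inv_of s) = g * (h b' * inv_of s')" by (simp add: mult.assoc)
  from arg_cong[OF this, of "\<lambda>z. inv_of g * z"]
  have "h b * inv_of s = h b' * inv_of s'" by (simp add: inv_cancel assms(2))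
  then show "b' = b" using same_coset[of b b' "inv_of s" "inv_of s'"] assms inv_of(1) by simp
  then show "s' = s" using h_cancel[of t s' s] assms by simp
qed

definition tr :: "'i \<Rightarrow> 'g \<Rightarrow> 'g" where
  "tr t g = (THE s. s \<in> grp M \<and> (\<exists>b\<in>I. h t * s = g * h b))"

definition ix :: "'i \<Rightarrow> 'g \<Rightarrow> 'i" where
  "ix t g = (SOME b. b \<in> I \<and> h t * tr t g = g * h b)"

lemma tr_ix:
  assumes "t \<in> I" "g \<in> grp M"
  shows "tr t g \<in> grp M" "ix t g \<in> I" "h t * tr t g = g * h (ix t g)"
proof -
  obtain s b where sb: "s \<in> grp M" "b \<in> I" "h t * s = g * h b"
    using transfer_ex[OF assms] by blast
  have tr: "tr t g = s"
    unfolding tr_def by (rule the_equality) (use sb transfer_unique(1)[OF assms sb] in blast)+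
  then have "ix t g \<in> I \<and> h t * tr t g = g * h (ix t g)"
    unfolding ix_def using someI[of "\<lambda>b. b \<in> I \<and> h t * tr t g = g * h b" b] sb by simp
  then show "tr t g \<in> grp M" "ix t g \<in> I" "h t * tr t g = g * h (ix t g)" using sb tr by auto
qed

lemma tr_eqI:
  assumes "t \<in> I" "g \<in> grp M" "s \<in> grp M" "b \<in> I" "h t * s = g * h b"
  shows "tr t g = s"
  using transfer_unique(1)[OF assms tr_ix[OF assms(1,2)]] .

text \<open>Applying the defining relation for \<open>g\<close> and then for \<open>g'\<close>
  yields an element with the property that characterizes the transfer of
  \<open>g * g'\<close>.\<close>

lemma tr_mult:
  assumes "t \<in> I" "g \<in> grp M" "g' \<in> grp M"
  shows "tr t (g * g') = tr t g * tr (ix t g) g'"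
proof -
  note 1 = tr_ix[OF assms(1,2)] note 2 = tr_ix[OF 1(2) assms(3)]
  have "h t * (tr t g * tr (ix t g) g') = g * g' * h (ix (ix t g) g')"
    using 1(3) 2(3) by (metis mult.assoc)
  then show ?thesis using 1 2 assms by (intro tr_eqI) (auto intro: mult_in)
qed

text \<open>Equal indices b put \<open>g * h b\<close> into the cosets of both \<open>h t\<close>
  and \<open>h t'\<close>.\<close>

lemma inj_on_ix: "g \<in> grp M \<Longrightarrow> inj_on (\<lambda>t. ix t g) I"
proof (rule inj_onI)
  fix t t' assume "g \<in> grp M" "t \<in> I" "t' \<in> I" "ix t g = ix t' g"
  then show "t = t'"
    using tr_ix[of t g] tr_ix[of t' g] same_coset[of t t' "tr t g" "tr t' g"] by simp
qed

text \<open>For infinite index sets both sums are zero by convention.\<close>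

lemma sum_ix:
  assumes "g \<in> grp M" shows "(\<Sum>t\<in>I. f (ix t g)) = (\<Sum>t\<in>I. f t)"
proof (cases "finite I")
  case True
  then have "(\<lambda>t. ix t g) ` I = I"
    using inj_on_ix[OF assms] tr_ix(2)[OF _ assms] by (intro endo_inj_surj) auto
  then show ?thesis using sum.reindex[OF inj_on_ix[OF assms], of f] by simp
qed simp

abbreviation U :: "('g \<Rightarrow> 'v) \<Rightarrow> 'g \<Rightarrow> 'v" where
  "U \<equiv> double_coset_op M I h"

definition U0 :: "'v \<Rightarrow> 'v" where
  "U0 v = (\<Sum>t\<in>I. act M (h t) v)"

lemma U_eq: "U \<phi> g = (\<Sum>t\<in>I. act M (h t) (\<phi> (tr t g)))"
  by (simp add: double_coset_op_def tr_def)

lemma act_add_Sg: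
  assumes "s \<in> Sg" "x \<in> carr M" "y \<in> carr M"
  shows "act M s (x + y) = act M s x + act M s y"
proof -
  have "act M s (0 - y) = - act M s y"
    using act_diff_Sg[OF assms(1) zero assms(3)] act_diff_Sg[OF assms(1) zero zero] by simp
  then show ?thesis using act_diff_Sg[OF assms(1,2) minus[OF assms(3)]] by simp
qed

lemma U_diff:
  assumes "\<And>g. g \<in> grp M \<Longrightarrow> \<phi> g \<in> carr M" "\<And>g. g \<in> grp M \<Longrightarrow> \<phi>' g \<in> carr M" "g \<in> grp M"
  shows "U (\<lambda>g. \<phi> g - \<phi>' g) g = U \<phi> g - U \<phi>' g"
  unfolding U_eq sum_subtractf[symmetric]
  by (intro sum.cong) (auto intro!: act_diff_Sg h_Sg tr_ix assms)

text \<open>By \<open>tr_mult\<close> and the relation h_t s_t(g) = g h_b, the second part of each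
  summand is \<open>g\<close> applied to the summand of index b. As t runs through \<open>I\<close>
  so does b, and reindexing gives the cocycle relation.\<close>

lemma U_Z1:
  assumes "\<phi> \<in> Z1 M" shows "U \<phi> \<in> Z1 M"
proof -
  have c: "\<phi> g \<in> carr M" if "g \<in> grp M" for g using assms that by (auto simp: Z1_def)
  have h: "h t \<in> Sg" "tr t g \<in> grp M" "tr t g \<in> Sg" "ix t g \<in> I" if "t \<in> I" "g \<in> grp M" for t g
    using tr_ix[OF that] h_Sg[OF that(1)] grp_Sg by auto
  have U: "U \<phi> g \<in> carr M" if "g \<in> grp M" for g
    unfolding U_eq by (intro sum act_closed c h(1)[OF _ that] h(2)[OF _ that])
  have "U \<phi> (g * g') = U \<phi> g + act M g (U \<phi> g')" if g: "g \<in> grp M" "g' \<in> grp M" for g g'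
  proof -
    have "act M (h t) (\<phi> (tr t (g * g')))
        = act M (h t) (\<phi> (tr t g)) + act M g (act M (h (ix t g)) (\<phi> (tr (ix t g) g')))"
      if t: "t \<in> I" for t
    proof -
      note ht = h[OF t g(1)] and hx = h[OF h(4)[OF t g(1)] g(2)]
      let ?y = "\<phi> (tr (ix t g) g')"
      have y: "?y \<in> carr M" by (intro c hx)
      have "act M (h t) (\<phi> (tr t (g * g'))) = act M (h t) (\<phi> (tr t g) + act M (tr t g) ?y)"
        using assms ht hx by (simp add: tr_mult[OF t g] Z1_def)
      also have "\<dots> = act M (h t) (\<phi> (tr t g)) + act M (h t) (act M (tr t g) ?y)"
        by (intro act_add_Sg c act_closed y ht)
      also have "act M (h t) (act M (tr t g) ?y) = act M g (act M (h (ix t g)) ?y)"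
        using act_mult[OF ht(1,3) y] act_mult[OF _ hx(1) y, of g] grp_Sg g tr_ix(3)[OF t g(1)] by auto
      finally show ?thesis .
    qed
    then have "U \<phi> (g * g') = U \<phi> g + (\<Sum>t\<in>I. act M g (act M (h (ix t g)) (\<phi> (tr (ix t g) g'))))"
      unfolding U_eq by (simp add: sum.distrib)
    also have "(\<Sum>t\<in>I. act M g (act M (h (ix t g)) (\<phi> (tr (ix t g) g'))))
        = (\<Sum>t\<in>I. act M g (act M (h t) (\<phi> (tr t g'))))"
      by (rule sum_ix[OF g(1)])
    also have "\<dots> = act M g (U \<phi> g')"
      unfolding U_eq by (rule act_sum[OF g(1), symmetric]) (intro act_closed c h(1)[OF _ g(2)] h(2)[OF _ g(2)])
    finally show ?thesis .
  qed
  then show ?thesis using U by (simp add: Z1_def)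
qed

lemma U0_closed: "v \<in> carr M \<Longrightarrow> U0 v \<in> carr M"
  unfolding U0_def by (intro sum act_closed h_Sg)

text \<open>The relation h_t s_t(g) = g h_b moves the transfer to the left of the representative,
  and the permutation of indices reassembles \<open>U0 v\<close>.\<close>

lemma U_coboundary:
  assumes v: "v \<in> carr M" and g: "g \<in> grp M"
  shows "U (\<lambda>g. act M g v - v) g = act M g (U0 v) - U0 v"
proof -
  have "act M (h t) (act M (tr t g) v - v) = act M g (act M (h (ix t g)) v) - act M (h t) v"
    if t: "t \<in> I" for t
  proof -
    note 1 = tr_ix[OF t g]
    have "act M (h t) (act M (tr t g) v - v) = act M (h t) (act M (tr t g) v) - act M (h t) v"
      using 1 grp_Sg by (intro act_diff_Sg h_Sg act_closed v t) auto
    also have "act M (h t) (act M (tr t g) v) = act M g (act M (h (ix t g)) v)"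
      using act_mult[OF h_Sg[OF t] _ v, of "tr t g"] act_mult[OF _ h_Sg[OF 1(2)] v, of g] 1
        subsetD[OF grp_Sg 1(1)] subsetD[OF grp_Sg g] by simp
    finally show ?thesis .
  qed
  then have "U (\<lambda>g. act M g v - v) g
      = (\<Sum>t\<in>I. act M g (act M (h (ix t g)) v)) - (\<Sum>t\<in>I. act M (h t) v)"
    unfolding U_eq by (simp add: sum_subtractf)
  also have "(\<Sum>t\<in>I. act M g (act M (h (ix t g)) v)) = (\<Sum>t\<in>I. act M g (act M (h t) v))"
    by (rule sum_ix[OF g])
  also have "\<dots> = act M g (U0 v)"
    unfolding U0_def by (rule act_sum[OF g, symmetric]) (intro act_closed h_Sg v)
  finally show ?thesis by (simp add: U0_def)
qed

lemma U_cohomologous: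
  assumes "(\<phi>, \<phi>') \<in> cohomologous M" shows "(U \<phi>, U \<phi>') \<in> cohomologous M"
proof -
  obtain v where Z: "\<phi> \<in> Z1 M" "\<phi>' \<in> Z1 M" and v: "v \<in> carr M"
    "\<forall>g\<in>grp M. \<phi>' g - \<phi> g = act M g v - v"
    using assms by (auto simp: cohomologous_def)
  have c: "\<phi> g \<in> carr M" "\<phi>' g \<in> carr M" if "g \<in> grp M" for g using Z that by (auto simp: Z1_def)
  have "U \<phi>' g - U \<phi> g = act M g (U0 v) - U0 v" if g: "g \<in> grp M" for g
  proof -
    have "U \<phi>' g - U \<phi> g = U (\<lambda>g. \<phi>' g - \<phi> g) g" by (rule U_diff[symmetric]) (auto intro: c g)
    also have "\<dots> = U (\<lambda>g. act M g v - v) g"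
      unfolding U_eq using v tr_ix(1)[OF _ g] by (intro sum.cong) auto
    finally show ?thesis using U_coboundary[OF v(1) g] by simp
  qed
  then show ?thesis
    unfolding cohomologous_def using U_Z1[OF Z(1)] U_Z1[OF Z(2)] U0_closed[OF v(1)] by blast
qed

end


section \<open>Geometric series of contracting operators\<close>

text \<open>\<open>F N\<close> abstracts the submodule varpi^N \<Lambda>. Completeness is required
  with a rate: when the n-th term lies in \<open>F n\<close>, the remainder after \<open>N\<close>
  terms lies in \<open>F N\<close>.\<close>

locale filtered_module = coeff_module M
  for M :: "('g::times, 'v::ab_group_add) gmod" +
  fixes F :: "nat \<Rightarrow> 'v set"
  assumes F_0: "F 0 = carr M" and zero_F: "0 \<in> F N"
    and diff_F: "x \<in> F N \<Longrightarrow> y \<in> F N \<Longrightarrow> x - y \<in> F N"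
    and F_Suc: "F (Suc N) \<subseteq> F N"
    and separated: "(\<And>N. x \<in> F N) \<Longrightarrow> x = 0"
    and complete_F: "(\<And>n. f n \<in> F n) \<Longrightarrow> \<exists>s. \<forall>N. s - (\<Sum>k<N. f k) \<in> F N"
    and act_F: "g \<in> grp M \<Longrightarrow> x \<in> F N \<Longrightarrow> act M g x \<in> F N"
    and grp_mult: "g \<in> grp M \<Longrightarrow> g' \<in> grp M \<Longrightarrow> g * g' \<in> grp M"
begin

lemma F_antimono: "m \<le> n \<Longrightarrow> F n \<subseteq> F m"
  using F_Suc by (rule lift_Suc_antimono_le)

lemma F_carr: "x \<in> F n \<Longrightarrow> x \<in> carr M"
  using F_antimono[of 0 n] F_0 by auto

lemma minus_F: "x \<in> F N \<Longrightarrow> - x \<in> F N"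
  using diff_F[OF zero_F, of x N] by simp

lemma add_F: "x \<in> F N \<Longrightarrow> y \<in> F N \<Longrightarrow> x + y \<in> F N"
  using diff_F[OF _ minus_F, of x N y] by simp

lemma sum_F: "(\<And>i. i \<in> I \<Longrightarrow> f i \<in> F N) \<Longrightarrow> sum f I \<in> F N"
  by (induction I rule: infinite_finite_induct) (auto intro: zero_F add_F)

text \<open>Stronger than convergence: the remainder after exactly \<open>N\<close> terms lies in
  \<open>F N\<close>, so no index has to be chosen when series are combined.\<close>

definition fsums :: "(nat \<Rightarrow> 'v) \<Rightarrow> 'v \<Rightarrow> bool" where
  "fsums f s \<longleftrightarrow> (\<forall>N. s - (\<Sum>k<N. f k) \<in> F N)"

lemma fsums_carr: "fsums f s \<Longrightarrow> s \<in> carr M"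
  using F_0 by (auto simp: fsums_def dest: spec[of _ 0])

lemma fsums_unique:
  assumes "fsums f s" "fsums f s'" shows "s = s'"
proof -
  have "s - s' \<in> F N" for N
    using diff_F[of "s - (\<Sum>k<N. f k)" N "s' - (\<Sum>k<N. f k)"] assms by (simp add: fsums_def)
  then show ?thesis using separated[of "s - s'"] by simp
qed

lemma fsums_diff: "fsums f s \<Longrightarrow> fsums f' s' \<Longrightarrow> fsums (\<lambda>n. f n - f' n) (s - s')"
  unfolding fsums_def
proof
  fix N assume "\<forall>N. s - (\<Sum>k<N. f k) \<in> F N" "\<forall>N. s' - (\<Sum>k<N. f' k) \<in> F N"
  then have "(s - (\<Sum>k<N. f k)) - (s' - (\<Sum>k<N. f' k)) \<in> F N" by (blast intro: diff_F)
  moreover have "(s - (\<Sum>k<N. f k)) - (s' - (\<Sum>k<N. f' k)) = s - s' - (\<Sum>k<N. f k - f' k)"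
    by (simp add: sum_subtractf)
  ultimately show "s - s' - (\<Sum>k<N. f k - f' k) \<in> F N" by simp
qed

lemma fsums_minus: "fsums f s \<Longrightarrow> fsums (\<lambda>n. - f n) (- s)"
  using fsums_diff[of "\<lambda>_. 0" 0 f s] by (simp add: fsums_def zero_F)

lemma fsums_add: "fsums f s \<Longrightarrow> fsums f' s' \<Longrightarrow> fsums (\<lambda>n. f n + f' n) (s + s')"
  using fsums_diff[OF _ fsums_minus, of f s f' s'] by simp

lemma fsums_act:
  assumes "fsums f s" "\<And>n. f n \<in> carr M" "g \<in> grp M"
  shows "fsums (\<lambda>n. act M g (f n)) (act M g s)"
  unfolding fsums_def
proof
  fix N
  have "act M g (s - (\<Sum>k<N. f k)) \<in> F N" using assms by (intro act_F) (auto simp: fsums_def)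
  moreover have "act M g (s - (\<Sum>k<N. f k)) = act M g s - (\<Sum>k<N. act M g (f k))"
    using assms fsums_carr by (subst act_diff) (auto simp: act_sum intro: sum)
  ultimately show "act M g s - (\<Sum>k<N. act M g (f k)) \<in> F N" by simp
qed

definition fsuminf :: "(nat \<Rightarrow> 'v) \<Rightarrow> 'v" where
  "fsuminf f = (SOME s. fsums f s)"

lemma fsums_fsuminf: "(\<And>n. f n \<in> F n) \<Longrightarrow> fsums f (fsuminf f)"
  unfolding fsuminf_def fsums_def by (rule someI_ex) (rule complete_F)

end

text \<open>\<open>V\<close> is the operator on functions and \<open>W\<close> its counterpart on
  coefficients, tied together on coboundaries. Both gain one step of the filtration, and the axioms
  are stable under a change of sign, so one treatment covers both series.\<close>

locale contraction = filtered_module M F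
  for M :: "('g::times, 'v::ab_group_add) gmod" and F +
  fixes V :: "('g \<Rightarrow> 'v) \<Rightarrow> 'g \<Rightarrow> 'v" and W :: "'v \<Rightarrow> 'v"
  assumes V_F: "(\<And>g. g \<in> grp M \<Longrightarrow> \<theta> g \<in> F n) \<Longrightarrow> g \<in> grp M \<Longrightarrow> V \<theta> g \<in> F (Suc n)"
    and V_diff: "(\<And>g. g \<in> grp M \<Longrightarrow> \<theta> g \<in> carr M) \<Longrightarrow> (\<And>g. g \<in> grp M \<Longrightarrow> \<theta>' g \<in> carr M) \<Longrightarrow>
      g \<in> grp M \<Longrightarrow> V (\<lambda>g. \<theta> g - \<theta>' g) g = V \<theta> g - V \<theta>' g"
    and V_Z1: "\<theta> \<in> Z1 M \<Longrightarrow> V \<theta> \<in> Z1 M"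
    and W_F: "v \<in> F n \<Longrightarrow> W v \<in> F (Suc n)"
    and V_coboundary: "v \<in> carr M \<Longrightarrow> g \<in> grp M \<Longrightarrow>
      V (\<lambda>g. act M g v - v) g = act M g (W v) - W v"
begin

text \<open>Nothing prevents \<open>V\<close> from reading values outside the group. But a function
  vanishing on the group takes values in every \<open>F N\<close> there, so by separation
  \<open>V\<close> sends it to zero on the group.\<close>

lemma V_cong:
  assumes "\<And>g. g \<in> grp M \<Longrightarrow> \<theta> g \<in> carr M" "\<And>g. g \<in> grp M \<Longrightarrow> \<theta>' g = \<theta> g" "g \<in> grp M"
  shows "V \<theta>' g = V \<theta> g"
proof -
  have "V (\<lambda>g. \<theta>' g - \<theta> g) g \<in> F N" for N
    using V_F[of "\<lambda>g. \<theta>' g - \<theta> g" N g] assms F_Suc[of N] by (auto simp: zero_F)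
  moreover have "V (\<lambda>g. \<theta>' g - \<theta> g) g = V \<theta>' g - V \<theta> g"
    using assms by (intro V_diff) auto
  ultimately show ?thesis using separated[of "V \<theta>' g - V \<theta> g"] by simp
qed

lemma V_0: "g \<in> grp M \<Longrightarrow> V (\<lambda>_. 0) g = 0"
  using V_diff[of "\<lambda>_. 0" "\<lambda>_. 0" g] zero by simp

lemma V_add:
  assumes "\<And>g. g \<in> grp M \<Longrightarrow> \<theta> g \<in> carr M" "\<And>g. g \<in> grp M \<Longrightarrow> \<theta>' g \<in> carr M" "g \<in> grp M"
  shows "V (\<lambda>g. \<theta> g + \<theta>' g) g = V \<theta> g + V \<theta>' g"
  using V_diff[of "\<lambda>g. \<theta> g + \<theta>' g" \<theta>' g] assms by (simp add: add)

lemma V_sum: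
  assumes "\<And>k g. k < N \<Longrightarrow> g \<in> grp M \<Longrightarrow> \<theta> k g \<in> carr M" "g \<in> grp M"
  shows "V (\<lambda>g. \<Sum>k<N. \<theta> k g) g = (\<Sum>k<(N::nat). V (\<theta> k) g)"
  using assms(1)
proof (induction N)
  case (Suc N)
  have "V (\<lambda>g. (\<Sum>k<N. \<theta> k g) + \<theta> N g) g = V (\<lambda>g. \<Sum>k<N. \<theta> k g) g + V (\<theta> N) g"
    using Suc.prems by (intro V_add assms(2)) (auto intro: sum)
  then show ?case using Suc by simp
qed (simp add: V_0 assms(2))

lemma iterate_Z1: "\<theta> \<in> Z1 M \<Longrightarrow> (V ^^ n) \<theta> \<in> Z1 M"
  by (induction n) (auto intro: V_Z1)

lemma iterate_F: "\<theta> \<in> Z1 M \<Longrightarrow> g \<in> grp M \<Longrightarrow> (V ^^ n) \<theta> g \<in> F n"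
proof (induction n arbitrary: g)
  case 0
  then show ?case by (simp add: F_0 Z1_def)
qed (simp add: V_F)

lemma iterate_carr: "\<theta> \<in> Z1 M \<Longrightarrow> g \<in> grp M \<Longrightarrow> (V ^^ n) \<theta> g \<in> carr M"
  using iterate_F F_carr by blast

definition series :: "('g \<Rightarrow> 'v) \<Rightarrow> 'g \<Rightarrow> 'v" where
  "series \<theta> g = fsuminf (\<lambda>n. (V ^^ n) \<theta> g)"

lemma fsums_series: "\<theta> \<in> Z1 M \<Longrightarrow> g \<in> grp M \<Longrightarrow> fsums (\<lambda>n. (V ^^ n) \<theta> g) (series \<theta> g)"
  unfolding series_def by (intro fsums_fsuminf iterate_F)

lemma series_carr: "\<theta> \<in> Z1 M \<Longrightarrow> g \<in> grp M \<Longrightarrow> series \<theta> g \<in> carr M"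
  using fsums_series fsums_carr by blast

lemma series_Z1:
  assumes "\<theta> \<in> Z1 M" shows "series \<theta> \<in> Z1 M"
proof -
  have "series \<theta> (g * g') = series \<theta> g + act M g (series \<theta> g')" if "g \<in> grp M" "g' \<in> grp M" for g g'
  proof -
    have "fsums (\<lambda>n. (V ^^ n) \<theta> g + act M g ((V ^^ n) \<theta> g')) (series \<theta> g + act M g (series \<theta> g'))"
      by (intro fsums_add fsums_act fsums_series iterate_carr that assms)
    moreover have "(V ^^ n) \<theta> g + act M g ((V ^^ n) \<theta> g') = (V ^^ n) \<theta> (g * g')" for n
      using iterate_Z1[OF assms, of n] that by (simp add: Z1_def)
    ultimately show ?thesis
      using fsums_unique[OF fsums_series[OF assms grp_mult[OF that]]] by simp
  qed
  then show ?thesis using series_carr[OF assms] by (simp add: Z1_def)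
qed

text \<open>By separation it is enough to compare with partial sums modulo every \<open>F N\<close>,
  so no continuity of \<open>V\<close> beyond \<open>V_F\<close> enters.\<close>

lemma series_fixpoint:
  assumes \<theta>: "\<theta> \<in> Z1 M" and g: "g \<in> grp M"
  shows "series \<theta> g = \<theta> g + V (series \<theta>) g"
proof -
  have "series \<theta> g - (\<theta> g + V (series \<theta>) g) \<in> F N" for N
  proof -
    let ?p = "\<lambda>g. \<Sum>k<N. (V ^^ k) \<theta> g"
    \<comment> \<open>\<open>V\<close> turns the remainder after \<open>N\<close> terms into an
      element of \<open>F (Suc N)\<close>, to be matched with the remainder of the original series
      after \<open>N\<close> + 1 terms.\<close>
    have "V (\<lambda>g. series \<theta> g - ?p g) g \<in> F (Suc N)"
      using fsums_series[OF \<theta>] by (intro V_F g) (simp add: fsums_def)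
    moreover have "V (\<lambda>g. series \<theta> g - ?p g) g = V (series \<theta>) g - V ?p g"
      using \<theta> by (intro V_diff series_carr sum iterate_carr g)
    moreover have "V ?p g = (\<Sum>k<N. (V ^^ Suc k) \<theta> g)"
      using V_sum[of N "\<lambda>k. (V ^^ k) \<theta>", OF iterate_carr[OF \<theta>] g] by simp
    moreover have "(\<Sum>k<Suc N. (V ^^ k) \<theta> g) = \<theta> g + (\<Sum>k<N. (V ^^ Suc k) \<theta> g)"
      by (subst sum.lessThan_Suc_shift) simp
    moreover have "series \<theta> g - (\<Sum>k<Suc N. (V ^^ k) \<theta> g) \<in> F (Suc N)"
      using fsums_series[OF \<theta> g] by (simp only: fsums_def)
    ultimately have "series \<theta> g - (\<theta> g + (\<Sum>k<N. (V ^^ Suc k) \<theta> g))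
        - (V (series \<theta>) g - (\<Sum>k<N. (V ^^ Suc k) \<theta> g)) \<in> F (Suc N)"
      by (intro diff_F[of "series \<theta> g - (\<theta> g + (\<Sum>k<N. (V ^^ Suc k) \<theta> g))"]) simp_all
    then have "series \<theta> g - (\<theta> g + V (series \<theta>) g) \<in> F (Suc N)"
      by (simp add: algebra_simps)
    then show ?thesis using F_Suc by auto
  qed
  then show ?thesis using separated[of "series \<theta> g - (\<theta> g + V (series \<theta>) g)"] by simp
qed

text \<open>If the coboundary of \<open>v\<close> is the difference of the cocycles, then the
  coboundary of the sum of all \<open>(W ^^ n) v\<close> is the difference of the two
  series.\<close>

lemma series_cohomologous:
  assumes "(\<theta>, \<theta>') \<in> cohomologous M" shows "(series \<theta>, series \<theta>') \<in> cohomologous M"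
proof -
  obtain v where Z: "\<theta> \<in> Z1 M" "\<theta>' \<in> Z1 M" and v: "v \<in> carr M"
    "\<forall>g\<in>grp M. \<theta>' g - \<theta> g = act M g v - v"
    using assms by (auto simp: cohomologous_def)
  have W: "(W ^^ n) v \<in> F n" for n
    by (induction n) (auto simp: F_0 v W_F)
  have W': "(W ^^ n) v \<in> carr M" for n using W F_carr by blast
  have it: "(V ^^ n) \<theta>' g - (V ^^ n) \<theta> g = act M g ((W ^^ n) v) - (W ^^ n) v"
    if "g \<in> grp M" for n g
    using that
  proof (induction n arbitrary: g)
    case (Suc n)
    have "(V ^^ Suc n) \<theta>' g - (V ^^ Suc n) \<theta> g = V (\<lambda>g. (V ^^ n) \<theta>' g - (V ^^ n) \<theta> g) g"
      unfolding funpow.simps o_apply by (rule V_diff[symmetric]) (intro iterate_carr Z Suc.prems | assumption)+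
    also have "\<dots> = V (\<lambda>g. act M g ((W ^^ n) v) - (W ^^ n) v) g"
    proof (rule V_cong)
      show "act M g ((W ^^ n) v) - (W ^^ n) v \<in> carr M" if "g \<in> grp M" for g
        using W' act_F[OF that, of _ 0] F_0 by (intro diff) auto
    qed (use Suc in auto)
    also have "\<dots> = act M g ((W ^^ Suc n) v) - (W ^^ Suc n) v"
      using V_coboundary[OF W' Suc.prems] by simp
    finally show ?case .
  qed (use v in simp)
  let ?w = "fsuminf (\<lambda>n. (W ^^ n) v)"
  have w: "fsums (\<lambda>n. (W ^^ n) v) ?w" by (intro fsums_fsuminf W)
  have "series \<theta>' g - series \<theta> g = act M g ?w - ?w" if g: "g \<in> grp M" for g
  proof (rule fsums_unique)
    show "fsums (\<lambda>n. (V ^^ n) \<theta>' g - (V ^^ n) \<theta> g) (series \<theta>' g - series \<theta> g)"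
      by (intro fsums_diff fsums_series Z g)
    show "fsums (\<lambda>n. (V ^^ n) \<theta>' g - (V ^^ n) \<theta> g) (act M g ?w - ?w)"
      unfolding it[OF g] by (intro fsums_diff fsums_act w W' g)
  qed
  then show ?thesis
    unfolding cohomologous_def using series_Z1[OF Z(1)] series_Z1[OF Z(2)] fsums_carr[OF w] by blast
qed

lemma contraction_minus: "contraction M F (\<lambda>\<theta> g. - V \<theta> g) (\<lambda>v. - W v)"
proof
  show "- V \<theta> g \<in> F (Suc n)" if "\<And>g. g \<in> grp M \<Longrightarrow> \<theta> g \<in> F n" "g \<in> grp M" for \<theta> n g
    using V_F[OF that] by (rule minus_F)
  show "(\<lambda>g. - V \<theta> g) \<in> Z1 M" if "\<theta> \<in> Z1 M" for \<theta>
    by (intro Z1_minus V_Z1 that)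
  show "- W v \<in> F (Suc n)" if "v \<in> F n" for v n
    using W_F[OF that] by (rule minus_F)
  show "- V (\<lambda>g. act M g v - v) g = act M g (- W v) - - W v" if "v \<in> carr M" "g \<in> grp M" for v g
    using V_coboundary[OF that] W_F[of v 0] that F_0 F_carr by (simp add: act_minus)
qed (simp add: V_diff)

lemma iterate_minus:
  assumes "\<theta> \<in> Z1 M" "g \<in> grp M"
  shows "((\<lambda>\<theta> g. - V \<theta> g) ^^ n) \<theta> g = (if even n then (V ^^ n) \<theta> g else - (V ^^ n) \<theta> g)"
  using assms(2)
proof (induction n arbitrary: g)
  case (Suc n)
  let ?V = "\<lambda>\<theta> g. - V \<theta> g"
  have neg: "V (\<lambda>g. - (V ^^ n) \<theta> g) g = - V ((V ^^ n) \<theta>) g"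
    using V_diff[of "\<lambda>_. 0" "(V ^^ n) \<theta>" g] iterate_carr[OF assms(1)] Suc.prems zero V_0 by simp
  have "V ((?V ^^ n) \<theta>) g = V (if even n then (V ^^ n) \<theta> else (\<lambda>g. - (V ^^ n) \<theta> g)) g"
    using Suc iterate_carr[OF assms(1)] by (intro V_cong) (auto intro: minus)
  then show ?case using neg by auto
qed simp

end

section \<open>The reduced norm\<close>

lemma vector_4:
  "(vector [w, x, y, z] :: 'a::zero ^ 4) $ 1 = w" "(vector [w, x, y, z] :: 'a ^ 4) $ 2 = x"
  "(vector [w, x, y, z] :: 'a ^ 4) $ 3 = y" "(vector [w, x, y, z] :: 'a ^ 4) $ 4 = z"
  by (simp_all add: vector_def)

text \<open>\<open>reduced_norm\<close> is a definite description through some standard involution,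
  so existence gives it content. The witness negates the coordinates at i, j and i j.\<close>

lemma standard_involution_exists:
  fixes alg :: "'f::field \<Rightarrow> 'b::ring_1"
  assumes "quaternion_algebra alg"
  shows "\<exists>s. standard_involution alg s"
proof -
  obtain a b i j where ij: "i * i = alg a" "j * j = alg b" "j * i = - (i * j)"
    and basis: "is_basis alg (vector [1, i, j, i * j] :: 'b^4)" and am: "algebra_map alg"
    using assms unfolding quaternion_algebra_def by (elim conjE exE) (rule that)
  have alg: "alg 1 = 1" "\<And>x y. alg (x + y) = alg x + alg y" "\<And>x y. alg (x * y) = alg x * alg y"
    and comm: "\<And>x y. y * alg x = alg x * y"
    using am unfolding algebra_map_def ring_hom_on_type_def by metis+
  have alg0: "alg 0 = 0" using alg(2)[of 0 0] by simp
  have algm: "alg (- x) = - alg x" for x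
    using alg(2)[of x "- x"] by (simp add: alg0 eq_neg_iff_add_eq_0 add.commute)
  \<comment> \<open>Naming scalar multiplication lets rewriting collect scalars on the left in
    products of coordinate expressions.\<close>
  define sm where "sm x u = alg x * u" for x u
  have sm_add: "sm (x + y) u = sm x u + sm y u" "sm x (u + v) = sm x u + sm x v"
    and sm_minus: "sm (- x) u = - sm x u" "sm x (- u) = - sm x u"
    and sm_sm: "sm x (sm y u) = sm (x * y) u" for x y u v
    by (simp_all add: sm_def alg algm alg0 algebra_simps)
  have sm_diff: "sm (x - y) u = sm x u - sm y u" for x y u
    using sm_add(1)[of x "- y" u] by (simp add: sm_minus)
  have sm_mult: "sm x u * sm y v = sm (x * y) (u * v)" for x y u v
    unfolding sm_def alg by (metis comm mult.assoc)
  define k where "k = i * j"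
  define L where "L x y z t = sm x 1 + sm y i + sm z j + sm t k" for x y z t
  have alg_mult: "alg x * u = sm x u" for x u by (simp add: sm_def)
  have tab: "i * i = sm a 1" "j * j = sm b 1" "i * j = k" "j * i = - k"
    "i * k = sm a j" "k * i = - sm a j" "j * k = - sm b i" "k * j = sm b i" "k * k = - sm (a * b) 1"
  proof -
    show 1: "i * i = sm a 1" "j * j = sm b 1" "i * j = k" "j * i = - k"
      using ij by (auto simp: sm_def k_def)
    show ik: "i * k = sm a j" unfolding k_def mult.assoc[symmetric] ij by (simp add: sm_def)
    show kj: "k * j = sm b i" unfolding k_def mult.assoc ij by (simp add: sm_def comm)
    have "k * i = i * (j * i)" by (simp add: k_def mult.assoc)
    then show "k * i = - sm a j" using ik 1 by simp
    have "j * k = (j * i) * j" by (simp add: k_def mult.assoc)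
    then show "j * k = - sm b i" using kj 1 by simp
    have "k * k = i * (j * k)" by (simp add: k_def mult.assoc)
    also have "\<dots> = - (i * sm b i)" using \<open>j * k = - sm b i\<close> by simp
    also have "i * sm b i = sm b (i * i)" using sm_mult[of 1 i b i] by (simp add: sm_def alg)
    finally show "k * k = - sm (a * b) 1" using 1 by (simp add: sm_sm mult.commute)
  qed
  have L_mult: "L x1 x2 x3 x4 * L y1 y2 y3 y4 =
     L (x1 * y1 + a * x2 * y2 + b * x3 * y3 - a * b * x4 * y4)
       (x1 * y2 + x2 * y1 - b * x3 * y4 + b * x4 * y3)
       (x1 * y3 + x3 * y1 + a * x2 * y4 - a * x4 * y2)
       (x1 * y4 + x4 * y1 + x2 * y3 - x3 * y2)" for x1 x2 x3 x4 y1 y2 y3 y4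
    unfolding L_def
    by (simp add: distrib_left distrib_right sm_mult tab sm_add sm_diff sm_minus sm_sm
        mult_1_left mult_1_right) (simp add: algebra_simps)
  have lin: "lin_comb alg (vector [1, i, j, i * j] :: 'b^4) c = L (c $ 1) (c $ 2) (c $ 3) (c $ 4)" for c
    by (simp add: lin_comb_def sum_4 L_def sm_def k_def vector_4)
  have bij: "bij (lin_comb alg (vector [1, i, j, i * j] :: 'b^4))"
    using basis by (simp add: is_basis_def)
  have surj: "\<exists>x1 x2 x3 x4. x = L x1 x2 x3 x4" for x
    using bij lin by (metis bij_pointE)
  have inj: "L x1 x2 x3 x4 = L y1 y2 y3 y4 \<longleftrightarrow> x1 = y1 \<and> x2 = y2 \<and> x3 = y3 \<and> x4 = y4"
    for x1 x2 x3 x4 y1 y2 y3 y4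
  proof
    assume *: "L x1 x2 x3 x4 = L y1 y2 y3 y4"
    have "(vector [x1, x2, x3, x4] :: 'f^4) = vector [y1, y2, y3, y4]"
      using bij_is_inj[OF bij] by (rule injD) (simp add: lin * vector_4)
    then show "x1 = y1 \<and> x2 = y2 \<and> x3 = y3 \<and> x4 = y4"
      by (simp add: vec_eq_iff forall_4 vector_4)
  qed simp
  define s where "s x = (THE y. \<exists>x1 x2 x3 x4. x = L x1 x2 x3 x4 \<and> y = L x1 (- x2) (- x3) (- x4))" for x
  have s: "s (L x1 x2 x3 x4) = L x1 (- x2) (- x3) (- x4)" for x1 x2 x3 x4
    unfolding s_def by (rule the_equality) (auto simp: inj)
  have alg_L: "alg x = L x 0 0 0" for x by (simp add: L_def sm_def alg0)
  have L_add: "L x1 x2 x3 x4 + L y1 y2 y3 y4 = L (x1 + y1) (x2 + y2) (x3 + y3) (x4 + y4)"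
    for x1 x2 x3 x4 y1 y2 y3 y4 by (simp add: L_def sm_add)
  have "standard_involution alg s"
    unfolding standard_involution_def
  proof (intro conjI allI)
    show "s (alg x) = alg x" for x by (simp add: alg_L s)
    fix x
    obtain x1 x2 x3 x4 where x: "x = L x1 x2 x3 x4" using surj by blast
    show "s (s x) = x" by (simp add: x s)
    show "x + s x \<in> range alg" by (auto simp: x s L_add alg_L)
    show "x * s x \<in> range alg"
    proof -
      have "x * s x = alg (x1 * x1 - a * x2 * x2 - b * x3 * x3 + a * b * x4 * x4)"
        by (simp add: x s L_mult alg_L inj)
      then show ?thesis by blast
    qed
    fix y
    obtain y1 y2 y3 y4 where y: "y = L y1 y2 y3 y4" using surj by blast
    show "s (x + y) = s x + s y" by (simp add: x y s L_add)
    show "s (x * y) = s y * s x" by (simp add: x y s L_mult inj)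
  qed
  then show ?thesis by blast
qed

locale involution_algebra =
  fixes alg :: "'f::field \<Rightarrow> 'b::ring_1" and bar :: "'b \<Rightarrow> 'b"
  assumes algebra_map: "algebra_map alg" and involution: "standard_involution alg bar"
begin

lemma alg_1 [simp]: "alg 1 = 1" and alg_add: "alg (x + y) = alg x + alg y"
  and alg_mult: "alg (x * y) = alg x * alg y" and alg_comm: "alg x * z = z * alg x"
  using algebra_map unfolding algebra_map_def ring_hom_on_type_def by metis+

lemma alg_0 [simp]: "alg 0 = 0"
  using alg_add[of 0 0] by simp

lemma alg_eq_0: "alg x = 0 \<longleftrightarrow> x = 0"
proof
  assume "alg x = 0"
  then show "x = 0"
    using alg_mult[of x "inverse x"] by (cases "x = 0") auto
qed simp

lemma alg_diff: "alg (x - y) = alg x - alg y"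
  using alg_add[of "x - y" y] by simp

lemma alg_inject: "alg x = alg y \<longleftrightarrow> x = y"
  using alg_eq_0[of "x - y"] by (simp add: alg_diff)

text \<open>The difference of the norms is \<open>x\<close> times the difference of the traces. If
  the traces differ, \<open>x\<close> is a scalar and both involutions fix it; otherwise the norms
  agree at once.\<close>

lemma norm_unique:
  assumes "standard_involution alg s" "standard_involution alg s'"
    and "x * s x = alg n" "x * s' x = alg n'"
  shows "n = n'"
proof -
  obtain t t' where t: "x + s x = alg t" "x + s' x = alg t'"
    using assms(1,2) unfolding standard_involution_def by (metis rangeE)
  have sx: "s x = alg t - x" "s' x = alg t' - x"
    using t by (simp_all add: algebra_simps)
  have "alg n - alg n' = x * s x - x * s' x" by (simp add: assms)
  also have "\<dots> = x * alg (t - t')" by (simp add: sx alg_diff algebra_simps)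
  finally have *: "alg (n - n') = x * alg (t - t')" by (simp add: alg_diff)
  show ?thesis
  proof (cases "t = t'")
    case True
    then show ?thesis using * by (simp add: alg_eq_0)
  next
    case False
    have "x = x * alg (t - t') * alg (inverse (t - t'))"
      using False by (simp add: mult.assoc flip: alg_mult)
    then have "x = alg ((n - n') * inverse (t - t'))" using * by (simp add: alg_mult)
    then have "s x = s' x"
      using assms(1,2) unfolding standard_involution_def by metis
    then show ?thesis using assms(3,4) by (simp add: alg_inject)
  qed
qed

lemma bar_mult: "bar (x * y) = bar y * bar x" and bar_alg: "bar (alg z) = alg z"
  using involution by (auto simp: standard_involution_def)

lemma alg_reduced_norm: "alg (reduced_norm alg x) = x * bar x"
proof -
  obtain n where n: "x * bar x = alg n"
    using involution unfolding standard_involution_def by (metis rangeE)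
  have "reduced_norm alg x = n"
    unfolding reduced_norm_def
    by (rule the_equality) (use n involution norm_unique in blast)+
  then show ?thesis using n by simp
qed

lemma bar_commute: "bar x * x = x * bar x"
proof -
  obtain t where t: "x + bar x = alg t"
    using involution unfolding standard_involution_def by (metis rangeE)
  then have "bar x = alg t - x" by (simp add: algebra_simps)
  then show ?thesis using alg_comm[of t x] by (simp add: left_diff_distrib right_diff_distrib)
qed

lemma reduced_norm_1: "reduced_norm alg 1 = 1"
  using alg_reduced_norm[of 1] bar_alg[of 1] alg_inject[of _ 1] by simp

lemma reduced_norm_mult: "reduced_norm alg (x * y) = reduced_norm alg x * reduced_norm alg y"
proof -
  have "alg (reduced_norm alg (x * y)) = x * (y * bar y) * bar x"
    by (simp add: alg_reduced_norm bar_mult mult.assoc)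
  also have "\<dots> = x * alg (reduced_norm alg y) * bar x" by (simp only: alg_reduced_norm)
  also have "\<dots> = alg (reduced_norm alg y) * x * bar x" by (simp only: alg_comm)
  also have "\<dots> = alg (reduced_norm alg y) * (x * bar x)" by (simp only: mult.assoc)
  finally show ?thesis by (simp add: alg_inject mult.commute flip: alg_reduced_norm alg_mult)
qed

lemma inverse_ex_if_norm:
  assumes "reduced_norm alg x \<noteq> 0" obtains y where "x * y = 1" "y * x = 1"
proof
  let ?z = "alg (inverse (reduced_norm alg x))"
  have z: "alg (reduced_norm alg x) * ?z = 1" using assms by (simp flip: alg_mult)
  then show "x * (bar x * ?z) = 1" by (simp add: alg_reduced_norm mult.assoc)
  have "bar x * ?z * x = bar x * x * ?z" by (metis mult.assoc alg_comm)
  then show "bar x * ?z * x = 1" using z by (simp add: bar_commute alg_reduced_norm)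
qed

text \<open>Multiplicativity makes the norm of \<open>x\<close> nonzero, and the conjugate divided
  by the norm is a two-sided inverse.\<close>

lemma inverse_ex_if_right_inverse:
  fixes x y :: 'b
  assumes "x * y = 1" obtains z where "x * z = 1" "z * x = 1"
proof -
  have "reduced_norm alg x \<noteq> 0"
    using reduced_norm_mult[of x y] by (auto simp: assms reduced_norm_1)
  then show ?thesis using inverse_ex_if_norm that by blast
qed

end


section \<open>The quaternionic setting\<close>

context complete_nonarch
begin

lemma abs_closure_diff:
  assumes X: "\<And>x y. x \<in> X \<Longrightarrow> y \<in> X \<Longrightarrow> x - y \<in> X"
    and "x \<in> abs_closure nu X" "y \<in> abs_closure nu X"
  shows "x - y \<in> abs_closure nu X"
  unfolding abs_closure_def
proof (intro CollectI allI impI)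
  fix e :: real assume "0 < e"
  then obtain p r where "p \<in> X" "nu (x - p) < e" "r \<in> X" "nu (y - r) < e"
    using assms(2,3) unfolding abs_closure_def by blast
  moreover have "x - y - (p - r) = (x - p) + - (y - r)" by simp
  ultimately show "\<exists>r\<in>X. nu (x - y - r) < e"
    using X nu_add_less[of "x - p" e "- (y - r)"] nu_minus[of "y - r"] by metis
qed

lemma abs_closure_mult:
  assumes X: "\<And>x y. x \<in> X \<Longrightarrow> y \<in> X \<Longrightarrow> x * y \<in> X"
    and "x \<in> abs_closure nu X" "y \<in> abs_closure nu X"
  shows "x * y \<in> abs_closure nu X"
  unfolding abs_closure_def
proof (intro CollectI allI impI)
  fix e :: real assume e: "0 < e"
  have small: "a * b < e" if "0 \<le> b" "b < e / (1 + a)" "0 \<le> a" for a b :: real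
  proof -
    have "(1 + a) * b < e" using that by (simp add: pos_less_divide_eq mult.commute)
    moreover have "a * b \<le> (1 + a) * b" using that by (intro mult_right_mono) auto
    ultimately show ?thesis by linarith
  qed
  \<comment> \<open>The error is x (y - r) + r (x - p), so \<open>r\<close> is chosen first and the
    precision of \<open>p\<close> depends on it. The summand 1 avoids division by zero.\<close>
  have "0 < e / (1 + nu x)" using e nu_nonneg[of x] by (intro divide_pos_pos) linarith+
  then obtain r where r: "r \<in> X" "nu (y - r) < e / (1 + nu x)"
    using assms(3) unfolding abs_closure_def by blast
  have "0 < e / (1 + nu r)" using e nu_nonneg[of r] by (intro divide_pos_pos) linarith+
  then obtain p where p: "p \<in> X" "nu (x - p) < e / (1 + nu r)"
    using assms(2) unfolding abs_closure_def by blast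
  have "nu (x * (y - r) + r * (x - p)) < e"
    using r p by (intro nu_add_less) (simp_all add: nu_mult small)
  moreover have "x * (y - r) + r * (x - p) = x * y - p * r" by (simp add: algebra_simps)
  ultimately show "\<exists>r\<in>X. nu (x * y - r) < e" using X[OF p(1) r(1)] by force
qed

lemma abs_closure_inverse:
  assumes X: "\<And>x. x \<in> X \<Longrightarrow> inverse x \<in> X" and x: "x \<in> abs_closure nu X"
  shows "inverse x \<in> abs_closure nu X"
proof (cases "x = 0")
  case True
  then show ?thesis using x by simp
next
  case False
  show ?thesis
    unfolding abs_closure_def
  proof (intro CollectI allI impI)
    fix e :: real assume e: "0 < e"
    have nx: "0 < nu x" using False nu_nonneg[of x] nu_eq_0[of x] by linarith
    \<comment> \<open>The first bound forces |p| = |x|, so that \<open>p\<close> is invertible; the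
      second is the precision needed for the difference of the inverses.\<close>
    then have "0 < min (nu x) (e * (nu x * nu x))" using e by simp
    then obtain p where p: "p \<in> X" "nu (x - p) < min (nu x) (e * (nu x * nu x))"
      using x unfolding abs_closure_def by blast
    have "nu (x + - (x - p)) = nu x"
      by (rule nu_add_eq) (use p nu_minus[of "x - p"] in linarith)
    then have np: "nu p = nu x" by simp
    then have "p \<noteq> 0" using nx by auto
    then have "inverse x - inverse p = - ((x - p) * inverse x * inverse p)"
      using False by (simp add: field_simps)
    then have "nu (inverse x - inverse p) = nu (x - p) / (nu x * nu x)"
      by (simp only: nu_minus) (simp add: nu_mult nu_inverse np divide_inverse)
    also have "\<dots> < e" using p(2) nx by (simp add: pos_divide_less_eq)
    finally show "\<exists>r\<in>X. nu (inverse x - r) < e" using X[OF p(1)] by blast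
  qed
qed

end

section \<open>The local field, the Eichler order and its norm one units\<close>

locale quat_setting =
  fixes S :: "('f::field_char_0, 'b::ring_1, 'c::field_char_0) setting"
  assumes setting: "quaternionic_setting S"
begin

abbreviation "\<pi> \<equiv> jp S (varpi S)"
abbreviation "\<iota> \<equiv> iota_p S"

lemma algebra_map_alg: "algebra_map (alg S)"
  using setting by (auto simp: quaternionic_setting_def quaternion_algebra_def)

definition bar :: "'b \<Rightarrow> 'b" where
  "bar = (SOME s. standard_involution (alg S) s)"

sublocale involution_algebra "alg S" bar
proof
  show "standard_involution (alg S) bar"
    unfolding bar_def
  proof (rule someI_ex[of "standard_involution (alg S)"], rule standard_involution_exists)
    show "quaternion_algebra (alg S)" using setting by (simp add: quaternionic_setting_def)
  qed
qed (rule algebra_map_alg)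

lemma jp_1 [simp]: "jp S 1 = 1" and jp_add: "jp S (x + y) = jp S x + jp S y"
  and jp_mult: "jp S (x * y) = jp S x * jp S y"
  using setting by (auto simp: quaternionic_setting_def ring_hom_on_type_def)

lemma jp_0 [simp]: "jp S 0 = 0"
  using jp_add[of 0 0] by simp

lemma jp_inverse: "jp S (inverse x) = inverse (jp S x)"
proof (cases "x = 0")
  case False
  then have "jp S x * jp S (inverse x) = 1" by (simp flip: jp_mult)
  then show ?thesis by (metis inverse_unique)
qed simp

lemma jp_diff: "jp S (x - y) = jp S x - jp S y"
  using jp_add[of "x - y" y] by simp

lemma varpi_nonzero: "varpi S \<noteq> 0"
proof
  assume "varpi S = 0"
  moreover have "arch_place (vinf S)" "totally_positive (varpi S)"
    using setting by (auto simp: quaternionic_setting_def)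
  ultimately have "vinf S 0 > 0" by (auto simp: totally_positive_def)
  moreover have "vinf S (0 + 0) = vinf S 0 + vinf S 0"
    using \<open>arch_place (vinf S)\<close> unfolding arch_place_def ring_hom_on_type_def by blast
  ultimately show False by simp
qed

lemma pr_eq: "pr S = principal (varpi S)"
  and integers_le: "x \<in> integers_of \<Longrightarrow> absp S (jp S x) \<le> 1"
  and pr_less: "x \<in> pr S \<Longrightarrow> absp S (jp S x) < 1"
  using setting by (auto simp: quaternionic_setting_def)

sublocale complete_nonarch "absp S" "\<pi>"
proof
  have c: "completed_alg_closure (absp S) (rat_prime S)"
    using setting by (simp add: quaternionic_setting_def)
  then show n: "nonarch_abs (absp S)" "abs_complete (absp S)"
    by (auto simp: completed_alg_closure_def)
  have "jp S (varpi S) * jp S (inverse (varpi S)) = 1"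
    using varpi_nonzero by (simp flip: jp_mult)
  then have "\<pi> \<noteq> 0" by auto
  then show "0 < absp S \<pi>" using n(1) unfolding nonarch_abs_def by (metis order_le_less)
  have "(1::'f) \<in> integers_of" by (simp add: integers_of_def)
  then have "varpi S \<in> pr S" unfolding pr_eq principal_def by (metis image_eqI mult.right_neutral)
  then show "absp S \<pi> < 1" by (rule pr_less)
qed

lemma Qp_jp: "jp S x \<in> Qp S"
  unfolding Qp_def abs_closure_def by (auto intro!: exI[of _ x])

lemma Qp_diff: "x \<in> Qp S \<Longrightarrow> y \<in> Qp S \<Longrightarrow> x - y \<in> Qp S"
  unfolding Qp_def by (rule abs_closure_diff) (auto simp flip: jp_diff)

lemma Qp_mult: "x \<in> Qp S \<Longrightarrow> y \<in> Qp S \<Longrightarrow> x * y \<in> Qp S"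
  unfolding Qp_def by (rule abs_closure_mult) (auto simp flip: jp_mult)

lemma Qp_inverse: "x \<in> Qp S \<Longrightarrow> inverse x \<in> Qp S"
  unfolding Qp_def by (rule abs_closure_inverse) (auto simp flip: jp_inverse)

lemma Qp_0: "0 \<in> Qp S"
  using Qp_jp[of 0] by simp

lemma Qp_minus: "x \<in> Qp S \<Longrightarrow> - x \<in> Qp S"
  using Qp_diff[OF Qp_0, of x] by simp

lemma Qp_divide: "x \<in> Qp S \<Longrightarrow> y \<in> Qp S \<Longrightarrow> x / y \<in> Qp S"
  unfolding divide_inverse by (intro Qp_mult Qp_inverse)

lemma Zp_1: "1 \<in> Zp S"
  using Qp_jp[of 1] by (simp add: Zp_def)

lemma pZp_le: "x \<in> pZp S \<Longrightarrow> absp S x \<le> q"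
proof -
  assume "x \<in> pZp S"
  then obtain T c where T: "x = (\<Sum>y\<in>T. c y * y)" "T \<subseteq> jp S ` pr S" "\<forall>y\<in>T. c y \<in> Zp S"
    unfolding pZp_def coef_span_def by blast
  show ?thesis
    unfolding T(1)
  proof (rule nu_sum_le)
    fix y assume y: "y \<in> T"
    then obtain z where "z \<in> integers_of" "y = \<pi> * jp S z"
      using T(2) by (auto simp: pr_eq principal_def jp_mult)
    then have "absp S y \<le> q" using nu_mult_le[of \<pi> q] integers_le by simp
    then show "absp S (c y * y) \<le> q"
      using nu_mult_le'[of "c y" y q] T(3) y by (auto simp: Zp_def)
  qed simp
qed

lemma iota_mult: "\<iota> (x * y) = \<iota> x ** \<iota> y" and iota_alg: "\<iota> (alg S z) = mat (jp S z)"
  using setting by (auto simp: quaternionic_setting_def splitting_def)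

lemma iota_1: "\<iota> 1 = mat 1"
  using iota_alg[of 1] by simp

lemma coef_span_superset: "x \<in> X \<Longrightarrow> x \<in> coef_span (Zp S) (\<lambda>c M. mat c ** M) X"
  unfolding coef_span_def by (rule CollectI, rule exI[of _ "{x}"], rule exI[of _ "\<lambda>_. 1"])
    (simp add: Zp_1)

lemma eich_ord_iota:
  assumes "g \<in> eich_ord S" shows "\<iota> g $ i $ j \<in> Zp S" "\<iota> g $ 2 $ 1 \<in> pZp S" "integral_mat (\<iota> g)"
proof -
  have "\<iota> g \<in> {M. (\<forall>i j. M $ i $ j \<in> Zp S) \<and> M $ 2 $ 1 \<in> pZp S}"
    using coef_span_superset[of "\<iota> g" "\<iota> ` eich_ord S"] assms setting
    by (auto simp: quaternionic_setting_def)
  then show "\<iota> g $ i $ j \<in> Zp S" "\<iota> g $ 2 $ 1 \<in> pZp S" "integral_mat (\<iota> g)"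
    using pZp_le by (auto simp: integral_mat_def Zp_def)
qed

lemma eich_ord_Qp: "g \<in> eich_ord S \<Longrightarrow> \<iota> g $ i $ j \<in> Qp S"
  using eich_ord_iota(1) by (auto simp: Zp_def)

lemma eich_ord_order: "1 \<in> eich_ord S" "x \<in> eich_ord S \<Longrightarrow> y \<in> eich_ord S \<Longrightarrow> x * y \<in> eich_ord S"
  and eich_ord_subset: "eich_ord S \<subseteq> max_ord S"
proof -
  obtain R1 R2 where R: "is_order (alg S) R1" "is_order (alg S) R2" "eich_ord S = R1 \<inter> R2"
    and sub: "eich_ord S \<subseteq> max_ord S"
    using setting unfolding quaternionic_setting_def eichler_order_of_level_def maximal_order_def
    by (elim conjE exE) (rule that)
  then show "1 \<in> eich_ord S" "x \<in> eich_ord S \<Longrightarrow> y \<in> eich_ord S \<Longrightarrow> x * y \<in> eich_ord S"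
    unfolding R(3) by (auto simp: is_order_def)
  show "eich_ord S \<subseteq> max_ord S" by (rule sub)
qed

lemma Gamma0p_eich_ord: "g \<in> Gamma0p S \<Longrightarrow> g \<in> eich_ord S"
  by (simp add: Gamma0p_def norm_one_units_def)

lemma Gamma0p_subset: "Gamma0p S \<subseteq> Gamma0 S"
  using eich_ord_subset by (auto simp: Gamma0p_def Gamma0_def norm_one_units_def)

lemma one_in_Gamma0p: "1 \<in> Gamma0p S"
  using eich_ord_order(1) by (auto simp: Gamma0p_def norm_one_units_def reduced_norm_1)

lemma Gamma0p_mult: "g \<in> Gamma0p S \<Longrightarrow> g' \<in> Gamma0p S \<Longrightarrow> g * g' \<in> Gamma0p S"
proof -
  assume g: "g \<in> Gamma0p S" "g' \<in> Gamma0p S"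
  then obtain k k' where k: "k \<in> eich_ord S" "g * k = 1" "k * g = 1" "k' \<in> eich_ord S" "g' * k' = 1" "k' * g' = 1"
    by (auto simp: Gamma0p_def norm_one_units_def)
  have "g * g' * (k' * k) = g * (g' * k') * k" "k' * k * (g * g') = k' * (k * g) * g'"
    by (simp_all add: mult.assoc)
  then show ?thesis
    using g k eich_ord_order(2)[of g g'] eich_ord_order(2)[of k' k]
    by (auto simp: Gamma0p_def norm_one_units_def reduced_norm_mult intro!: bexI[of _ "k' * k"])
qed

lemma Gamma0p_inverse: "g \<in> Gamma0p S \<Longrightarrow> \<exists>g'\<in>Gamma0p S. g * g' = 1 \<and> g' * g = 1"
proof -
  assume g: "g \<in> Gamma0p S"
  then obtain k where k: "k \<in> eich_ord S" "g * k = 1" "k * g = 1" "nrd S g = 1"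
    by (auto simp: Gamma0p_def norm_one_units_def)
  then have "nrd S k = 1" using reduced_norm_mult[of g k] by (simp add: reduced_norm_1)
  then have "k \<in> Gamma0p S"
    using k Gamma0p_eich_ord[OF g] by (auto simp: Gamma0p_def norm_one_units_def)
  then show ?thesis using k by blast
qed

text \<open>The inverse is integral as well, and the upper left entry of the product is 1;
  \<open>nu_11_mult\<close> then makes the upper left entry of each factor a unit.\<close>

lemma Gamma0p_sigma_mat: "g \<in> Gamma0p S \<Longrightarrow> sigma_mat (\<iota> g)"
  and Gamma0p_det: "g \<in> Gamma0p S \<Longrightarrow> det (\<iota> g) \<noteq> 0"
proof -
  assume g: "g \<in> Gamma0p S"
  then obtain g' where g': "g' \<in> Gamma0p S" "g * g' = 1" using Gamma0p_inverse by blast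
  then have 1: "\<iota> g ** \<iota> g' = mat 1" by (simp add: iota_1 flip: iota_mult)
  then have "det (\<iota> g) * det (\<iota> g') = 1" by (simp flip: det_mul)
  then show "det (\<iota> g) \<noteq> 0" by auto
  have int: "integral_mat (\<iota> g)" "integral_mat (\<iota> g')"
    using g g' Gamma0p_eich_ord eich_ord_iota(3) by auto
  then show "sigma_mat (\<iota> g)" using nu_11_mult[OF int] 1 by (simp add: sigma_mat_def mat_def)
qed

end

section \<open>The module \<open>\<Lambda>\<close>\<close>

context quat_setting
begin

definition FLam :: "nat \<Rightarrow> 'c fps set" where
  "FLam N = {f. bd q (q ^ N) f}"

lemma FLam_eq: "(*) (fps_const (\<pi> ^ N)) ` Lam S = FLam N"
proof (intro equalityI subsetI)
  fix f assume "f \<in> (*) (fps_const (\<pi> ^ N)) ` Lam S"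
  then obtain g where g: "f = fps_const (\<pi> ^ N) * g" "g \<in> Lam S" by blast
  have "bd q 1 g"
    unfolding bd_def
  proof
    fix n
    obtain a where "absp S a \<le> 1" "fps_nth g n = a * \<pi> ^ n"
      using g(2) unfolding Lam_def by blast
    then show "absp S (fps_nth g n) \<le> 1 * q ^ n"
      by (simp add: nu_mult nu_power mult_left_le_one_le)
  qed
  then have "bd q (q ^ N * 1) f" unfolding g by (intro bd_const_mult) (simp_all add: nu_power)
  then show "f \<in> FLam N" by (simp add: FLam_def)
next
  fix f assume "f \<in> FLam N"
  then have f: "absp S (fps_nth f n) \<le> q ^ N * q ^ n" for n by (simp add: FLam_def bd_def)
  define g where "g = fps_const (inverse \<pi> ^ N) * f"
  have "\<exists>a. absp S a \<le> 1 \<and> fps_nth g n = a * \<pi> ^ n" for n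
  proof (intro exI conjI)
    show "fps_nth g n = (fps_nth g n * inverse \<pi> ^ n) * \<pi> ^ n"
      by (simp add: mult.assoc flip: power_mult_distrib)
    show "absp S (fps_nth g n * inverse \<pi> ^ n) \<le> 1"
      using f[of n] w_pos by (simp add: g_def nu_mult nu_power nu_inverse nu_divide field_simps)
  qed
  then have "g \<in> Lam S" by (simp add: Lam_def)
  moreover have "f = fps_const (\<pi> ^ N) * g"
    by (simp add: g_def flip: mult.assoc power_mult_distrib fps_const_mult)
  ultimately show "f \<in> (*) (fps_const (\<pi> ^ N)) ` Lam S" by blast
qed

lemma Lam_eq: "Lam S = FLam 0"
  using FLam_eq[of 0] by simp

lemma Lam_bd: "f \<in> Lam S \<longleftrightarrow> bd q 1 f"
  by (simp add: Lam_eq FLam_def)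

lemma lam_act_eq:
  assumes M: "sigma_mat (\<iota> g)" and f: "bd q C f"
  shows "lam_act S g f = mact (\<iota> g) f"
proof -
  have "bd 1 1 (wt (\<iota> g))"
    using bd_q_imp_bd_1[OF bd_wt[OF M]] nu_det_le[OF M] by (auto intro: bd_mono)
  then show ?thesis
    unfolding mact_def using mult_sub_eq[OF f bd_arg(1)[OF M], of "wt (\<iota> g)"]
    by (simp add: lam_act_def Let_def wt_def arg_def recip_def den_def det_2)
qed

definition Sigma_mat :: "'b set" where
  "Sigma_mat = {g. sigma_mat (\<iota> g)}"

lemma lam_act_FLam:
  assumes "g \<in> Sigma_mat" "f \<in> FLam N" shows "lam_act S g f \<in> FLam N"
  using assms lam_act_eq[of g "q ^ N" f] mact_bd_le[of "\<iota> g" "q ^ N" f]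
  by (simp add: Sigma_mat_def FLam_def)

lemma lam_act_diff:
  assumes "g \<in> Sigma_mat" "x \<in> Lam S" "y \<in> Lam S"
  shows "lam_act S g (x - y) = lam_act S g x - lam_act S g y"
proof -
  have "bd q 1 x" "bd q 1 y" "bd q 1 (x - y)" using assms by (auto simp: Lam_bd intro: bd_diff)
  then show ?thesis
    using assms(1) lam_act_eq[of g 1] mact_diff[of "\<iota> g" 1 x y] by (simp add: Sigma_mat_def)
qed

lemma Gamma0p_Sigma_mat: "Gamma0p S \<subseteq> Sigma_mat"
  using Gamma0p_sigma_mat by (auto simp: Sigma_mat_def)

sublocale Lam: filtered_module "Lam_mod S" FLam
proof
  show "0 \<in> carr (Lam_mod S)" by (simp add: Lam_mod_def Lam_bd bd_0)
  show "x - y \<in> carr (Lam_mod S)" if "x \<in> carr (Lam_mod S)" "y \<in> carr (Lam_mod S)" for x y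
    using that by (simp add: Lam_mod_def Lam_bd bd_diff)
  show "act (Lam_mod S) g (x - y) = act (Lam_mod S) g x - act (Lam_mod S) g y"
    if "g \<in> grp (Lam_mod S)" "x \<in> carr (Lam_mod S)" "y \<in> carr (Lam_mod S)" for g x y
    using that lam_act_diff Gamma0p_Sigma_mat by (auto simp: Lam_mod_def)
  show "FLam 0 = carr (Lam_mod S)" by (simp add: Lam_mod_def Lam_eq)
  show "0 \<in> FLam N" for N by (simp add: FLam_def bd_0)
  show "x - y \<in> FLam N" if "x \<in> FLam N" "y \<in> FLam N" for x y N
    using that by (simp add: FLam_def bd_diff)
  show "FLam (Suc N) \<subseteq> FLam N" for N
    using q_power_le[of N "Suc N"] by (auto simp: FLam_def intro: bd_mono)
  show "x = 0" if "\<And>N. x \<in> FLam N" for x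
    using that eq_if_bd[of 1 x 0] by (simp add: FLam_def bd_q_imp_bd_1)
  show "act (Lam_mod S) g x \<in> FLam N" if "g \<in> grp (Lam_mod S)" "x \<in> FLam N" for g x N
    using that lam_act_FLam Gamma0p_Sigma_mat by (auto simp: Lam_mod_def)
  show "g * g' \<in> grp (Lam_mod S)" if "g \<in> grp (Lam_mod S)" "g' \<in> grp (Lam_mod S)" for g g'
    using that Gamma0p_mult by (simp add: Lam_mod_def)
  show "\<exists>s. \<forall>N. s - (\<Sum>k<N. f k) \<in> FLam N" if f: "\<And>n. f n \<in> FLam n" for f
  proof -
    \<comment> \<open>Completeness is checked coefficientwise; the factor \<open>q ^ m\<close> keeps
      the limit bounded at radius 1/q.\<close>
    have "\<exists>s. \<forall>N. absp S (s - (\<Sum>k<N. fps_nth (f k) m)) \<le> q ^ m * q ^ N" for m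
      using f by (intro sum_approx_ex) (simp add: FLam_def bd_def mult.commute)
    then obtain s where s: "\<And>m N. absp S (s m - (\<Sum>k<N. fps_nth (f k) m)) \<le> q ^ m * q ^ N"
      by metis
    have "Abs_fps s - (\<Sum>k<N. f k) \<in> FLam N" for N
      using s[of _ N] by (simp add: FLam_def bd_def fps_sum_nth mult.commute)
    then show ?thesis by blast
  qed
qed

text \<open>\<open>Lam_sums\<close> asks for convergence without a rate. The competing limits in
  \<open>Lam_suminf\<close> are therefore only known to be close to late partial sums, which still
  forces equality.\<close>

lemma Lam_sums_iff:
  assumes "Lam.fsums f s" shows "Lam_sums S f s" "Lam_suminf S f = s"
proof -
  have close: "s - (\<Sum>k<n. f k) \<in> FLam N" if "N \<le> n" for N n
    using assms Lam.F_antimono[OF that] by (auto simp: Lam.fsums_def)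
  then show *: "Lam_sums S f s"
    using Lam.fsums_carr[OF assms] unfolding Lam_sums_def FLam_eq by (auto simp: Lam_mod_def)
  show "Lam_suminf S f = s"
    unfolding Lam_suminf_def
  proof (rule the_equality)
    fix s' assume s': "Lam_sums S f s'"
    have "s' - s \<in> FLam N" for N
    proof -
      obtain n where "\<And>m. m \<ge> n \<Longrightarrow> s' - (\<Sum>k<m. f k) \<in> FLam N"
        using s' unfolding Lam_sums_def FLam_eq by blast
      then have "(s' - (\<Sum>k<max n N. f k)) - (s - (\<Sum>k<max n N. f k)) \<in> FLam N"
        by (intro Lam.diff_F[of "s' - (\<Sum>k<max n N. f k)"] close) auto
      then show ?thesis by simp
    qed
    then show "s' = s" using Lam.separated[of "s' - s"] by simp
  qed (rule *)
qed

end


section \<open>The operator \<open>U\<^sub>p\<close>\<close>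

locale Up_setting = quat_setting S
  for S :: "('f::field_char_0, 'b::ring_1, 'c::field_char_0) setting" +
  fixes hw :: 'b and h :: "'c set \<Rightarrow> 'b"
  assumes Up_reps: "Up_reps S hw h"
begin

lemma reps: "coset_reps (Gamma0p S) hw (Fp S) h"
  using Up_reps by (simp add: Up_reps_def)

lemma hw_sigma_mat: "sigma_mat (\<iota> hw)"
  using Up_reps eich_ord_iota(3)[of hw] by (auto simp: Up_reps_def Sigma0p_def sigma_mat_def)

lemma hw_det: "det (\<iota> hw) = \<pi>"
proof -
  obtain M where "det M = 1" "\<iota> hw = vector [vector [1, 0], vector [0, \<pi>]] ** M"
    using Up_reps by (auto simp: Up_reps_def SL2_Zp_def)
  then show ?thesis by (simp add: det_mul) (simp add: det_2)
qed

lemma hw_inverse_ex: obtains y where "y * hw = 1"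
proof (rule inverse_ex_if_norm)
  show "nrd S hw \<noteq> 0" using Up_reps varpi_nonzero by (simp add: Up_reps_def)
qed

text \<open>Every representative lies in the double coset of \<open>hw\<close>, so its sizes, its
  determinant up to a unit and its cancellation property are inherited from
  \<open>hw\<close>.\<close>

lemma rep_cases:
  assumes "t \<in> Fp S" obtains g g' where "g \<in> Gamma0p S" "g' \<in> Gamma0p S" "h t = g * hw * g'"
proof -
  have "h t * 1 \<in> (\<Union>t\<in>Fp S. (*) (h t) ` Gamma0p S)" using assms one_in_Gamma0p by blast
  then have "h t * 1 \<in> {g * hw * g' | g g'. g \<in> Gamma0p S \<and> g' \<in> Gamma0p S}"
    using reps by (simp add: coset_reps_def)
  then show ?thesis using that by auto
qed

lemma rep_sigma_mat: "t \<in> Fp S \<Longrightarrow> sigma_mat (\<iota> (h t))"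
  by (elim rep_cases) (auto simp: iota_mult intro!: sigma_mat_mult Gamma0p_sigma_mat hw_sigma_mat)

lemma rep_det: "t \<in> Fp S \<Longrightarrow> absp S (det (\<iota> (h t))) \<le> q"
proof (elim rep_cases)
  fix g g' assume g: "g \<in> Gamma0p S" "g' \<in> Gamma0p S" "h t = g * hw * g'"
  have "absp S (det (\<iota> g) * \<pi> * det (\<iota> g')) \<le> q"
    using g by (intro nu_mult_le[OF nu_mult_le'] nu_det_le Gamma0p_sigma_mat order_refl)
  then show "absp S (det (\<iota> (h t))) \<le> q" by (simp add: g(3) iota_mult det_mul hw_det)
qed

lemma rep_cancel: "t \<in> Fp S \<Longrightarrow> h t * s = h t * s' \<Longrightarrow> s = s'"
proof (elim rep_cases)
  fix g g' assume g: "g \<in> Gamma0p S" "g' \<in> Gamma0p S" "h t = g * hw * g'"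
    and eq: "h t * s = h t * s'"
  obtain k k' y where inv: "k * g = 1" "k' * g' = 1" "y * hw = 1"
    using Gamma0p_inverse g hw_inverse_ex by metis
  have "k' * (y * (k * (h t * z))) = z" for z
  proof -
    have "k' * (y * (k * (h t * z))) = k' * (y * ((k * g) * hw) * g') * z"
      by (simp add: g(3) mult.assoc)
    then show ?thesis using inv by simp
  qed
  then show "s = s'" using eq by metis
qed

lemma lam_act_rep:
  assumes "t \<in> Fp S" "f \<in> FLam N" shows "lam_act S (h t) f \<in> FLam (Suc N)"
proof -
  note M = rep_sigma_mat[OF assms(1)]
  have f: "bd q (q ^ N) f" using assms(2) by (simp add: FLam_def)
  have "bd q (q * q ^ N) (mact (\<iota> (h t)) f)"
    by (rule bd_mono[OF mact_bd[OF M f]]) (auto intro!: mult_right_mono rep_det assms(1))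
  then show ?thesis by (simp add: FLam_def lam_act_eq[OF M f])
qed

sublocale Up: hecke_module "Lam_mod S" Sigma_mat hw "Fp S" h
proof
  fix g g' assume g: "g \<in> grp (Lam_mod S)" and g': "g' \<in> grp (Lam_mod S)"
  show "g * g' \<in> grp (Lam_mod S)" by (rule Lam.grp_mult[OF g g'])
  show "\<exists>g'\<in>grp (Lam_mod S). g * g' = 1 \<and> g' * g = 1"
    using g Gamma0p_inverse by (simp add: Lam_mod_def)
next
  fix s s' x assume s: "s \<in> Sigma_mat" and s': "s' \<in> Sigma_mat" and x: "x \<in> carr (Lam_mod S)"
  have M: "sigma_mat (\<iota> s)" "sigma_mat (\<iota> s')" using s s' by (auto simp: Sigma_mat_def)
  have f: "bd q 1 x" using x by (simp add: Lam_mod_def Lam_bd)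
  have "lam_act S (s * s') x = mact (\<iota> s ** \<iota> s') x"
    using lam_act_eq[of "s * s'"] sigma_mat_mult[OF M] f by (simp add: iota_mult)
  also have "\<dots> = lam_act S s (lam_act S s' x)"
    using mact_mult[OF M f] lam_act_eq[OF M(2) f] lam_act_eq[OF M(1) mact_bd_le[OF M(2) f]] by simp
  finally show "act (Lam_mod S) (s * s') x = act (Lam_mod S) s (act (Lam_mod S) s' x)"
    by (simp add: Lam_mod_def)
next
  fix s x assume s: "s \<in> Sigma_mat" and x: "x \<in> carr (Lam_mod S)"
  show "act (Lam_mod S) s x \<in> carr (Lam_mod S)"
    using lam_act_FLam[OF s, of x 0] x by (simp add: Lam_mod_def Lam_eq)
  fix y assume y: "y \<in> carr (Lam_mod S)"
  show "act (Lam_mod S) s (x - y) = act (Lam_mod S) s x - act (Lam_mod S) s y"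
    using lam_act_diff[OF s] x y by (simp add: Lam_mod_def)
next
  fix t s s' assume "t \<in> Fp S" "h t * s = h t * s'"
  then show "s = s'" by (rule rep_cancel)
qed (use one_in_Gamma0p Gamma0p_Sigma_mat rep_sigma_mat reps
      in \<open>auto simp: Lam_mod_def Sigma_mat_def\<close>)

lemma Up_eq: "Up S h = Up.U"
  by (simp add: Up_def)

sublocale Up: contraction "Lam_mod S" FLam "Up S h" Up.U0
proof
  have act: "act (Lam_mod S) = lam_act S" by (simp add: Lam_mod_def)
  fix n
  show "Up S h \<theta> g \<in> FLam (Suc n)"
    if "\<And>g. g \<in> grp (Lam_mod S) \<Longrightarrow> \<theta> g \<in> FLam n" "g \<in> grp (Lam_mod S)" for \<theta> g
    unfolding Up_eq Up.U_eq act by (intro Lam.sum_F lam_act_rep that Up.tr_ix)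
  show "Up.U0 v \<in> FLam (Suc n)" if "v \<in> FLam n" for v
    unfolding Up.U0_def act by (intro Lam.sum_F lam_act_rep that)
qed (auto simp: Up_eq intro: Up.U_diff Up.U_Z1 Up.U_coboundary)

lemma series_define_classes:
  assumes \<theta>: "\<theta> \<in> Z1 (Lam_mod S)"
  defines "\<phi> \<equiv> H1_class (Lam_mod S) \<theta>"
  shows "\<exists>\<Phi>plus \<Phi>minus.
      series_defines_class S (\<lambda>n \<theta>. (Up S h ^^ n) \<theta>) \<phi> \<Phi>plus \<and>
      series_defines_class S (\<lambda>n \<theta> \<gamma>. (- 1) ^ Suc n * (Up S h ^^ n) \<theta> \<gamma>) \<phi> \<Phi>minus \<and>
      H1_add (Lam_mod S) (H1_map (Lam_mod S) (Up S h) \<Phi>plus) \<phi> = \<Phi>plus \<and>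
      H1_add (Lam_mod S) (H1_map (Lam_mod S) (Up S h) \<Phi>minus) \<phi> = H1_minus (Lam_mod S) \<Phi>minus"
proof (intro exI conjI)
  interpret neg: contraction "Lam_mod S" FLam "\<lambda>\<theta> g. - Up S h \<theta> g" "\<lambda>v. - Up.U0 v"
    by (rule Up.contraction_minus)
  let ?M = "Lam_mod S"
  have grp: "grp ?M = Gamma0p S" by (simp add: Lam_mod_def)
  have map: "H1_map ?M (Up S h) (H1_class ?M \<xi>) = H1_class ?M (Up S h \<xi>)" if "\<xi> \<in> Z1 ?M" for \<xi>
    using Lam.H1_map_class[OF Lam.coeff_module_axioms that] Up.U_cohomologous by (simp add: Up_eq)
  \<comment> \<open>The signs (-1)^(n+1) make the second series minus the geometric series of the
    operator -U_p, hence the outer minus sign.\<close>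
  let ?P = "Up.series \<theta>" and ?N = "\<lambda>g. - neg.series \<theta> g"
  have P: "?P \<in> Z1 ?M" and N: "?N \<in> Z1 ?M"
    using \<theta> by (auto intro: Up.series_Z1 neg.series_Z1 Lam.Z1_minus)
  show "series_defines_class S (\<lambda>n \<theta>. (Up S h ^^ n) \<theta>) \<phi> (H1_class ?M ?P)"
    unfolding series_defines_class_def
  proof (intro conjI ballI)
    show "H1_class ?M ?P \<in> H1 ?M" by (rule Lam.H1_class_in_H1[OF P])
    fix \<theta>' assume "\<theta>' \<in> \<phi>"
    then have coh: "(\<theta>, \<theta>') \<in> cohomologous ?M" by (simp add: \<phi>_def H1_class_def)
    then have \<theta>': "\<theta>' \<in> Z1 ?M" by (auto simp: cohomologous_def)
    have sums: "Lam.fsums (\<lambda>n. (Up S h ^^ n) \<theta>' g) (Up.series \<theta>' g)" if "g \<in> Gamma0p S" for g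
      using Up.fsums_series[OF \<theta>'] that grp by simp
    then show "Lam_summable S (\<lambda>n. (Up S h ^^ n) \<theta>' g)" if "g \<in> Gamma0p S" for g
      using Lam_sums_iff(1) that unfolding Lam_summable_def by blast
    let ?s = "\<lambda>g. Lam_suminf S (\<lambda>n. (Up S h ^^ n) \<theta>' g)"
    \<comment> \<open>Outside the group nothing is known about \<open>Lam_suminf\<close>, so the two
      functions are compared on the group only and \<open>Lam.Z1_cong\<close> does the rest.\<close>
    have eq: "?s g = Up.series \<theta>' g" if "g \<in> grp ?M" for g
      using Lam_sums_iff(2)[OF sums] that grp by simp
    have "?s \<in> Z1 ?M" by (rule Lam.Z1_cong[OF Up.series_Z1[OF \<theta>'] eq Lam.grp_mult])
    moreover have "H1_class ?M ?s = H1_class ?M ?P"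
      using Lam.H1_class_cong[OF \<open>?s \<in> Z1 ?M\<close> Up.series_Z1[OF \<theta>'] eq]
        Lam.H1_class_eq[OF Up.series_cohomologous[OF coh]] by simp
    ultimately show "?s \<in> H1_class ?M ?P" using Lam.in_H1_class by blast
  qed
  show "series_defines_class S (\<lambda>n \<theta> \<gamma>. (- 1) ^ Suc n * (Up S h ^^ n) \<theta> \<gamma>) \<phi> (H1_class ?M ?N)"
    unfolding series_defines_class_def
  proof (intro conjI ballI)
    show "H1_class ?M ?N \<in> H1 ?M" by (rule Lam.H1_class_in_H1[OF N])
    fix \<theta>' assume "\<theta>' \<in> \<phi>"
    then have coh: "(\<theta>, \<theta>') \<in> cohomologous ?M" by (simp add: \<phi>_def H1_class_def)
    then have \<theta>': "\<theta>' \<in> Z1 ?M" by (auto simp: cohomologous_def)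
    have sums: "Lam.fsums (\<lambda>n. (- 1) ^ Suc n * (Up S h ^^ n) \<theta>' g) (- neg.series \<theta>' g)"
      if "g \<in> Gamma0p S" for g
    proof -
      have "Lam.fsums (\<lambda>n. - ((\<lambda>\<theta> g. - Up S h \<theta> g) ^^ n) \<theta>' g) (- neg.series \<theta>' g)"
        using neg.fsums_series[OF \<theta>'] that grp by (intro Lam.fsums_minus) simp
      moreover have "- ((\<lambda>\<theta> g. - Up S h \<theta> g) ^^ n) \<theta>' g = (- 1) ^ Suc n * (Up S h ^^ n) \<theta>' g" for n
        using Up.iterate_minus[OF \<theta>', of g n] that grp by simp
      ultimately show ?thesis by simp
    qed
    then show "Lam_summable S (\<lambda>n. (- 1) ^ Suc n * (Up S h ^^ n) \<theta>' g)" if "g \<in> Gamma0p S" for g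
      using Lam_sums_iff(1) that unfolding Lam_summable_def by blast
    let ?s = "\<lambda>g. Lam_suminf S (\<lambda>n. (- 1) ^ Suc n * (Up S h ^^ n) \<theta>' g)"
    have eq: "?s g = - neg.series \<theta>' g" if "g \<in> grp ?M" for g
      using Lam_sums_iff(2)[OF sums] that grp by simp
    note Z = Lam.Z1_minus[OF neg.series_Z1[OF \<theta>']]
    have "?s \<in> Z1 ?M" by (rule Lam.Z1_cong[OF Z eq Lam.grp_mult])
    moreover have "H1_class ?M ?s = H1_class ?M ?N"
      using Lam.H1_class_cong[OF \<open>?s \<in> Z1 ?M\<close> Z eq]
        Lam.H1_class_eq[OF Lam.cohomologous_minus[OF neg.series_cohomologous[OF coh]]] by simp
    ultimately show "?s \<in> H1_class ?M ?N" using Lam.in_H1_class by blast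
  qed
  show "H1_add ?M (H1_map ?M (Up S h) (H1_class ?M ?P)) \<phi> = H1_class ?M ?P"
    unfolding \<phi>_def map[OF P] Lam.H1_add_class[OF Up.V_Z1[OF P] \<theta>]
    by (intro Lam.H1_class_cong Lam.Z1_add Up.V_Z1 P \<theta>)
      (simp add: Up.series_fixpoint[OF \<theta>] add.commute)
  \<comment> \<open>The geometric series \<nu> of -U_p satisfies \<nu> = \<theta> - U_p \<nu>. With
    N = -\<nu> this reads U_p N + \<theta> = -N, already on cocycles.\<close>
  show "H1_add ?M (H1_map ?M (Up S h) (H1_class ?M ?N)) \<phi> = H1_minus ?M (H1_class ?M ?N)"
    unfolding \<phi>_def map[OF N] Lam.H1_add_class[OF Up.V_Z1[OF N] \<theta>] Lam.H1_minus_class[OF N]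
  proof (intro Lam.H1_class_cong Lam.Z1_add Lam.Z1_minus Up.V_Z1 neg.series_Z1 \<theta>)
    fix g assume g: "g \<in> grp ?M"
    have "Up S h (\<lambda>g. 0 - neg.series \<theta> g) g = Up S h (\<lambda>_. 0) g - Up S h (neg.series \<theta>) g"
      using neg.series_carr[OF \<theta>] by (intro Up.V_diff g) (auto intro: Lam.zero)
    then show "Up S h ?N g + \<theta> g = - ?N g"
      using neg.series_fixpoint[OF \<theta> g] Up.V_0[OF g] by simp
  qed
qed

end

section \<open>Divisors\<close>

lemma sum_keys_superset:
  fixes f :: "'a \<Rightarrow> 'r::ring_1"
  assumes "finite K" "Poly_Mapping.keys D \<subseteq> K"
  shows "(\<Sum>x\<in>Poly_Mapping.keys D. of_int (Poly_Mapping.lookup D x) * f x)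
    = (\<Sum>x\<in>K. of_int (Poly_Mapping.lookup D x) * f x)"
  using assms by (intro sum.mono_neutral_left) (auto simp: in_keys_iff)

lemma sum_keys_diff:
  fixes f :: "'a \<Rightarrow> 'r::ring_1" and D D' :: "'a \<Rightarrow>\<^sub>0 int"
  defines "T \<equiv> \<lambda>D. \<Sum>x\<in>Poly_Mapping.keys D. of_int (Poly_Mapping.lookup D x) * f x"
  shows "T (D - D') = T D - T D'"
proof -
  let ?K = "Poly_Mapping.keys D \<union> Poly_Mapping.keys D'"
  have T: "T E = (\<Sum>x\<in>?K. of_int (Poly_Mapping.lookup E x) * f x)" if "E \<in> {D, D', D - D'}" for E
    unfolding T_def using that keys_diff[of D D'] by (intro sum_keys_superset) auto
  show ?thesis by (simp add: T lookup_minus left_diff_distrib sum_subtractf)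
qed

lemma deg_diff: "deg (D - D') = deg D - deg D'"
  using sum_keys_diff[where f = "\<lambda>_. 1 :: int"] by (simp add: deg_def)

lemma eta_diff: "eta (D - D') = eta D - eta D'"
  unfolding eta_def by (rule sum_keys_diff)

lemma eta_0: "eta 0 = 0"
  using eta_diff[of 0 0] by simp

lemma eta_add: "eta (D + D') = eta D + eta D'"
  using eta_diff[of "D + D'" D'] by simp

lemma Div_diff: "D \<in> Div X \<Longrightarrow> D' \<in> Div X \<Longrightarrow> D - D' \<in> Div X"
  using keys_diff[of D D'] by (auto simp: Div_def)

lemma Div0_diff: "D \<in> Div0 X \<Longrightarrow> D' \<in> Div0 X \<Longrightarrow> D - D' \<in> Div0 X"
  by (simp add: Div0_def Div_diff deg_diff)

lemma Div0_0: "0 \<in> Div0 X"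
  by (simp add: Div0_def Div_def deg_def)

lemma div_act_diff: "div_act S g (D - D') = div_act S g D - div_act S g D'"
  by (simp add: div_act_def frag_extend_diff)

lemma div_act_add: "div_act S g (D + D') = div_act S g D + div_act S g D'"
  by (simp add: div_act_def frag_extend_add)

text \<open>Pushing points forward may merge them, but total multiplicity is kept.\<close>

lemma deg_div_act: "deg (div_act S g D) = deg D"
proof -
  have "Poly_Mapping.keys D \<subseteq> UNIV" by simp
  then show ?thesis
    by (induction D rule: frag_induction) (simp_all add: div_act_diff deg_diff, simp_all add: div_act_def deg_def)
qed

lemma div_act_Div:
  assumes "D \<in> Div X" "\<And>z. z \<in> X \<Longrightarrow> mob_p S g z \<in> Y" shows "div_act S g D \<in> Div Y"
  using assms keys_frag_extend[of "\<lambda>z. frag_of (mob_p S g z)" D]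
  by (fastforce simp: Div_def div_act_def)

lemma div_act_cong:
  assumes "D \<in> Div X" "\<And>z. z \<in> X \<Longrightarrow> mob_p S g (mob_p S g' z) = mob_p S k (mob_p S k' z)"
  shows "div_act S g (div_act S g' D) = div_act S k (div_act S k' D)"
proof -
  have "frag_extend (\<lambda>z. frag_of (mob_p S g (mob_p S g' z))) D
      = frag_extend (\<lambda>z. frag_of (mob_p S k (mob_p S k' z))) D"
    using assms by (intro frag_extend_eq) (auto simp: Div_def)
  then show ?thesis
    using frag_extend_compose[of "\<lambda>z. frag_of (mob_p S g z)" "mob_p S g'" D]
      frag_extend_compose[of "\<lambda>z. frag_of (mob_p S k z)" "mob_p S k'" D]
    by (simp add: div_act_def o_def)
qed

lemma coeff_module_Div0:
  "coeff_module \<lparr>grp = G, act = div_act S, carr = Div0 X\<rparr>"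
  by unfold_locales (auto simp: Div0_0 Div0_diff div_act_diff)

section \<open>Fractional linear transformations on the p-adic upper half plane\<close>

context quat_setting
begin

definition Qp_mat :: "'c^2^2 \<Rightarrow> bool" where
  "Qp_mat M \<longleftrightarrow> (\<forall>i j. M $ i $ j \<in> Qp S) \<and> det M \<noteq> 0"

text \<open>A zero of the denominator would be -d/c, a point of \<open>Qp S\<close>; if c = 0, then
  d = 0 would contradict the determinant.\<close>

lemma mob_den_nonzero:
  assumes "Qp_mat M" "z \<notin> Qp S" shows "M $ 2 $ 1 * z + M $ 2 $ 2 \<noteq> 0"
proof
  assume *: "M $ 2 $ 1 * z + M $ 2 $ 2 = 0"
  show False
  proof (cases "M $ 2 $ 1 = 0")
    case True
    then show False using * assms(1) by (simp add: Qp_mat_def det_2)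
  next
    case False
    have "M $ 2 $ 1 * z = - (M $ 2 $ 2)" using * by (simp add: eq_neg_iff_add_eq_0)
    moreover have "z = M $ 2 $ 1 * z / M $ 2 $ 1" using False by simp
    ultimately have "z = - (M $ 2 $ 2) / M $ 2 $ 1" by simp
    moreover have "- (M $ 2 $ 2) / M $ 2 $ 1 \<in> Qp S"
      using assms(1) by (intro Qp_divide Qp_minus) (auto simp: Qp_mat_def)
    ultimately show False using assms(2) by simp
  qed
qed

text \<open>Solving w = (a z + b) / (c z + d) for \<open>z\<close> gives a rational expression in
  \<open>w\<close>; its denominator vanishes only for a singular matrix.\<close>

lemma mob_p_not_Qp:
  assumes "Qp_mat (\<iota> g)" "z \<notin> Qp S" shows "mob_p S g z \<notin> Qp S"
proof
  define a b c d where abcd: "a = \<iota> g $ 1 $ 1" "b = \<iota> g $ 1 $ 2" "c = \<iota> g $ 2 $ 1" "d = \<iota> g $ 2 $ 2"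
  define w where "w = mob_p S g z"
  assume "mob_p S g z \<in> Qp S"
  then have Q: "a \<in> Qp S" "b \<in> Qp S" "c \<in> Qp S" "d \<in> Qp S" "w \<in> Qp S"
    using assms(1) by (auto simp: Qp_mat_def abcd w_def)
  have det: "a * d - b * c \<noteq> 0" using assms(1) by (simp add: Qp_mat_def det_2 abcd)
  have "c * z + d \<noteq> 0" using mob_den_nonzero[OF assms] by (simp add: abcd)
  then have "w * (c * z + d) = a * z + b"
    by (simp add: w_def mob_p_def Let_def flip: abcd)
  then have *: "(w * c - a) * z = b - w * d" by (simp add: algebra_simps)
  show False
  proof (cases "w * c - a = 0")
    case True
    then have "b = w * d" "a = w * c" using * by auto
    then show False using det by simp
  next
    case False
    then have "z = (b - w * d) / (w * c - a)" using * by (simp add: eq_divide_eq mult.commute)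
    moreover have "(b - w * d) / (w * c - a) \<in> Qp S" by (intro Qp_divide Qp_diff Qp_mult Q)
    ultimately show False using assms(2) by simp
  qed
qed

lemma mob_p_mult:
  assumes "Qp_mat (\<iota> g')" "z \<notin> Qp S"
  shows "mob_p S (g * g') z = mob_p S g (mob_p S g' z)"
proof -
  define e n where "e = \<iota> g' $ 2 $ 1 * z + \<iota> g' $ 2 $ 2" and "n = \<iota> g' $ 1 $ 1 * z + \<iota> g' $ 1 $ 2"
  have e: "e \<noteq> 0" using mob_den_nonzero[OF assms] by (simp add: e_def)
  have *: "x * n / e + y = (x * n + y * e) / e" for x y using e by (simp add: field_simps)
  have "mob_p S g (n / e) = (\<iota> g $ 1 $ 1 * n + \<iota> g $ 1 $ 2 * e) / (\<iota> g $ 2 $ 1 * n + \<iota> g $ 2 $ 2 * e)"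
    using e by (simp add: mob_p_def Let_def *)
  moreover have "mob_p S g' z = n / e" by (simp add: mob_p_def Let_def e_def n_def)
  ultimately show ?thesis
    by (simp add: mob_p_def Let_def iota_mult matrix_mult_2 e_def n_def algebra_simps)
qed

lemma Gamma0p_Qp_mat: "g \<in> Gamma0p S \<Longrightarrow> Qp_mat (\<iota> g)"
  using Gamma0p_det eich_ord_Qp[OF Gamma0p_eich_ord] by (simp add: Qp_mat_def)

text \<open>A point of \<open>A0 S\<close> in \<open>Qp S\<close> would lie in \<open>Zp S\<close>
  and have distance 0 from itself.\<close>

lemma A0_not_Qp: "z \<in> A0 S \<Longrightarrow> z \<notin> Qp S"
  by (auto simp: A0_def Zp_def dest: bspec[of _ _ z])

lemma A0_abs: "z \<in> A0 S \<Longrightarrow> absp S z = 1"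
  using Qp_0 by (force simp: A0_def Zp_def dest: bspec[of _ _ 0])


section \<open>The map to \<open>\<Lambda>\<close>\<close>

lemma UinfD: "Q \<in> Uinf S \<Longrightarrow> Q \<notin> Qp S" "Q \<in> Uinf S \<Longrightarrow> 1 / q \<le> absp S Q"
  by (auto simp: Uinf_def Hp_def divide_inverse)

lemma eta_Lam: "D \<in> Div (Uinf S) \<Longrightarrow> eta D \<in> Lam S"
  unfolding eta_def Lam_bd fps_of_int[symmetric]
  by (intro bd_sum bd_mult_unit bd_const bd_inverse_linear nu_of_int_le UinfD) (auto simp: Div_def)

text \<open>Induction over divisors passes through single points, so the statement covers all
  degrees. The differential dx / (x - Q) also has a pole at infinity, and the transport of that pole
  is the correction, counted once for each unit of degree.\<close>

lemma eta_div_act: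
  assumes D: "D \<in> Div (Uinf S)" and g: "g \<in> Gamma0p S"
  shows "lam_act S g (eta D) = eta (div_act S g D)
    + of_int (deg D) * (fps_const (\<iota> g $ 2 $ 1) * recip (\<iota> g))"
proof -
  have M: "sigma_mat (\<iota> g)" "g \<in> Sigma_mat" and Q: "Qp_mat (\<iota> g)"
    using g Gamma0p_sigma_mat Gamma0p_Qp_mat by (auto simp: Sigma_mat_def)
  have "Poly_Mapping.keys D \<subseteq> Uinf S" using D by (simp add: Div_def)
  then have "D \<in> Div (Uinf S) \<and> lam_act S g (eta D) = eta (div_act S g D)
    + of_int (deg D) * (fps_const (\<iota> g $ 2 $ 1) * recip (\<iota> g))"
  proof (induction D rule: frag_induction)
    case zero
    have "lam_act S g 0 = 0" using lam_act_diff[OF M(2), of 0 0] by (simp add: Lam_bd bd_0)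
    then show ?case by (simp add: eta_0 div_act_def deg_def Div_def)
  next
    case (one z)
    note z = UinfD[OF one]
    have "lam_act S g (inverse (fps_X - fps_const z)) = mact (\<iota> g) (inverse (fps_X - fps_const z))"
      by (rule lam_act_eq[OF M(1) bd_inverse_linear[OF z(2)]])
    then show ?case
      using one mact_inverse_linear[OF M(1) z(2) mob_den_nonzero[OF Q z(1)]]
      by (simp add: eta_def div_act_def deg_def Div_def mob_p_def Let_def)
  next
    case (diff D D')
    then show ?case
      using lam_act_diff[OF M(2) eta_Lam eta_Lam, of D D']
      by (simp add: Div_diff eta_diff div_act_diff deg_diff left_diff_distrib)
  qed
  then show ?thesis by simp
qed

sublocale Uinf: coeff_module "Div0Uinf_mod S"
  unfolding Div0Uinf_mod_def by (rule coeff_module_Div0)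

sublocale A0: coeff_module "Div0A0_mod S"
  unfolding Div0A0_mod_def by (rule coeff_module_Div0)

lemma eta_Z1:
  assumes "\<phi> \<in> Z1 (Div0Uinf_mod S)" shows "(\<lambda>g. eta (\<phi> g)) \<in> Z1 (Lam_mod S)"
proof -
  have \<phi>: "\<phi> g \<in> Div (Uinf S)" "deg (\<phi> g) = 0" if "g \<in> Gamma0p S" for g
    using assms that by (auto simp: Z1_def Div0Uinf_mod_def Div0_def)
  have "eta (\<phi> (g * g')) = eta (\<phi> g) + lam_act S g (eta (\<phi> g'))"
    if "g \<in> Gamma0p S" "g' \<in> Gamma0p S" for g g'
    using assms that eta_div_act[OF \<phi>(1)[OF that(2)] that(1)] \<phi>(2)[OF that(2)]
    by (simp add: Z1_def Div0Uinf_mod_def eta_add)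
  then show ?thesis using \<phi> by (simp add: Z1_def Lam_mod_def eta_Lam)
qed

lemma eta_cohomologous:
  assumes "(\<phi>, \<phi>') \<in> cohomologous (Div0Uinf_mod S)"
  shows "((\<lambda>g. eta (\<phi> g)), (\<lambda>g. eta (\<phi>' g))) \<in> cohomologous (Lam_mod S)"
proof -
  obtain v where Z: "\<phi> \<in> Z1 (Div0Uinf_mod S)" "\<phi>' \<in> Z1 (Div0Uinf_mod S)"
    and v: "v \<in> Div (Uinf S)" "deg v = 0"
    "\<And>g. g \<in> Gamma0p S \<Longrightarrow> \<phi>' g - \<phi> g = div_act S g v - v"
    using assms by (auto simp: cohomologous_def Div0Uinf_mod_def Div0_def)
  have "eta (\<phi>' g) - eta (\<phi> g) = lam_act S g (eta v) - eta v" if g: "g \<in> Gamma0p S" for g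
    using eta_div_act[OF v(1) g] v(2) by (simp add: v(3)[OF g] flip: eta_diff)
  then show ?thesis
    unfolding cohomologous_def using eta_Z1[OF Z(1)] eta_Z1[OF Z(2)] eta_Lam[OF v(1)]
    by (auto simp: Lam_mod_def)
qed

end


section \<open>The Atkin--Lehner element\<close>

locale atkin_lehner = quat_setting S
  for S :: "('f::field_char_0, 'b::ring_1, 'c::field_char_0) setting" +
  fixes \<omega> :: 'b
  assumes atkin_lehner: "atkin_lehner_elt S \<omega>"
begin

text \<open>Since conjugation by \<open>\<omega>\<close> is onto the group, 1 has the form
  \<open>\<omega> * g * ring_inv \<omega>\<close>. This gives a right inverse of
  \<open>\<omega>\<close>, which yields a two-sided one and so justifies the description in
  \<open>ring_inv\<close>.\<close>

lemma \<omega>_inverse: "\<omega> * ring_inv \<omega> = 1" "ring_inv \<omega> * \<omega> = 1"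
proof -
  have "1 \<in> (\<lambda>g. \<omega> * g * ring_inv \<omega>) ` Gamma0p S"
    using atkin_lehner one_in_Gamma0p by (simp add: atkin_lehner_elt_def)
  then obtain g where "\<omega> * (g * ring_inv \<omega>) = 1" by (auto simp: mult.assoc)
  then obtain z where z: "\<omega> * z = 1" "z * \<omega> = 1" by (rule inverse_ex_if_right_inverse)
  have "ring_inv \<omega> = z"
    unfolding ring_inv_def
  proof (rule the_equality)
    fix y assume "\<omega> * y = 1 \<and> y * \<omega> = 1"
    then show "y = z" using z by (metis mult.assoc mult.left_neutral mult.right_neutral)
  qed (use z in simp)
  then show "\<omega> * ring_inv \<omega> = 1" "ring_inv \<omega> * \<omega> = 1" using z by auto
qed

definition conj :: "'b \<Rightarrow> 'b" where
  "conj g = ring_inv \<omega> * g * \<omega>"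

lemma \<omega>_conj: "\<omega> * conj g = g * \<omega>"
  using \<omega>_inverse(1) by (simp add: conj_def flip: mult.assoc)

lemma conj_mult: "conj (g * g') = conj g * conj g'"
proof -
  have "conj g * conj g' = ring_inv \<omega> * g * (\<omega> * ring_inv \<omega>) * g' * \<omega>"
    by (simp add: conj_def mult.assoc)
  then show ?thesis by (simp add: conj_def \<omega>_inverse mult.assoc)
qed

lemma conj_Gamma0p: assumes "g \<in> Gamma0p S" shows "conj g \<in> Gamma0p S"
proof -
  have "g \<in> (\<lambda>g. \<omega> * g * ring_inv \<omega>) ` Gamma0p S"
    using atkin_lehner assms by (simp add: atkin_lehner_elt_def)
  then obtain k where k: "k \<in> Gamma0p S" "g = \<omega> * k * ring_inv \<omega>" by blast
  have "conj g = (ring_inv \<omega> * \<omega>) * k * (ring_inv \<omega> * \<omega>)"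
    by (simp add: conj_def k(2) mult.assoc)
  then show ?thesis using k(1) by (simp add: \<omega>_inverse)
qed

lemma \<omega>_matrix:
  obtains M :: "'c^2^2" where "\<And>i j. absp S (M $ i $ j) \<le> 1" "absp S (M $ 2 $ 1) \<le> q" "det M = 1"
    "\<iota> \<omega> $ 1 $ 1 = M $ 1 $ 2 * \<pi>" "\<iota> \<omega> $ 1 $ 2 = - (M $ 1 $ 1)"
    "\<iota> \<omega> $ 2 $ 1 = M $ 2 $ 2 * \<pi>" "\<iota> \<omega> $ 2 $ 2 = - (M $ 2 $ 1)"
proof -
  obtain M where "M \<in> SL2_Zp S" "M $ 2 $ 1 \<in> pZp S"
    "\<iota> \<omega> = M ** vector [vector [0, - 1], vector [\<pi>, 0]]"
    using atkin_lehner unfolding atkin_lehner_elt_def by blast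
  then show ?thesis
    using pZp_le by (intro that[of M]) (auto simp: SL2_Zp_def Zp_def matrix_mult_2)
qed

lemma \<omega>_Qp_mat: "Qp_mat (\<iota> \<omega>)"
proof -
  obtain M :: "'c^2^2" where M: "det M = 1"
    "\<iota> \<omega> $ 1 $ 1 = M $ 1 $ 2 * \<pi>" "\<iota> \<omega> $ 1 $ 2 = - (M $ 1 $ 1)"
    "\<iota> \<omega> $ 2 $ 1 = M $ 2 $ 2 * \<pi>" "\<iota> \<omega> $ 2 $ 2 = - (M $ 2 $ 1)"
    by (rule \<omega>_matrix) (rule that)
  have "det (\<iota> \<omega>) = \<pi> * det M" by (simp only: det_2 M) (simp add: algebra_simps)
  then have "det (\<iota> \<omega>) \<noteq> 0" using M(1) by simp
  moreover have "\<omega> \<in> eich_ord S" using atkin_lehner by (simp add: atkin_lehner_elt_def)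
  ultimately show ?thesis using eich_ord_Qp by (simp add: Qp_mat_def)
qed

text \<open>Determinant 1 with a small lower left entry forces |M_11| = 1. Since |z| = 1, the
  numerator then has absolute value 1 and the denominator at most q.\<close>

lemma \<omega>_A0_Uinf:
  assumes z: "z \<in> A0 S" shows "mob_p S \<omega> z \<in> Uinf S"
proof -
  obtain M :: "'c^2^2" where M: "\<And>i j. absp S (M $ i $ j) \<le> 1" "absp S (M $ 2 $ 1) \<le> q" "det M = 1"
    and \<omega>: "\<iota> \<omega> $ 1 $ 1 = M $ 1 $ 2 * \<pi>" "\<iota> \<omega> $ 1 $ 2 = - (M $ 1 $ 1)"
      "\<iota> \<omega> $ 2 $ 1 = M $ 2 $ 2 * \<pi>" "\<iota> \<omega> $ 2 $ 2 = - (M $ 2 $ 1)"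
    by (rule \<omega>_matrix) (rule that)
  have nz: "M $ 2 $ 2 * \<pi> * z - M $ 2 $ 1 \<noteq> 0"
    using mob_den_nonzero[OF \<omega>_Qp_mat A0_not_Qp[OF z]] by (simp add: \<omega>)
  have small: "absp S (x * \<pi> * z) \<le> q" if "absp S x \<le> 1" for x
    using that A0_abs[OF z] by (intro nu_mult_le[OF nu_mult_le']) auto
  have "absp S (M $ 1 $ 1 * M $ 2 $ 2) = 1"
  proof -
    have "absp S (- (M $ 1 $ 2 * M $ 2 $ 1)) \<le> q"
      using M by (simp add: nu_mult_le')
    moreover have "1 + - (- (M $ 1 $ 2 * M $ 2 $ 1)) = M $ 1 $ 1 * M $ 2 $ 2"
      using M(3) by (simp add: det_2 algebra_simps)
    ultimately show ?thesis
      using nu_add_eq[of "- (- (M $ 1 $ 2 * M $ 2 $ 1))" 1] w_less by simp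
  qed
  then have a: "absp S (M $ 1 $ 1) = 1"
    using nu_mult_le[of "M $ 1 $ 1" "absp S (M $ 1 $ 1)" "M $ 2 $ 2"] M(1) by (simp add: order_antisym)
  have num: "absp S (M $ 1 $ 2 * \<pi> * z - M $ 1 $ 1) = 1"
    using nu_add_eq[of "M $ 1 $ 2 * \<pi> * z" "- (M $ 1 $ 1)"] small[OF M(1), of 1 2] a w_less
    by simp
  have den: "absp S (M $ 2 $ 2 * \<pi> * z - M $ 2 $ 1) \<le> q"
    by (intro nu_diff_le small M)
  have pos: "0 < absp S (M $ 2 $ 2 * \<pi> * z - M $ 2 $ 1)"
    using nz nu_nonneg nu_eq_0 by (metis order_le_less)
  have "inverse q \<le> inverse (absp S (M $ 2 $ 2 * \<pi> * z - M $ 2 $ 1))"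
    using den pos by (rule le_imp_inverse_le)
  also have "\<dots> = absp S (mob_p S \<omega> z)"
    using num by (simp add: mob_p_def Let_def \<omega> nu_divide inverse_eq_divide)
  finally show ?thesis
    using mob_p_not_Qp[OF \<omega>_Qp_mat A0_not_Qp[OF z]] by (simp add: Uinf_def Hp_def)
qed

lemma \<omega>_Div0: "D \<in> Div0 (A0 S) \<Longrightarrow> div_act S \<omega> D \<in> Div0 (Uinf S)"
  using div_act_Div[of D "A0 S" S \<omega> "Uinf S"] \<omega>_A0_Uinf by (simp add: Div0_def deg_div_act)

lemma \<omega>_equivariant:
  assumes "D \<in> Div0 (A0 S)" "g \<in> Gamma0p S"
  shows "div_act S \<omega> (div_act S (conj g) D) = div_act S g (div_act S \<omega> D)"
proof (rule div_act_cong)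
  show "D \<in> Div (A0 S)" using assms(1) by (simp add: Div0_def)
  fix z assume "z \<in> A0 S"
  then have z: "z \<notin> Qp S" by (rule A0_not_Qp)
  show "mob_p S \<omega> (mob_p S (conj g) z) = mob_p S g (mob_p S \<omega> z)"
    using mob_p_mult[OF Gamma0p_Qp_mat[OF conj_Gamma0p[OF assms(2)]] z, of \<omega>]
      mob_p_mult[OF \<omega>_Qp_mat z, of g] by (simp add: \<omega>_conj)
qed

lemma Wp_eq: "Wp S \<omega> \<phi> g = div_act S \<omega> (\<phi> (conj g))"
  by (simp add: Wp_def conj_def)

lemma conj_Gamma0: "g \<in> Gamma0p S \<Longrightarrow> conj g \<in> Gamma0 S"
  using conj_Gamma0p Gamma0p_subset by blast

lemma Wp_Z1:
  assumes "\<phi> \<in> Z1 (Div0A0_mod S)" shows "Wp S \<omega> \<phi> \<in> Z1 (Div0Uinf_mod S)"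
proof -
  have \<phi>: "\<phi> (conj g) \<in> Div0 (A0 S)" if "g \<in> Gamma0p S" for g
    using assms conj_Gamma0[OF that] by (simp add: Z1_def Div0A0_mod_def)
  have "Wp S \<omega> \<phi> (g * g') = Wp S \<omega> \<phi> g + div_act S g (Wp S \<omega> \<phi> g')"
    if "g \<in> Gamma0p S" "g' \<in> Gamma0p S" for g g'
    using assms conj_Gamma0[OF that(1)] conj_Gamma0[OF that(2)] \<omega>_equivariant[OF \<phi> that(1)] that
    by (simp add: Z1_def Div0A0_mod_def Wp_eq conj_mult div_act_add)
  then show ?thesis using \<phi> \<omega>_Div0 by (simp add: Z1_def Div0Uinf_mod_def Wp_eq)
qed

lemma Wp_cohomologous:
  assumes "(\<phi>, \<phi>') \<in> cohomologous (Div0A0_mod S)"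
  shows "(Wp S \<omega> \<phi>, Wp S \<omega> \<phi>') \<in> cohomologous (Div0Uinf_mod S)"
proof -
  obtain v where Z: "\<phi> \<in> Z1 (Div0A0_mod S)" "\<phi>' \<in> Z1 (Div0A0_mod S)"
    and v: "v \<in> Div0 (A0 S)" "\<And>g. g \<in> Gamma0 S \<Longrightarrow> \<phi>' g - \<phi> g = div_act S g v - v"
    using assms by (auto simp: cohomologous_def Div0A0_mod_def)
  have "Wp S \<omega> \<phi>' g - Wp S \<omega> \<phi> g = div_act S g (div_act S \<omega> v) - div_act S \<omega> v"
    if g: "g \<in> Gamma0p S" for g
    using v(2)[OF conj_Gamma0[OF g]] \<omega>_equivariant[OF v(1) g]
    by (simp add: Wp_eq flip: div_act_diff) (simp add: div_act_diff)
  then show ?thesis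
    unfolding cohomologous_def using Wp_Z1[OF Z(1)] Wp_Z1[OF Z(2)] \<omega>_Div0[OF v(1)]
    by (auto simp: Div0Uinf_mod_def)
qed

lemma phi_Lam_class_cases:
  assumes "c0 \<in> H1 (Div0A0_mod S)"
  obtains \<theta> where "\<theta> \<in> Z1 (Lam_mod S)" "phi_Lam_class S \<omega> c0 = H1_class (Lam_mod S) \<theta>"
proof -
  obtain \<phi> where \<phi>: "\<phi> \<in> Z1 (Div0A0_mod S)" "c0 = H1_class (Div0A0_mod S) \<phi>"
    using A0.H1_cases[OF assms] by blast
  have "phi_Lam_class S \<omega> c0 = H1_class (Lam_mod S) (\<lambda>g. eta (Wp S \<omega> \<phi> g))"
    unfolding phi_Lam_class_def \<phi>(2)
    using A0.H1_map_class[OF Uinf.coeff_module_axioms \<phi>(1) Wp_cohomologous]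
      Uinf.H1_map_class[OF Lam.coeff_module_axioms Wp_Z1[OF \<phi>(1)] eta_cohomologous]
    by simp
  then show ?thesis using that eta_Z1[OF Wp_Z1[OF \<phi>(1)]] by blast
qed

end

theorem proposition5p2:
  fixes S :: "('f::field_char_0, 'b::ring_1, 'c::field_char_0) setting"
    and algK :: "'f \<Rightarrow> 'k::field_char_0"
    and Ord :: "'k set"
    and kp :: "'k \<Rightarrow> 'c"
    and \<psi> :: "'k \<Rightarrow> 'b"
    and u :: 'k
    and x :: "complex proj_line"
    and P :: "'f hecke"
    and c0 :: "('b \<Rightarrow> ('c \<Rightarrow>\<^sub>0 int)) set"
    and \<omega> hw :: 'b
    and h :: "'c set \<Rightarrow> 'b"
    and \<phi> :: "('b \<Rightarrow> 'c fps) set"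
  assumes "quaternionic_setting S"
    and "quadratic_extension S algK"
    and "is_order algK Ord"
    and "generates_free_part (relative_norm_one_units algK Ord) u"
    and "ring_hom_on_type kp" and "kp \<circ> algK = jp S"
    and "\<psi> \<in> optimal_embeddings S algK Ord"
    and "tau_p S kp \<psi> \<in> A0 S"
    and "iota_inf S (\<psi> u) $ 2 $ 1 \<noteq> 0"
    and "base_point S (\<psi> u) x"
    and "degree_zero_lift S (phi_class S kp \<psi> u x) P c0"
    and "atkin_lehner_elt S \<omega>"
    and "Up_reps S hw h"
    and "\<phi> = phi_Lam_class S \<omega> c0"
  shows "\<exists>\<Phi>plus \<Phi>minus.
      series_defines_class S (\<lambda>n \<theta>. (Up S h ^^ n) \<theta>) \<phi> \<Phi>plus \<and>
      series_defines_class S (\<lambda>n \<theta> \<gamma>. (- 1) ^ Suc n * (Up S h ^^ n) \<theta> \<gamma>) \<phi> \<Phi>minus \<and>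
      H1_add (Lam_mod S) (H1_map (Lam_mod S) (Up S h) \<Phi>plus) \<phi> = \<Phi>plus \<and>
      H1_add (Lam_mod S) (H1_map (Lam_mod S) (Up S h) \<Phi>minus) \<phi> = H1_minus (Lam_mod S) \<Phi>minus"
proof -
  interpret atkin_lehner S \<omega> by unfold_locales (use assms in auto)
  interpret Up_setting S hw h by unfold_locales (use assms in auto)
  \<comment> \<open>Being a class with values in divisors of degree zero, \<open>c0\<close> has a
    representing cocycle, which \<open>Wp\<close> and \<open>eta\<close> carry to \<Lambda>.\<close>
  have "c0 \<in> H1 (Div0A0_mod S)" using assms(11) by (simp add: degree_zero_lift_def)
  then obtain \<theta> where "\<theta> \<in> Z1 (Lam_mod S)" "\<phi> = H1_class (Lam_mod S) \<theta>"
    using phi_Lam_class_cases assms(14) by metis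
  then show ?thesis using series_define_classes by simp
qed

end
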